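(* Let $p\in[1,\infty]$ and let $\mathbf{s}=(s_n)_{n=1}^\infty$ be an increasing weight whose discrete derivative is essentially decreasing. Assume that \[ \inf_{n\in\mathbb{N}}\ \sup_{k\in\mathbb{N}} \frac{s_k}{s_{kn}}=0 . \] Let $\mathbb{Y}$ be either $m(\mathbf{s})$ or $\ell_p(m(\mathbf{s}))$. Then, if $T$ is a bounded linear operator on $\mathbb{Y}$, the identity map on $\mathbb{Y}$ factors through either $T$ or $\mathrm{Id}_{\mathbb{Y}}-T$. Consequently, $\ell_p(m(\mathbf{s}))$ is a primary Banach space.
   Context: $\mathbb{F}$ is the real or complex field. A weight is a sequence of positive scalars. The discrete derivative of $\mathbf{s}=(s_n)_{n=1}^\infty$ is the weight $\mathbf{w}=(w_j)_{j=1}^\infty$ with $s_n=\sum_{j=1}^n w_j$ for all $n\in\mathbb{N}$. A weight $(w_n)_{n=1}^\infty$ is essentially decreasing if $\inf_{m\le n} w_m/w_n>0$. The Marcinkiewicz space $m(\mathbf{s})$ is the Banach space of all $f=(a_j)_{j=1}^\infty\in\mathbb{F}^{\mathbb{N}}$ such that $\|f\|_{m(\mathbf{s})}:=\sup\{ \frac{1}{s_n}\sum_{j\in A}|a_j| : n\in\mathbb{N},\ A\subseteq\mathbb{N},\ |A|=n\}<\infty$. $\ell_p(\mathbb{X})$ is the infinite direct sum of $\mathbb{X}$ in the sense of $\ell_p$, i.e. the space of sequences $(f_n)_{n=1}^\infty$ in $\mathbb{X}$ with $(\|f_n\|)_{n=1}^\infty\in\ell_p$, normed by $\|(\|f_n\|)_n\|_p$.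 The identity map on $\mathbb{Y}$ factors through a bounded linear operator $R\colon\mathbb{Y}\to\mathbb{Y}$ if there are bounded linear operators $S,U\colon\mathbb{Y}\to\mathbb{Y}$ with $U\circ R\circ S=\mathrm{Id}_{\mathbb{Y}}$. A Banach space $\mathbb{X}$ is primary if whenever $\mathbb{V}$ and $\mathbb{W}$ are Banach spaces with $\mathbb{V}\oplus\mathbb{W}$ isomorphic to $\mathbb{X}$, then $\mathbb{V}$ or $\mathbb{W}$ is isomorphic to $\mathbb{X}$. *)

theory Defs
  imports "HOL-Analysis.Analysis" "HOL-Library.Function_Algebras"
begin

(* The scalar field 'f always has sort {real_normed_field, euclidean_space}. Both real and complex
   are instances, and by the theorem of Frobenius every field in this sort is isometrically
   isomorphic to one of them. *)


section \<open>Normed spaces with an explicit carrier\<close>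

(* Addition is that of the ambient type; the ambient vector space may be larger than the carrier,
   and the norm is only meaningful on the carrier. *)
record ('f, 'v) nspace =
  car :: "'v set"
  scl :: "'f \<Rightarrow> 'v \<Rightarrow> 'v"
  nrm :: "'v \<Rightarrow> real"

definition normed_space ::
    "('f::{real_normed_field, euclidean_space}, 'v::ab_group_add) nspace \<Rightarrow> bool" where
  "normed_space X \<longleftrightarrow>
     vector_space (scl X) \<and> module.subspace (scl X) (car X) \<and>
     (\<forall>x\<in>car X. 0 \<le> nrm X x \<and> (nrm X x = 0 \<longleftrightarrow> x = 0)) \<and>
     (\<forall>c. \<forall>x\<in>car X. nrm X (scl X c x) = norm c * nrm X x) \<and>
     (\<forall>x\<in>car X. \<forall>y\<in>car X. nrm X (x + y) \<le> nrm X x + nrm X y)"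

definition banach_space ::
    "('f::{real_normed_field, euclidean_space}, 'v::ab_group_add) nspace \<Rightarrow> bool" where
  "banach_space X \<longleftrightarrow>
     normed_space X \<and>
     (\<forall>x :: nat \<Rightarrow> 'v.
        (\<forall>n. x n \<in> car X) \<and> (\<forall>e>0. \<exists>N. \<forall>m\<ge>N. \<forall>n\<ge>N. nrm X (x m - x n) < e) \<longrightarrow>
        (\<exists>l\<in>car X. (\<lambda>n. nrm X (x n - l)) \<longlonglongrightarrow> 0))"

(* Operators are functions on the ambient type of which only the values on the carrier matter. *)
definition bounded_operator ::
    "('f, 'v::ab_group_add) nspace \<Rightarrow> ('f, 'w::ab_group_add) nspace \<Rightarrow> ('v \<Rightarrow> 'w) \<Rightarrow> bool" where
  "bounded_operator X Y T \<longleftrightarrow>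
     (\<forall>x\<in>car X. T x \<in> car Y) \<and>
     (\<forall>x\<in>car X. \<forall>y\<in>car X. T (x + y) = T x + T y) \<and>
     (\<forall>c. \<forall>x\<in>car X. T (scl X c x) = scl Y c (T x)) \<and>
     (\<exists>K. \<forall>x\<in>car X. nrm Y (T x) \<le> K * nrm X x)"

definition isomorphic ::
    "('f, 'v::ab_group_add) nspace \<Rightarrow> ('f, 'w::ab_group_add) nspace \<Rightarrow> bool" where
  "isomorphic X Y \<longleftrightarrow>
     (\<exists>T S. bounded_operator X Y T \<and> bounded_operator Y X S \<and>
            (\<forall>x\<in>car X. S (T x) = x) \<and> (\<forall>y\<in>car Y. T (S y) = y))"

definition identity_factors_through ::
    "('f, 'v::ab_group_add) nspace \<Rightarrow> ('v \<Rightarrow> 'v) \<Rightarrow> bool" where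
  "identity_factors_through Y R \<longleftrightarrow>
     (\<exists>S U. bounded_operator Y Y S \<and> bounded_operator Y Y U \<and> (\<forall>x\<in>car Y. U (R (S x)) = x))"

(* The choice of the norm on the sum is immaterial up to isomorphism. *)
definition direct_sum ::
    "('f, 'v) nspace \<Rightarrow> ('f, 'w) nspace \<Rightarrow> ('f, 'v \<times> 'w) nspace" where
  "direct_sum V W =
     \<lparr> car = car V \<times> car W,
       scl = (\<lambda>c (v, w). (scl V c v, scl W c w)),
       nrm = (\<lambda>(v, w). nrm V v + nrm W w) \<rparr>"

(* HOL cannot quantify over types inside a formula, so the ambient types of the two summands are
   parameters; a theorem with 'v and 'w left schematic covers all Banach spaces V and W. *)
definition primary ::
    "'v::ab_group_add itself \<Rightarrow> 'w::ab_group_add itself \<Rightarrow>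
     ('f::{real_normed_field, euclidean_space}, 'x::ab_group_add) nspace \<Rightarrow> bool" where
  "primary (_ :: 'v itself) (_ :: 'w itself) X \<longleftrightarrow>
     banach_space X \<and>
     (\<forall>(V :: ('f, 'v) nspace) (W :: ('f, 'w) nspace).
        banach_space V \<and> banach_space W \<and> isomorphic (direct_sum V W) X \<longrightarrow>
        isomorphic V X \<or> isomorphic W X)"


section \<open>Weights\<close>

(* Weights are indexed from 1; the value at 0 is irrelevant. *)
definition weight :: "(nat \<Rightarrow> real) \<Rightarrow> bool" where
  "weight s \<longleftrightarrow> (\<forall>n\<ge>1. 0 < s n)"

definition discrete_derivative :: "(nat \<Rightarrow> real) \<Rightarrow> (nat \<Rightarrow> real) \<Rightarrow> bool" where
  "discrete_derivative s w \<longleftrightarrow> weight w \<and> (\<forall>n\<ge>1. s n = (\<Sum>j=1..n. w j))"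

definition essentially_decreasing :: "(nat \<Rightarrow> real) \<Rightarrow> bool" where
  "essentially_decreasing w \<longleftrightarrow>
     (INF (m, n) \<in> {(m, n). 1 \<le> m \<and> m \<le> n}. w m / w n) > 0"


section \<open>Marcinkiewicz spaces and infinite direct sums\<close>

definition marcinkiewicz_averages ::
    "(nat \<Rightarrow> real) \<Rightarrow> (nat \<Rightarrow> 'f::real_normed_field) \<Rightarrow> real set" where
  "marcinkiewicz_averages s f =
     {(1 / s n) * (\<Sum>j\<in>A. norm (f j)) | n A. 1 \<le> n \<and> finite A \<and> card A = n}"

(* Unlike the weights, the elements are indexed from 0; the norm depends on the index set
   only through the cardinalities of its finite subsets. *)
definition marcinkiewicz ::
    "(nat \<Rightarrow> real) \<Rightarrow> ('f::{real_normed_field, euclidean_space}, nat \<Rightarrow> 'f) nspace" where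
  "marcinkiewicz s =
     \<lparr> car = {f. bdd_above (marcinkiewicz_averages s f)},
       scl = (\<lambda>c f j. c * f j),
       nrm = (\<lambda>f. Sup (marcinkiewicz_averages s f)) \<rparr>"

definition in_lp :: "ereal \<Rightarrow> (nat \<Rightarrow> real) \<Rightarrow> bool" where
  "in_lp p a \<longleftrightarrow>
     (if p = \<infinity> then bdd_above (range (\<lambda>n. \<bar>a n\<bar>))
      else summable (\<lambda>n. \<bar>a n\<bar> powr real_of_ereal p))"

definition lp_norm :: "ereal \<Rightarrow> (nat \<Rightarrow> real) \<Rightarrow> real" where
  "lp_norm p a =
     (if p = \<infinity> then (SUP n. \<bar>a n\<bar>)
      else (\<Sum>n. \<bar>a n\<bar> powr real_of_ereal p) powr (1 / real_of_ereal p))"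

definition lp_sum :: "ereal \<Rightarrow> ('f, 'v) nspace \<Rightarrow> ('f, nat \<Rightarrow> 'v) nspace" where
  "lp_sum p X =
     \<lparr> car = {f. (\<forall>n. f n \<in> car X) \<and> in_lp p (\<lambda>n. nrm X (f n))},
       scl = (\<lambda>c f n. scl X c (f n)),
       nrm = (\<lambda>f. lp_norm p (\<lambda>n. nrm X (f n))) \<rparr>"

end

theory Submission
  imports Defs
begin

text \<open>The hypothesis on \<open>s\<close> says that the norm of a sum of \<open>N\<close> disjointly supported elements of the unit ball of
  \<open>m(s)\<close> is \<open>o(N)\<close>. Hence a functional has small norm on the elements supported in a suitable infinite subset of
  any infinite set of coordinates. Given an operator \<open>T\<close> on \<open>\<ell>\<^sub>p(m(s))\<close>, infinitely many rows contain infinitely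
  many coordinates at which the diagonal entries of \<open>T\<close>, or those of \<open>Id - T\<close>, are at least 1/2 in modulus.
  Choosing coordinates inductively, the entries above the diagonal are made small with the functionals, and those
  below it by replacing a coordinate functional by the difference of two in the same row. The compression
  of the operator to the chosen coordinates is then a small perturbation of an invertible diagonal operator. Applied to
  operators acting row by row this gives the result for \<open>m(s)\<close>, and Pelczynski's decomposition method
  gives primariness.\<close>

section \<open>Normed spaces with an explicit carrier\<close>

text \<open>Finitely supported elements need not be dense in \<open>m(s)\<close>: for
  \<open>s n = n\<close> it is \<open>\<ell>\<^sub>\<infinity>\<close>. So an operator is not
  determined by its matrix, and smallness of single entries says nothing about the part above the
  diagonal. This is why a functional has to be small on every element supported in the coordinates
  still available, and why an element is only ever split into the finitely many coordinates chosen
  so far and a remainder. The estimate for disjoint sums combines two facts about \<open>s\<close>: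
  \<open>s n / n\<close> decreases up to a constant, since the derivative is essentially decreasing,
  and \<open>s k \<le> \<eta> * s (k * N)\<close> for some \<open>N\<close>, by the assumption on
  the infimum. The threshold 1/2 comes from \<open>1 \<le> norm x + norm (1 - x)\<close>. Errors are
  added up without a basis: the error at entry \<open>(k, j)\<close> is at most a small multiple of
  the entry of one fixed element, \<open>geometric\<close>, and the norm is monotone in the moduli
  of the entries.\<close>

lemma normed_spaceD:
  assumes "normed_space X"
  shows nspace_vs: "vector_space (scl X)"
    and nspace_zero: "0 \<in> car X"
    and nspace_add: "\<And>x y. x \<in> car X \<Longrightarrow> y \<in> car X \<Longrightarrow> x + y \<in> car X"
    and nspace_scl: "\<And>c x. x \<in> car X \<Longrightarrow> scl X c x \<in> car X"
    and nspace_nonneg: "\<And>x. x \<in> car X \<Longrightarrow> 0 \<le> nrm X x"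
    and nspace_eq0: "\<And>x. x \<in> car X \<Longrightarrow> nrm X x = 0 \<longleftrightarrow> x = 0"
    and nspace_nscl: "\<And>c x. x \<in> car X \<Longrightarrow> nrm X (scl X c x) = norm c * nrm X x"
    and nspace_tri: "\<And>x y. x \<in> car X \<Longrightarrow> y \<in> car X \<Longrightarrow> nrm X (x + y) \<le> nrm X x + nrm X y"
proof -
  show vs: "vector_space (scl X)" using assms unfolding normed_space_def by blast
  then have "module (scl X)" by (simp add: module_iff_vector_space)
  then have "0 \<in> car X \<and> (\<forall>x\<in>car X. \<forall>y\<in>car X. x + y \<in> car X) \<and> (\<forall>c. \<forall>x\<in>car X. scl X c x \<in> car X)"
    using assms module.subspace_def[of "scl X" "car X"] unfolding normed_space_def by simp
  then show "0 \<in> car X" "\<And>x y. x \<in> car X \<Longrightarrow> y \<in> car X \<Longrightarrow> x + y \<in> car X"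
     "\<And>c x. x \<in> car X \<Longrightarrow> scl X c x \<in> car X" by auto
qed (use assms in \<open>unfold normed_space_def, blast+\<close>)

lemma nspace_scl_laws:
  assumes "normed_space X"
  shows "scl X c (x + y) = scl X c x + scl X c y"
    and "scl X (c + d) x = scl X c x + scl X d x"
    and "scl X c (scl X d x) = scl X (c * d) x"
    and "scl X 1 x = x"
  using nspace_vs[OF assms] unfolding vector_space_def by auto

lemma nspace_scl_minus:
  assumes "normed_space X"
  shows "scl X (-1) x = - x"
proof -
  have "scl X 0 x = 0" using nspace_scl_laws(2)[OF assms, of 0 0 x] by simp
  then show ?thesis
    using nspace_scl_laws(2)[OF assms, of "-1" 1 x] nspace_scl_laws(4)[OF assms, of x]
    by (simp add: eq_neg_iff_add_eq_0)
qed

lemma nspace_minus: "normed_space X \<Longrightarrow> x \<in> car X \<Longrightarrow> - x \<in> car X"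
  using nspace_scl nspace_scl_minus by metis

lemma nspace_diff: "normed_space X \<Longrightarrow> x \<in> car X \<Longrightarrow> y \<in> car X \<Longrightarrow> x - y \<in> car X"
  using nspace_minus nspace_add by (metis diff_conv_add_uminus)

lemma nspace_nrm_minus: "normed_space X \<Longrightarrow> x \<in> car X \<Longrightarrow> nrm X (- x) = nrm X x"
  using nspace_nscl[of X x "-1"] nspace_scl_minus[of X x] by simp

lemma nspace_nrm_diff_commute:
  "normed_space X \<Longrightarrow> x \<in> car X \<Longrightarrow> y \<in> car X \<Longrightarrow> nrm X (x - y) = nrm X (y - x)"
  using nspace_nrm_minus[of X "x - y"] nspace_diff[of X x y] by simp

lemma nspace_tri_diff:
  assumes "normed_space X" "x \<in> car X" "y \<in> car X"
  shows "nrm X x \<le> nrm X y + nrm X (x - y)"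
  using nspace_tri[OF assms(1,3) nspace_diff[OF assms]] by simp

lemma nspace_tri_diff2:
  assumes "normed_space X" "x \<in> car X" "y \<in> car X"
  shows "nrm X (x - y) \<le> nrm X x + nrm X y"
  using nspace_tri[OF assms(1,2) nspace_minus[OF assms(1,3)]] nspace_nrm_minus[OF assms(1,3)] by simp

lemma nspace_nrm_zero: "normed_space X \<Longrightarrow> nrm X 0 = 0"
  using nspace_eq0 nspace_zero by blast

lemma nspace_scl_zero: "normed_space X \<Longrightarrow> scl X c 0 = 0"
  using nspace_scl_laws(1)[of X c 0 0] by simp

lemma nspace_sum:
  assumes "normed_space X" "\<And>i. i \<in> I \<Longrightarrow> f i \<in> car X"
  shows "(\<Sum>i\<in>I. f i) \<in> car X"
  using assms(2) by (induction I rule: infinite_finite_induct)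
     (auto intro: nspace_add[OF assms(1)] nspace_zero[OF assms(1)])

lemma normed_spaceI:
  assumes "vector_space (scl X)" "0 \<in> car X"
    "\<And>x y. x \<in> car X \<Longrightarrow> y \<in> car X \<Longrightarrow> x + y \<in> car X"
    "\<And>c x. x \<in> car X \<Longrightarrow> scl X c x \<in> car X"
    "\<And>x. x \<in> car X \<Longrightarrow> 0 \<le> nrm X x"
    "\<And>x. x \<in> car X \<Longrightarrow> nrm X x = 0 \<longleftrightarrow> x = 0"
    "\<And>c x. x \<in> car X \<Longrightarrow> nrm X (scl X c x) = norm c * nrm X x"
    "\<And>x y. x \<in> car X \<Longrightarrow> y \<in> car X \<Longrightarrow> nrm X (x + y) \<le> nrm X x + nrm X y"
  shows "normed_space X"
proof -
  have "module (scl X)" using assms(1) by (simp add: module_iff_vector_space)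
  then have "module.subspace (scl X) (car X)" using assms by (simp add: module.subspace_def)
  then show ?thesis using assms unfolding normed_space_def by blast
qed

section \<open>Bounded operators\<close>

lemma bounded_operatorD:
  assumes "bounded_operator X Y T"
  shows bop_car: "\<And>x. x \<in> car X \<Longrightarrow> T x \<in> car Y"
    and bop_add: "\<And>x y. x \<in> car X \<Longrightarrow> y \<in> car X \<Longrightarrow> T (x + y) = T x + T y"
    and bop_scl: "\<And>c x. x \<in> car X \<Longrightarrow> T (scl X c x) = scl Y c (T x)"
  using assms unfolding bounded_operator_def by auto

lemma bop_bound:
  assumes "normed_space X" "bounded_operator X Y T"
  obtains K where "K > 0" "\<And>x. x \<in> car X \<Longrightarrow> nrm Y (T x) \<le> K * nrm X x"
proof -
  obtain K where K: "\<And>x. x \<in> car X \<Longrightarrow> nrm Y (T x) \<le> K * nrm X x"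
    using assms(2) unfolding bounded_operator_def by blast
  show thesis
  proof (rule that[of "max K 1"])
    fix x assume x: "x \<in> car X"
    have "K * nrm X x \<le> max K 1 * nrm X x" using nspace_nonneg[OF assms(1) x] by (intro mult_right_mono) auto
    then show "nrm Y (T x) \<le> max K 1 * nrm X x" using K[OF x] by linarith
  qed auto
qed

lemma bounded_operatorI:
  assumes "\<And>x. x \<in> car X \<Longrightarrow> T x \<in> car Y"
    and "\<And>x y. x \<in> car X \<Longrightarrow> y \<in> car X \<Longrightarrow> T (x + y) = T x + T y"
    and "\<And>c x. x \<in> car X \<Longrightarrow> T (scl X c x) = scl Y c (T x)"
    and "\<And>x. x \<in> car X \<Longrightarrow> nrm Y (T x) \<le> K * nrm X x"
  shows "bounded_operator X Y T"
  using assms unfolding bounded_operator_def by blast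

lemma bop_zero:
  assumes "normed_space X" "bounded_operator X Y T"
  shows "T 0 = 0"
  using bop_add[OF assms(2), of 0 0] nspace_zero[OF assms(1)] by simp

lemma bop_minus:
  assumes "normed_space X" "normed_space Y" "bounded_operator X Y T" "x \<in> car X"
  shows "T (- x) = - T x"
  using bop_scl[OF assms(3,4), of "-1"] by (simp add: nspace_scl_minus assms(1,2))

lemma bop_diff:
  assumes "normed_space X" "normed_space Y" "bounded_operator X Y T" "x \<in> car X" "y \<in> car X"
  shows "T (x - y) = T x - T y"
  using bop_add[OF assms(3,4) nspace_minus[OF assms(1,5)]] bop_minus[OF assms(1-3,5)] by simp

lemma bop_sum:
  assumes "normed_space X" "bounded_operator X Y T" "\<And>i. i \<in> I \<Longrightarrow> f i \<in> car X"
  shows "T (\<Sum>i\<in>I. f i) = (\<Sum>i\<in>I. T (f i))"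
  using assms(3)
  by (induction I rule: infinite_finite_induct)
     (auto simp: bop_zero[OF assms(1,2)] bop_add[OF assms(2)] nspace_sum[OF assms(1)])

lemma bop_compose:
  assumes "normed_space X" "normed_space Y" "bounded_operator X Y T" "bounded_operator Y Z S"
  shows "bounded_operator X Z (\<lambda>x. S (T x))"
proof -
  obtain K where K: "K > 0" "\<And>x. x \<in> car X \<Longrightarrow> nrm Y (T x) \<le> K * nrm X x" using bop_bound[OF assms(1,3)] by blast
  obtain J where J: "J > 0" "\<And>x. x \<in> car Y \<Longrightarrow> nrm Z (S x) \<le> J * nrm Y x" using bop_bound[OF assms(2,4)] by blast
  show ?thesis
  proof (rule bounded_operatorI[where K = "J * K"])
    fix x assume x: "x \<in> car X"
    have "nrm Z (S (T x)) \<le> J * nrm Y (T x)" using J(2) bop_car[OF assms(3) x] by blast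
    also have "\<dots> \<le> J * (K * nrm X x)" using K(2)[OF x] J(1) by (intro mult_left_mono) auto
    finally show "nrm Z (S (T x)) \<le> J * K * nrm X x" by (simp add: mult.assoc)
  qed (use assms in \<open>auto simp: bop_car bop_add bop_scl\<close>)
qed

lemma bop_id: "bounded_operator X X (\<lambda>x. x)"
  by (rule bounded_operatorI[where K = 1]) auto

lemma bop_operator_diff:
  assumes X: "normed_space X" and Y: "normed_space Y"
    and T: "bounded_operator X Y T" and S: "bounded_operator X Y S"
  shows "bounded_operator X Y (\<lambda>x. T x - S x)"
proof -
  obtain K where K: "K > 0" "\<And>x. x \<in> car X \<Longrightarrow> nrm Y (T x) \<le> K * nrm X x" using bop_bound[OF X T] by blast
  obtain J where J: "J > 0" "\<And>x. x \<in> car X \<Longrightarrow> nrm Y (S x) \<le> J * nrm X x" using bop_bound[OF X S] by blast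
  show ?thesis
  proof (rule bounded_operatorI[where K = "K + J"])
    fix x assume x: "x \<in> car X"
    note c = bop_car[OF T x] bop_car[OF S x]
    show "T (scl X r x) - S (scl X r x) = scl Y r (T x - S x)" for r
      using nspace_scl_laws(1)[OF Y, of r "T x - S x" "S x"] unfolding bop_scl[OF T x] bop_scl[OF S x]
      by (simp add: eq_diff_eq)
    show "nrm Y (T x - S x) \<le> (K + J) * nrm X x"
      using nspace_tri_diff2[OF Y c] K(2)[OF x] J(2)[OF x] by (simp add: algebra_simps)
    show "T x - S x \<in> car Y" using nspace_diff[OF Y c] .
  qed (simp add: bop_add[OF T] bop_add[OF S])
qed

lemmas bop_id_minus = bop_operator_diff[OF _ _ bop_id]

text \<open>The inverse comes from the fixed points of the contractions \<open>x \<mapsto> y + (x - G x)\<close>.\<close>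

lemma near_identity_left_inverse:
  assumes X: "banach_space X" and G: "bounded_operator X X G"
    and near: "\<And>x. x \<in> car X \<Longrightarrow> nrm X (G x - x) \<le> 1/2 * nrm X x"
  obtains V where "bounded_operator X X V" "\<And>x. x \<in> car X \<Longrightarrow> V (G x) = x"
proof -
  have ns: "normed_space X" using X unfolding banach_space_def by blast
  note car = nspace_add[OF ns] nspace_diff[OF ns] bop_car[OF G]
  \<comment> \<open>From \<open>nrm X x \<le> nrm X (G x) + nrm X (x - G x)\<close>. It yields
    injectivity now and the bound 2 for the inverse later.\<close>
  have lower: "nrm X x \<le> 2 * nrm X (G x)" if x: "x \<in> car X" for x
    using nspace_tri_diff[OF ns x bop_car[OF G x]] near[OF x] nspace_nrm_diff_commute[OF ns x bop_car[OF G x]]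
    by linarith
  have inj: "x = y" if "x \<in> car X" "y \<in> car X" "G x = G y" for x y
  proof -
    have d: "x - y \<in> car X" using that car by blast
    have "nrm X (x - y) \<le> 0"
      using lower[OF d] that bop_diff[OF ns ns G] nspace_nrm_zero[OF ns] by simp
    then have "nrm X (x - y) = 0" using nspace_nonneg[OF ns d] by linarith
    then show ?thesis using nspace_eq0[OF ns d] by simp
  qed
  have surj: "\<exists>x\<in>car X. G x = y" if y: "y \<in> car X" for y
  proof -
    define h where "h x = y + (x - G x)" for x
    define z where "z n = (h ^^ n) 0" for n
    have z: "z n \<in> car X" for n
      by (induction n) (auto simp: z_def h_def y nspace_zero[OF ns] car)
    have zS: "z (Suc n) = h (z n)" for n by (simp add: z_def)
    have contr: "nrm X (h a - h b) \<le> 1/2 * nrm X (a - b)" if "a \<in> car X" "b \<in> car X" for a b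
    proof -
      have "h a - h b = (a - b) - G (a - b)" using that by (simp add: h_def bop_diff[OF ns ns G])
      then show ?thesis
        using near[of "a - b"] nspace_nrm_diff_commute[OF ns, of "a - b" "G (a - b)"] that car by simp
    qed
    have step: "nrm X (z (Suc n) - z n) \<le> nrm X y * (1/2) ^ n" for n
    proof (induction n)
      case 0 then show ?case by (simp add: z_def h_def bop_zero[OF ns G])
    next
      case (Suc n)
      have "nrm X (z (Suc (Suc n)) - z (Suc n)) \<le> 1/2 * nrm X (z (Suc n) - z n)"
        using contr[OF z z] zS by metis
      then show ?case using Suc by simp
    qed
    \<comment> \<open>\<open>2 - 2 * (1/2) ^ d\<close> is the sum of the first \<open>d\<close>
      powers of 1/2; keeping its exact value lets the induction close.\<close>
    have tail: "nrm X (z (m + d) - z m) \<le> nrm X y * (1/2) ^ m * (2 - 2 * (1/2) ^ d)" for m d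
    proof (induction d)
      case 0 then show ?case by (simp add: nspace_nrm_zero[OF ns])
    next
      case (Suc d)
      have "nrm X (z (m + Suc d) - z m) \<le> nrm X (z (m + d) - z m) + nrm X (z (Suc (m + d)) - z (m + d))"
        using nspace_tri[OF ns, of "z (m + d) - z m" "z (Suc (m + d)) - z (m + d)"] z car by simp
      also have "\<dots> \<le> nrm X y * (1/2) ^ m * (2 - 2 * (1/2) ^ d) + nrm X y * (1/2) ^ (m + d)"
        using Suc step[of "m + d"] by linarith
      also have "\<dots> = nrm X y * (1/2) ^ m * (2 - 2 * (1/2) ^ Suc d)"
        by (simp add: power_add algebra_simps)
      finally show ?case .
    qed
    have tail': "nrm X (z n - z m) \<le> 2 * nrm X y * (1/2) ^ m" if "m \<le> n" for m n
    proof -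
      have "nrm X y * (1/2) ^ m * (2 - 2 * (1/2) ^ (n - m)) \<le> nrm X y * (1/2) ^ m * 2"
        using nspace_nonneg[OF ns y] by (intro mult_left_mono) auto
      then show ?thesis using tail[of m "n - m"] that by simp
    qed
    have lim: "(\<lambda>m. 2 * nrm X y * (1/2) ^ m) \<longlonglongrightarrow> 0"
      by (intro tendsto_mult_right_zero LIMSEQ_power_zero) auto
    have "\<exists>N. \<forall>m\<ge>N. \<forall>n\<ge>N. nrm X (z m - z n) < e" if e: "e > 0" for e
    proof -
      obtain N where N: "\<And>m. m \<ge> N \<Longrightarrow> 2 * nrm X y * (1/2) ^ m < e"
        using order_tendstoD(2)[OF lim e] unfolding eventually_sequentially by blast
      have "nrm X (z m - z n) < e" if "m \<ge> N" "n \<ge> N" for m n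
      proof (cases "n \<le> m")
        case True then show ?thesis using tail'[OF True] N[of n] that by linarith
      next
        case False
        then show ?thesis using tail'[of m n] N[of m] that nspace_nrm_diff_commute[OF ns z z, of n m] by fastforce
      qed
      then show ?thesis by blast
    qed
    then obtain l where l: "l \<in> car X" "(\<lambda>n. nrm X (z n - l)) \<longlonglongrightarrow> 0"
      using X z unfolding banach_space_def by blast
    \<comment> \<open>Here \<open>y - G l = h l - l\<close>; inserting
      \<open>h (z n) = z (Suc n)\<close> and using the contraction bounds it by terms that tend to
      0.\<close>
    have "nrm X (y - G l) \<le> 3/2 * nrm X (z n - l) + nrm X (z (Suc n) - l)" for n
    proof -
      note c = z[of n] z[of "Suc n"] l(1) y
      have eq: "y - G l = (h l - h (z n)) + ((z (Suc n) - l))" by (simp add: zS h_def)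
      have hc: "h l \<in> car X" "h (z n) \<in> car X" using c car unfolding h_def by simp_all
      show ?thesis using nspace_tri[OF ns, of "h l - h (z n)" "z (Suc n) - l"] contr[OF l(1) z[of n]] eq c hc car
          nspace_nrm_diff_commute[OF ns z[of n] l(1)] nspace_nonneg[OF ns, of "z n - l"] by auto
    qed
    moreover have "(\<lambda>n. 3/2 * nrm X (z n - l) + nrm X (z (Suc n) - l)) \<longlonglongrightarrow> 3/2 * 0 + 0"
      by (intro tendsto_intros l(2) LIMSEQ_Suc[OF l(2)])
    ultimately have "nrm X (y - G l) \<le> 0" by (intro LIMSEQ_le_const) auto
    moreover have d: "y - G l \<in> car X" using y l(1) car by blast
    ultimately have "y - G l = 0" using nspace_eq0[OF ns d] nspace_nonneg[OF ns d] by linarith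
    then show ?thesis using l(1) by auto
  qed
  define V where "V y = (THE x. x \<in> car X \<and> G x = y)" for y
  have VG: "V (G x) = x" if "x \<in> car X" for x
    unfolding V_def using that inj by (intro the_equality) auto
  have V: "V y \<in> car X \<and> G (V y) = y" if "y \<in> car X" for y
    using surj[OF that] VG by force
  have "bounded_operator X X V"
  proof (rule bounded_operatorI[where K = 2])
    fix x y assume "x \<in> car X" "y \<in> car X"
    then show "V (x + y) = V x + V y" using V VG[of "V x + V y"] bop_add[OF G] car by metis
  next
    fix c x assume "x \<in> car X"
    then show "V (scl X c x) = scl X c (V x)"
      using V VG[of "scl X c (V x)"] bop_scl[OF G] nspace_scl[OF ns] by metis
  next
    fix x assume "x \<in> car X" then show "nrm X (V x) \<le> 2 * nrm X x" using V lower by metis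
  qed (use V in blast)
  then show thesis using that VG by blast
qed

section \<open>Isomorphisms and direct sums\<close>

lemma isomorphicI:
  assumes "bounded_operator X Y T" "bounded_operator Y X S"
    "\<And>x. x \<in> car X \<Longrightarrow> S (T x) = x" "\<And>y. y \<in> car Y \<Longrightarrow> T (S y) = y"
  shows "isomorphic X Y"
  using assms unfolding isomorphic_def by blast

lemma isomorphic_refl: "isomorphic X X"
  by (rule isomorphicI[OF bop_id bop_id]) auto

lemma isomorphic_sym: "isomorphic X Y \<Longrightarrow> isomorphic Y X"
  unfolding isomorphic_def by blast

lemma isomorphic_trans:
  assumes ns: "normed_space X" "normed_space Y" "normed_space Z"
    and "isomorphic X Y" "isomorphic Y Z"
  shows "isomorphic X Z"
proof -
  obtain T S where a: "bounded_operator X Y T" "bounded_operator Y X S"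
    "\<forall>x\<in>car X. S (T x) = x" "\<forall>y\<in>car Y. T (S y) = y" using assms(4) unfolding isomorphic_def by blast
  obtain T' S' where b: "bounded_operator Y Z T'" "bounded_operator Z Y S'"
    "\<forall>x\<in>car Y. S' (T' x) = x" "\<forall>y\<in>car Z. T' (S' y) = y" using assms(5) unfolding isomorphic_def by blast
  show ?thesis
    by (rule isomorphicI[OF bop_compose[OF ns(1,2) a(1) b(1)] bop_compose[OF ns(3,2) b(2) a(2)]])
       (use a b in \<open>auto simp: bop_car\<close>)
qed

lemma direct_sum_simps [simp]:
  "car (direct_sum V W) = car V \<times> car W"
  "scl (direct_sum V W) c (v, w) = (scl V c v, scl W c w)"
  "nrm (direct_sum V W) (v, w) = nrm V v + nrm W w"
  by (simp_all add: direct_sum_def)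

lemma normed_space_direct_sum:
  assumes V: "normed_space V" and W: "normed_space W"
  shows "normed_space (direct_sum V W)"
proof (rule normed_spaceI)
  show "vector_space (scl (direct_sum V W))"
    by unfold_locales (auto simp: nspace_scl_laws[OF V] nspace_scl_laws[OF W] direct_sum_def)
  fix x y assume x: "x \<in> car (direct_sum V W)"
  show "nrm (direct_sum V W) x = 0 \<longleftrightarrow> x = 0"
    using x nspace_nonneg[OF V] nspace_nonneg[OF W] nspace_eq0[OF V] nspace_eq0[OF W]
    by (auto simp: zero_prod_def add_nonneg_eq_0_iff)
  assume y: "y \<in> car (direct_sum V W)"
  show "nrm (direct_sum V W) (x + y) \<le> nrm (direct_sum V W) x + nrm (direct_sum V W) y"
  proof -
    obtain a b c d where "x = (a, b)" "y = (c, d)" "a \<in> car V" "c \<in> car V" "b \<in> car W" "d \<in> car W"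
      using x y by auto
    then show ?thesis using nspace_tri[OF V, of a c] nspace_tri[OF W, of b d] by simp
  qed
qed (auto simp: zero_prod_def nspace_zero V W nspace_add nspace_scl nspace_nonneg nspace_nscl algebra_simps)

lemma isomorphic_direct_sum:
  assumes ns: "normed_space X" "normed_space Y" "normed_space X'" "normed_space Y'"
    and "isomorphic X X'" "isomorphic Y Y'"
  shows "isomorphic (direct_sum X Y) (direct_sum X' Y')"
proof -
  \<comment> \<open>The spaces are quantified afresh because the claim is applied to the given
    isomorphisms and to their inverses.\<close>
  have *: "bounded_operator (direct_sum X Y) (direct_sum X' Y') (map_prod T T')"
    if o: "normed_space X" "normed_space Y" "bounded_operator X X' T" "bounded_operator Y Y' T'"
    for X :: "('f::{real_normed_field, euclidean_space}, 'x::ab_group_add) nspace"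
    and X' :: "('f, 'xx::ab_group_add) nspace" and Y :: "('f, 'y::ab_group_add) nspace"
    and Y' :: "('f, 'yy::ab_group_add) nspace" and T T'
  proof -
    obtain K where K: "K > 0" "\<And>x. x \<in> car X \<Longrightarrow> nrm X' (T x) \<le> K * nrm X x"
      using bop_bound[OF o(1,3)] by blast
    obtain J where J: "J > 0" "\<And>x. x \<in> car Y \<Longrightarrow> nrm Y' (T' x) \<le> J * nrm Y x"
      using bop_bound[OF o(2,4)] by blast
    show ?thesis
    proof (rule bounded_operatorI[where K = "K + J"])
      fix z assume "z \<in> car (direct_sum X Y)"
      then obtain x y where z: "z = (x, y)" "x \<in> car X" "y \<in> car Y" by auto
      have "nrm X' (T x) + nrm Y' (T' y) \<le> K * nrm X x + J * nrm Y y"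
        using K(2)[OF z(2)] J(2)[OF z(3)] by linarith
      also have "\<dots> \<le> (K + J) * (nrm X x + nrm Y y)"
        using K(1) J(1) nspace_nonneg[OF o(1) z(2)] nspace_nonneg[OF o(2) z(3)]
        by (simp add: algebra_simps add_nonneg_nonneg)
      finally show "nrm (direct_sum X' Y') (map_prod T T' z) \<le> (K + J) * nrm (direct_sum X Y) z"
        using z by simp
    qed (use o in \<open>auto simp: bop_car bop_add bop_scl\<close>)
  qed
  obtain T S where a: "bounded_operator X X' T" "bounded_operator X' X S"
    "\<forall>x\<in>car X. S (T x) = x" "\<forall>y\<in>car X'. T (S y) = y" using assms(5) unfolding isomorphic_def by blast
  obtain T' S' where b: "bounded_operator Y Y' T'" "bounded_operator Y' Y S'"
    "\<forall>x\<in>car Y. S' (T' x) = x" "\<forall>y\<in>car Y'. T' (S' y) = y" using assms(6) unfolding isomorphic_def by blast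
  show ?thesis
    by (rule isomorphicI[OF *[OF ns(1,2) a(1) b(1)] *[OF ns(3,4) a(2) b(2)]]) (use a b in auto)
qed

lemma isomorphic_direct_sum_commute: "isomorphic (direct_sum X Y) (direct_sum Y X)"
  by (rule isomorphicI[where T = prod.swap and S = prod.swap]; (rule bounded_operatorI[where K = 1])?) auto

lemma isomorphic_direct_sum_assoc:
  "isomorphic (direct_sum (direct_sum X Y) Z) (direct_sum X (direct_sum Y Z))"
  by (rule isomorphicI[where T = "\<lambda>((x, y), z). (x, (y, z))" and S = "\<lambda>(x, (y, z)). ((x, y), z)"];
      (rule bounded_operatorI[where K = 1])?) auto

text \<open>Since \<open>B\<close> is a left inverse of \<open>A\<close>, the map
  \<open>A \<circ> B\<close> is a projection of \<open>V\<close> onto a copy of \<open>X\<close>,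
  and the kernel of \<open>B\<close> is the complement:
  \<open>v = A (B v) + (v - A (B v))\<close>.\<close>

lemma isomorphic_complement:
  assumes V: "normed_space V" and X: "normed_space X"
    and A: "bounded_operator X V A" and B: "bounded_operator V X B"
    and BA: "\<And>x. x \<in> car X \<Longrightarrow> B (A x) = x"
  defines "Z \<equiv> V\<lparr>car := {v \<in> car V. B v = 0}\<rparr>"
  shows "normed_space Z" "isomorphic V (direct_sum X Z)"
proof -
  have Zs: "car Z = {v \<in> car V. B v = 0}" "scl Z = scl V" "nrm Z = nrm V" by (simp_all add: Z_def)
  show "normed_space Z"
    by (rule normed_spaceI; unfold Zs)
       (auto simp: nspace_vs V nspace_zero bop_zero[OF V B] nspace_add bop_add[OF B] nspace_scl bop_scl[OF B]
         nspace_scl_zero X nspace_nonneg nspace_eq0 nspace_nscl nspace_tri)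
  obtain a where a: "a > 0" "\<And>x. x \<in> car X \<Longrightarrow> nrm V (A x) \<le> a * nrm X x" using bop_bound[OF X A] by blast
  obtain b where b: "b > 0" "\<And>x. x \<in> car V \<Longrightarrow> nrm X (B x) \<le> b * nrm V x" using bop_bound[OF V B] by blast
  have AB: "bounded_operator V V (\<lambda>v. v - A (B v))" by (rule bop_id_minus[OF V V bop_compose[OF V X B A]])
  obtain c where c: "c > 0" "\<And>v. v \<in> car V \<Longrightarrow> nrm V (v - A (B v)) \<le> c * nrm V v" using bop_bound[OF V AB] by blast
  have "bounded_operator V (direct_sum X Z) (\<lambda>v. (B v, v - A (B v)))"
  proof (rule bounded_operatorI[where K = "b + c"])
    fix v assume v: "v \<in> car V"
    show "(B v, v - A (B v)) \<in> car (direct_sum X Z)"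
      using v by (auto simp: Zs bop_car[OF B] bop_car[OF A] bop_diff[OF V X B] BA nspace_diff[OF V])
    show "nrm (direct_sum X Z) (B v, v - A (B v)) \<le> (b + c) * nrm V v"
      using b(2)[OF v] c(2)[OF v] by (simp add: Zs algebra_simps)
    show "(B (scl V r v), scl V r v - A (B (scl V r v))) = scl (direct_sum X Z) r (B v, v - A (B v))" for r
      using bop_scl[OF AB v] v by (simp add: Zs bop_scl[OF B])
  qed (use bop_add[OF AB] bop_add[OF B] in simp)
  moreover have "bounded_operator (direct_sum X Z) V (\<lambda>(x, z). A x + z)"
  proof (rule bounded_operatorI[where K = "a + 1"])
    fix y assume y: "y \<in> car (direct_sum X Z)"
    then obtain x z where xz: "y = (x, z)" "x \<in> car X" "z \<in> car V" by (auto simp: Zs)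
    have "nrm V (A x + z) \<le> a * nrm X x + nrm V z"
      using nspace_tri[OF V bop_car[OF A xz(2)] xz(3)] a(2)[OF xz(2)] by linarith
    also have "\<dots> \<le> (a + 1) * (nrm X x + nrm V z)"
      using a(1) nspace_nonneg[OF V xz(3)] nspace_nonneg[OF X xz(2)] by (simp add: algebra_simps)
    finally show "nrm V (case y of (x, z) \<Rightarrow> A x + z) \<le> (a + 1) * nrm (direct_sum X Z) y"
      by (simp add: xz(1) Zs)
  qed (auto simp: Zs bop_car[OF A] bop_add[OF A] bop_scl[OF A] nspace_add[OF V] nspace_scl_laws[OF V])
  ultimately show "isomorphic V (direct_sum X Z)"
    by (rule isomorphicI)
       (auto simp: Zs bop_add[OF B] bop_car[OF A] BA)
qed

section \<open>The sequence spaces \<open>\<ell>\<^sub>p\<close>\<close>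

lemma ereal_ge_1_cases:
  assumes "1 \<le> (p::ereal)"
  obtains "p = \<infinity>" | q where "p = ereal q" "1 \<le> q"
  using assms by (cases p) (auto simp: one_ereal_def)

text \<open>Membership and norm bound are stated together because the supremum carries information
  only for bounded sequences. \<open>lp_finite_iff\<close> and \<open>marcinkiewicz_le_iff\<close>
  have the same shape, and most later estimates go through these three.\<close>

lemma lp_infinity_iff:
  "in_lp \<infinity> a \<and> lp_norm \<infinity> a \<le> K \<longleftrightarrow> (\<forall>n. \<bar>a n\<bar> \<le> K)"
proof
  assume *: "in_lp \<infinity> a \<and> lp_norm \<infinity> a \<le> K"
  have "\<bar>a n\<bar> \<le> (SUP n. \<bar>a n\<bar>)" for n
    using * by (intro cSUP_upper) (auto simp: in_lp_def)
  then show "\<forall>n. \<bar>a n\<bar> \<le> K" using * unfolding lp_norm_def by (auto intro: order_trans)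
next
  assume *: "\<forall>n. \<bar>a n\<bar> \<le> K"
  then have "bdd_above (range (\<lambda>n. \<bar>a n\<bar>))" by (auto intro!: bdd_aboveI[of _ K])
  then show "in_lp \<infinity> a \<and> lp_norm \<infinity> a \<le> K"
    using * unfolding in_lp_def lp_norm_def by (auto intro: cSUP_least)
qed

lemma lp_finite_powr_norm:
  assumes "1 \<le> q" "in_lp (ereal q) a"
  shows "lp_norm (ereal q) a powr q = (\<Sum>n. \<bar>a n\<bar> powr q)"
proof -
  have "0 \<le> (\<Sum>n. \<bar>a n\<bar> powr q)" using assms by (intro suminf_nonneg) (auto simp: in_lp_def)
  then show ?thesis using assms by (simp add: lp_norm_def powr_powr)
qed

lemma lp_norm_nonneg:
  assumes "in_lp p a"
  shows "0 \<le> lp_norm p a"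
proof (cases "p = \<infinity>")
  case True
  have "\<bar>a 0\<bar> \<le> lp_norm p a" using True assms lp_infinity_iff[of a "lp_norm \<infinity> a"] by auto
  then show ?thesis by linarith
qed (simp add: lp_norm_def)

text \<open>For nonnegative terms, summability with a bound on the sum amounts to that bound for all
  finite partial sums. This turns the estimates for finite \<open>p\<close> into estimates of finite
  sums.\<close>

lemma lp_finite_iff:
  assumes q: "1 \<le> q" and K: "0 \<le> K"
  shows "in_lp (ereal q) a \<and> lp_norm (ereal q) a \<le> K \<longleftrightarrow>
         (\<forall>F. finite F \<longrightarrow> (\<Sum>n\<in>F. \<bar>a n\<bar> powr q) \<le> K powr q)"
proof
  assume *: "in_lp (ereal q) a \<and> lp_norm (ereal q) a \<le> K"
  show "\<forall>F. finite F \<longrightarrow> (\<Sum>n\<in>F. \<bar>a n\<bar> powr q) \<le> K powr q"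
  proof (intro allI impI)
    fix F :: "nat set" assume F: "finite F"
    have "(\<Sum>n\<in>F. \<bar>a n\<bar> powr q) \<le> (\<Sum>n. \<bar>a n\<bar> powr q)"
      using * F by (intro sum_le_suminf) (auto simp: in_lp_def)
    also have "\<dots> = lp_norm (ereal q) a powr q" using lp_finite_powr_norm[OF q] * by simp
    also have "\<dots> \<le> K powr q" using * q lp_norm_nonneg by (intro powr_mono2) auto
    finally show "(\<Sum>n\<in>F. \<bar>a n\<bar> powr q) \<le> K powr q" .
  qed
next
  assume *: "\<forall>F. finite F \<longrightarrow> (\<Sum>n\<in>F. \<bar>a n\<bar> powr q) \<le> K powr q"
  have s: "summable (\<lambda>n. \<bar>a n\<bar> powr q)"
    by (rule summableI_nonneg_bounded[where x = "K powr q"]) (use * in auto)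
  have "(\<Sum>n. \<bar>a n\<bar> powr q) \<le> K powr q" by (rule suminf_le_const[OF s]) (use * in auto)
  then have "(\<Sum>n. \<bar>a n\<bar> powr q) powr (1/q) \<le> (K powr q) powr (1/q)"
    using q s by (intro powr_mono2 suminf_nonneg) auto
  then show "in_lp (ereal q) a \<and> lp_norm (ereal q) a \<le> K"
    using s q K by (simp add: in_lp_def lp_norm_def powr_powr)
qed

text \<open>Asking for injectivity of \<open>h\<close> only where \<open>b\<close> is nonzero covers
  pointwise domination, subsequences, shifts and padding by zeros in a single statement.\<close>

lemma lp_dominated:
  assumes p: "1 \<le> p" and a: "in_lp p a"
    and inj: "inj_on h {n. b n \<noteq> 0}" and le: "\<And>n. b n \<noteq> 0 \<Longrightarrow> \<bar>b n\<bar> \<le> \<bar>a (h n)\<bar>"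
  shows "in_lp p b \<and> lp_norm p b \<le> lp_norm p a"
  using p
proof (cases p rule: ereal_ge_1_cases)
  case 1
  have "\<forall>n. \<bar>a n\<bar> \<le> lp_norm \<infinity> a" using a 1 lp_infinity_iff by blast
  then have "\<bar>b n\<bar> \<le> lp_norm \<infinity> a" for n
    using le[of n] lp_norm_nonneg[OF a[unfolded 1]] by (cases "b n = 0") (simp, meson order_trans)
  then show ?thesis unfolding 1 using lp_infinity_iff by blast
next
  case (2 q)
  have N: "0 \<le> lp_norm (ereal q) a" using lp_norm_nonneg a 2 by blast
  then have *: "\<forall>F. finite F \<longrightarrow> (\<Sum>n\<in>F. \<bar>a n\<bar> powr q) \<le> lp_norm (ereal q) a powr q"
    using lp_finite_iff[OF 2(2)] a 2(1) by blast
  have "(\<Sum>n\<in>F. \<bar>b n\<bar> powr q) \<le> lp_norm (ereal q) a powr q" if F: "finite F" for F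
  proof -
    let ?G = "{n\<in>F. b n \<noteq> 0}"
    have "(\<Sum>n\<in>F. \<bar>b n\<bar> powr q) = (\<Sum>n\<in>?G. \<bar>b n\<bar> powr q)"
      using F by (intro sum.mono_neutral_right) auto
    also have "\<dots> \<le> (\<Sum>n\<in>?G. \<bar>a (h n)\<bar> powr q)"
      using le 2 by (intro sum_mono powr_mono2) auto
    also have "\<dots> = (\<Sum>n\<in>h ` ?G. \<bar>a n\<bar> powr q)"
      using inj_on_subset[OF inj, of ?G] by (subst sum.reindex) auto
    finally show ?thesis using *[rule_format, of "h ` ?G"] F by simp
  qed
  then show ?thesis unfolding 2 using lp_finite_iff[OF 2(2) N] by blast
qed

lemma lp_mono:
  assumes "1 \<le> p" "in_lp p a" "\<And>n. \<bar>b n\<bar> \<le> \<bar>a n\<bar>"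
  shows "in_lp p b \<and> lp_norm p b \<le> lp_norm p a"
  by (rule lp_dominated[where h = id]) (use assms in auto)

text \<open>Each finite partial sum passes to the limit. This puts the coordinatewise limit of a
  Cauchy sequence back into the space.\<close>

lemma lp_fatou:
  assumes p: "1 \<le> p" and a: "\<And>m. in_lp p (a m)" and K: "\<And>m. lp_norm p (a m) \<le> K"
    and lim: "\<And>n. (\<lambda>m. a m n) \<longlonglongrightarrow> b n"
  shows "in_lp p b \<and> lp_norm p b \<le> K"
  using p
proof (cases p rule: ereal_ge_1_cases)
  case 1
  have "\<forall>n. \<bar>a m n\<bar> \<le> K" for m using a K 1 lp_infinity_iff by blast
  then have "\<bar>b n\<bar> \<le> K" for n
    by (intro LIMSEQ_le_const2[OF tendsto_rabs[OF lim]]) auto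
  then show ?thesis unfolding 1 using lp_infinity_iff by blast
next
  case (2 q)
  have K0: "0 \<le> K" using lp_norm_nonneg[OF a[of 0]] K[of 0] by linarith
  have "(\<Sum>n\<in>F. \<bar>b n\<bar> powr q) \<le> K powr q" if F: "finite F" for F
  proof (rule LIMSEQ_le_const2)
    show "(\<lambda>m. \<Sum>n\<in>F. \<bar>a m n\<bar> powr q) \<longlonglongrightarrow> (\<Sum>n\<in>F. \<bar>b n\<bar> powr q)"
      using 2(2) by (intro tendsto_sum tendsto_powr2 tendsto_rabs lim) auto
    show "\<exists>N. \<forall>m\<ge>N. (\<Sum>n\<in>F. \<bar>a m n\<bar> powr q) \<le> K powr q"
      using lp_finite_iff[OF 2(2) K0] a K F unfolding 2(1) by blast
  qed
  then show ?thesis unfolding 2 using lp_finite_iff[OF 2(2) K0] by blast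
qed

text \<open>In the interior this is convexity of the power function on the positive reals; if
  \<open>x\<close> or \<open>y\<close> vanishes it reduces to \<open>r powr q \<le> r\<close> for
  \<open>r\<close> in the unit interval.\<close>

lemma powr_convex_nonneg:
  fixes x y :: real
  assumes q: "1 \<le> q" and xy: "0 \<le> x" "0 \<le> y" and t: "0 \<le> t" "t \<le> 1"
  shows "(t * x + (1 - t) * y) powr q \<le> t * x powr q + (1 - t) * y powr q"
proof -
  have zero: "(r * z) powr q \<le> r * z powr q" if "0 \<le> r" "r \<le> 1" "0 \<le> z" for r z :: real
  proof (cases "r = 0")
    case False
    have "r powr q \<le> r powr 1" using False that q by (intro powr_mono') auto
    then show ?thesis using that by (simp add: powr_mult mult_right_mono)
  qed simp
  consider "x = 0" | "y = 0" | "0 < x" "0 < y" using xy by fastforce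
  then show ?thesis
  proof cases
    case 1 then show ?thesis using zero[of "1 - t" y] t xy by simp
  next
    case 2 then show ?thesis using zero[of t x] t xy by simp
  next
    case 3 then show ?thesis
      using convex_onD[OF powr_convex[OF q], of "1 - t" x y] t by (simp add: algebra_simps)
  qed
qed

text \<open>Minkowski's inequality by convexity:
  \<open>(\<bar>a n\<bar> + \<bar>b n\<bar>) / (A + B)\<close> is the convex combination of
  \<open>\<bar>a n\<bar> / A\<close> and \<open>\<bar>b n\<bar> / B\<close> with weights
  \<open>A / (A + B)\<close> and \<open>B / (A + B)\<close>.\<close>

lemma lp_triangle:
  assumes p: "1 \<le> p" and a: "in_lp p a" and b: "in_lp p b"
  shows "in_lp p (\<lambda>n. a n + b n) \<and> lp_norm p (\<lambda>n. a n + b n) \<le> lp_norm p a + lp_norm p b"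
  using p
proof (cases p rule: ereal_ge_1_cases)
  case 1
  have "\<forall>n. \<bar>a n\<bar> \<le> lp_norm \<infinity> a" "\<forall>n. \<bar>b n\<bar> \<le> lp_norm \<infinity> b"
    using a b lp_infinity_iff unfolding 1 by blast+
  then have "\<forall>n. \<bar>a n + b n\<bar> \<le> lp_norm \<infinity> a + lp_norm \<infinity> b"
    by (meson abs_triangle_ineq add_mono order_trans)
  then show ?thesis unfolding 1 using lp_infinity_iff by blast
next
  case (2 q)
  define A B where "A = lp_norm (ereal q) a" and "B = lp_norm (ereal q) b"
  have A: "0 \<le> A" and B: "0 \<le> B" unfolding A_def B_def using lp_norm_nonneg a b 2 by blast+
  have sA: "\<forall>F. finite F \<longrightarrow> (\<Sum>n\<in>F. \<bar>a n\<bar> powr q) \<le> A powr q"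
    using lp_finite_iff[OF 2(2) A] a unfolding 2(1) A_def by blast
  have sB: "\<forall>F. finite F \<longrightarrow> (\<Sum>n\<in>F. \<bar>b n\<bar> powr q) \<le> B powr q"
    using lp_finite_iff[OF 2(2) B] b unfolding 2(1) B_def by blast
  have le: "in_lp (ereal q) (\<lambda>n. a n + b n) \<and> lp_norm (ereal q) (\<lambda>n. a n + b n) \<le> (A + e) + (B + e)"
    if e: "0 < e" for e
  proof -
    \<comment> \<open>Both norms are enlarged by \<open>e\<close> so that no denominator vanishes;
      \<open>e\<close> tends to 0 at the end.\<close>
    define t where "t = (A + e) / ((A + e) + (B + e))"
    have t: "0 \<le> t" "t \<le> 1" using A B e by (auto simp: t_def)
    have t1: "1 - t = (B + e) / ((A + e) + (B + e))" using A B e by (simp add: t_def field_simps)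
    have S: "0 < (A + e) + (B + e)" using A B e by simp
    have pw: "\<bar>a n + b n\<bar> powr q \<le> ((A + e) + (B + e)) powr q *
        (t * (\<bar>a n\<bar> powr q / (A + e) powr q) + (1 - t) * (\<bar>b n\<bar> powr q / (B + e) powr q))" for n
    proof -
      have "\<bar>a n + b n\<bar> powr q \<le> (\<bar>a n\<bar> + \<bar>b n\<bar>) powr q" using 2 by (intro powr_mono2) auto
      also have "\<bar>a n\<bar> + \<bar>b n\<bar> = ((A + e) + (B + e)) * (t * (\<bar>a n\<bar> / (A + e)) + (1 - t) * (\<bar>b n\<bar> / (B + e)))"
      proof -
        have split: "x + y = (u + v) * (u / (u + v) * (x / u) + v / (u + v) * (y / v))"
          if "0 < u" "0 < v" for x y u v :: real
        proof -
          have "(u + v) * (u / (u + v) * (x / u)) = x" "(u + v) * (v / (u + v) * (y / v)) = y"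
            using that by simp_all
          then show ?thesis by (simp only: distrib_left)
        qed
        show ?thesis unfolding t1 unfolding t_def by (rule split) (use A B e in auto)
      qed
      also have "\<dots> powr q \<le> ((A + e) + (B + e)) powr q *
         (t * (\<bar>a n\<bar> / (A + e)) powr q + (1 - t) * (\<bar>b n\<bar> / (B + e)) powr q)"
        unfolding powr_mult using 2 t A B e by (intro mult_left_mono powr_convex_nonneg) auto
      finally show ?thesis by (simp add: powr_divide)
    qed
    have "(\<Sum>n\<in>F. \<bar>a n + b n\<bar> powr q) \<le> ((A + e) + (B + e)) powr q" if F: "finite F" for F
    proof -
      have qa: "(\<Sum>n\<in>F. \<bar>a n\<bar> powr q) / (A + e) powr q \<le> 1"
        using sA F A e 2 powr_mono2[of q A "A + e"] by (auto simp: divide_le_eq intro: order_trans)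
      have qb: "(\<Sum>n\<in>F. \<bar>b n\<bar> powr q) / (B + e) powr q \<le> 1"
        using sB F B e 2 powr_mono2[of q B "B + e"] by (auto simp: divide_le_eq intro: order_trans)
      have "(\<Sum>n\<in>F. \<bar>a n + b n\<bar> powr q) \<le> (\<Sum>n\<in>F. ((A + e) + (B + e)) powr q *
        (t * (\<bar>a n\<bar> powr q / (A + e) powr q) + (1 - t) * (\<bar>b n\<bar> powr q / (B + e) powr q)))"
        by (intro sum_mono pw)
      also have "\<dots> = ((A + e) + (B + e)) powr q *
        (t * ((\<Sum>n\<in>F. \<bar>a n\<bar> powr q) / (A + e) powr q) + (1 - t) * ((\<Sum>n\<in>F. \<bar>b n\<bar> powr q) / (B + e) powr q))"
        by (simp only: sum_distrib_left[symmetric] sum.distrib sum_divide_distrib[symmetric])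
      also have "\<dots> \<le> ((A + e) + (B + e)) powr q * (t * 1 + (1 - t) * 1)"
        using t qa qb by (intro mult_left_mono add_mono) auto
      finally show ?thesis by simp
    qed
    then show ?thesis using lp_finite_iff[OF 2(2), of "(A + e) + (B + e)"] S by simp
  qed
  have "lp_norm (ereal q) (\<lambda>n. a n + b n) \<le> A + B + e" if "e > 0" for e
    using le[of "e/2"] that by simp
  then show ?thesis using le[of 1] unfolding 2 A_def[symmetric] B_def[symmetric]
    by (auto intro: field_le_epsilon)
qed

lemma lp_scale_le:
  assumes p: "1 \<le> p" and a: "in_lp p a"
  shows "in_lp p (\<lambda>n. c * a n) \<and> lp_norm p (\<lambda>n. c * a n) \<le> \<bar>c\<bar> * lp_norm p a"
  using p
proof (cases p rule: ereal_ge_1_cases)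
  case 1
  have "\<forall>n. \<bar>a n\<bar> \<le> lp_norm \<infinity> a" using a 1 lp_infinity_iff by blast
  then have "\<forall>n. \<bar>c * a n\<bar> \<le> \<bar>c\<bar> * lp_norm \<infinity> a" by (simp add: abs_mult mult_left_mono)
  then show ?thesis unfolding 1 using lp_infinity_iff by blast
next
  case (2 q)
  have N: "0 \<le> lp_norm (ereal q) a" using lp_norm_nonneg a 2 by blast
  then have *: "\<forall>F. finite F \<longrightarrow> (\<Sum>n\<in>F. \<bar>a n\<bar> powr q) \<le> lp_norm (ereal q) a powr q"
    using lp_finite_iff[OF 2(2)] a 2(1) by blast
  have "(\<Sum>n\<in>F. \<bar>c * a n\<bar> powr q) \<le> (\<bar>c\<bar> * lp_norm (ereal q) a) powr q" if F: "finite F" for F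
    using *[rule_format, OF F]
    by (simp add: abs_mult powr_mult sum_distrib_left[symmetric] mult_left_mono)
  then show ?thesis unfolding 2 using lp_finite_iff[OF 2(2), of "\<bar>c\<bar> * lp_norm (ereal q) a"] N by simp
qed

lemma lp_scale:
  assumes p: "1 \<le> p" and a: "in_lp p a"
  shows "lp_norm p (\<lambda>n. c * a n) = \<bar>c\<bar> * lp_norm p a"
proof (cases "c = 0")
  case True
  then show ?thesis using lp_scale_le[OF assms, of 0] lp_norm_nonneg[of p "\<lambda>n. 0 * a n"] by simp
next
  case False
  have "lp_norm p a \<le> \<bar>1/c\<bar> * lp_norm p (\<lambda>n. c * a n)"
    using lp_scale_le[OF p conjunct1[OF lp_scale_le[OF assms]], of "1/c" c] False by simp
  then have "\<bar>c\<bar> * lp_norm p a \<le> lp_norm p (\<lambda>n. c * a n)" using False by (simp add: field_simps)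
  then show ?thesis using lp_scale_le[OF assms, of c] by linarith
qed

lemma lp_component_le:
  assumes p: "1 \<le> p" and a: "in_lp p a"
  shows "\<bar>a n\<bar> \<le> lp_norm p a"
  using p
proof (cases p rule: ereal_ge_1_cases)
  case 1
  then show ?thesis using a lp_infinity_iff by blast
next
  case (2 q)
  have N: "0 \<le> lp_norm (ereal q) a" using lp_norm_nonneg a 2 by blast
  then have "\<forall>F. finite F \<longrightarrow> (\<Sum>n\<in>F. \<bar>a n\<bar> powr q) \<le> lp_norm (ereal q) a powr q"
    using lp_finite_iff[OF 2(2)] a 2(1) by blast
  then have "\<bar>a n\<bar> powr q \<le> lp_norm (ereal q) a powr q" by (auto dest: spec[of _ "{n}"])
  moreover have "lp_norm (ereal q) a powr q < \<bar>a n\<bar> powr q" if "lp_norm (ereal q) a < \<bar>a n\<bar>"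
    using N 2(2) that by (intro powr_less_mono2) auto
  ultimately show ?thesis unfolding 2(1) by (meson not_less)
qed

lemma lp_single:
  assumes p: "1 \<le> p"
  shows "in_lp p (\<lambda>n. if n = k then c else 0) \<and> lp_norm p (\<lambda>n. if n = k then c else 0) \<le> \<bar>c\<bar>"
  using p
proof (cases p rule: ereal_ge_1_cases)
  case 1
  then show ?thesis using lp_infinity_iff[of "\<lambda>n. if n = k then c else 0" "\<bar>c\<bar>"] by simp
next
  case (2 q)
  have "(\<Sum>n\<in>F. \<bar>if n = k then c else 0\<bar> powr q) \<le> \<bar>c\<bar> powr q" if F: "finite F" for F
  proof -
    have "(\<Sum>n\<in>F. \<bar>if n = k then c else 0\<bar> powr q) = (\<Sum>n\<in>F. if n = k then \<bar>c\<bar> powr q else 0)"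
      by (intro sum.cong) auto
    then show ?thesis using F by (simp add: sum.delta)
  qed
  then show ?thesis unfolding 2 using lp_finite_iff[OF 2(2), of "\<bar>c\<bar>"] by simp
qed

lemma in_lp_geometric:
  assumes p: "1 \<le> p"
  shows "in_lp p (\<lambda>n. (1/2) ^ n)"
  using p
proof (cases p rule: ereal_ge_1_cases)
  case 1
  have "\<forall>n. \<bar>(1/2) ^ n\<bar> \<le> (1::real)" by (simp add: power_le_one)
  then show ?thesis using 1 lp_infinity_iff by blast
next
  case (2 q)
  have "summable (\<lambda>n. \<bar>(1/2) ^ n :: real\<bar> powr q)"
  proof (rule summable_comparison_test'[where N = 0])
    show "summable (\<lambda>n. (1/2) ^ n :: real)" by (intro summable_geometric) auto
    fix n :: nat
    have "((1/2) ^ n :: real) powr q \<le> ((1/2) ^ n) powr 1"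
      using 2 by (intro powr_mono') (auto simp: power_le_one)
    then show "norm (\<bar>(1/2) ^ n :: real\<bar> powr q) \<le> (1/2) ^ n" by simp
  qed
  then show ?thesis by (simp add: 2 in_lp_def)
qed

text \<open>This fails for bounded sequences, for instance constant ones, and so forces the case
  distinction on \<open>p\<close> in \<open>functional_small\<close>.\<close>

lemma lp_tail_tendsto:
  assumes q: "1 \<le> q" and a: "in_lp (ereal q) a"
  shows "(\<lambda>N. lp_norm (ereal q) (\<lambda>n. if n < N then 0 else a n)) \<longlonglongrightarrow> 0"
proof -
  have s: "summable (\<lambda>n. \<bar>a n\<bar> powr q)" using a by (simp add: in_lp_def)
  have "lp_norm (ereal q) (\<lambda>n. if n < N then 0 else a n) = (\<Sum>n. \<bar>a (n + N)\<bar> powr q) powr (1/q)" for N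
  proof -
    have "summable (\<lambda>n. \<bar>if n < N then 0 else a n\<bar> powr q)"
      by (rule summable_comparison_test'[OF s, where N = 0]) auto
    from suminf_split_initial_segment[OF this, of N]
    have "(\<Sum>n. \<bar>if n < N then 0 else a n\<bar> powr q) = (\<Sum>n. \<bar>a (n + N)\<bar> powr q)" by simp
    then show ?thesis by (simp add: lp_norm_def)
  qed
  moreover have "(\<lambda>N. (\<Sum>n. \<bar>a (n + N)\<bar> powr q) powr (1/q)) \<longlonglongrightarrow> 0 powr (1/q)"
    using q by (intro tendsto_powr2 suminf_exist_split2[OF s] tendsto_intros always_eventually allI suminf_nonneg)
      (auto simp: summable_ignore_initial_segment[OF s])
  ultimately show ?thesis by simp
qed

text \<open>A finite set of codes decodes into a finite rectangle, over which the sum can be taken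
  row by row.\<close>

lemma lp_flatten:
  assumes p: "1 \<le> p" and a: "\<And>k. in_lp p (a k)" and aa: "in_lp p (\<lambda>k. lp_norm p (a k))"
  shows "in_lp p (\<lambda>i. a (fst (prod_decode i)) (snd (prod_decode i))) \<and>
    lp_norm p (\<lambda>i. a (fst (prod_decode i)) (snd (prod_decode i))) \<le> lp_norm p (\<lambda>k. lp_norm p (a k))"
  using p
proof (cases p rule: ereal_ge_1_cases)
  case 1
  have "\<bar>a k n\<bar> \<le> lp_norm p (\<lambda>k. lp_norm p (a k))" for k n
    using lp_component_le[OF p a, of k n] lp_component_le[OF p aa, of k] by linarith
  then show ?thesis unfolding 1 using lp_infinity_iff by blast
next
  case (2 q)
  define K where "K = lp_norm p (\<lambda>k. lp_norm p (a k))"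
  have K: "0 \<le> K" unfolding K_def using lp_norm_nonneg aa by blast
  have "(\<Sum>i\<in>F. \<bar>a (fst (prod_decode i)) (snd (prod_decode i))\<bar> powr q) \<le> K powr q" if F: "finite F" for F
  proof -
    define G where "G = prod_decode ` F"
    have G: "finite G" using F by (simp add: G_def)
    have "(\<Sum>i\<in>F. \<bar>a (fst (prod_decode i)) (snd (prod_decode i))\<bar> powr q) = (\<Sum>x\<in>G. \<bar>a (fst x) (snd x)\<bar> powr q)"
      unfolding G_def by (subst sum.reindex) (auto intro: inj_on_subset[OF inj_prod_decode])
    also have "\<dots> \<le> (\<Sum>x\<in>fst ` G \<times> snd ` G. \<bar>a (fst x) (snd x)\<bar> powr q)"
      using G by (intro sum_mono2) (force simp: image_iff)+
    also have "\<dots> = (\<Sum>k\<in>fst ` G. \<Sum>n\<in>snd ` G. \<bar>a k n\<bar> powr q)"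
      by (simp add: sum.cartesian_product case_prod_unfold)
    also have "\<dots> \<le> (\<Sum>k\<in>fst ` G. lp_norm p (a k) powr q)"
      using lp_finite_iff[OF 2(2)] a G lp_norm_nonneg[OF a] unfolding 2(1) by (intro sum_mono) blast
    also have "\<dots> = (\<Sum>k\<in>fst ` G. \<bar>lp_norm p (a k)\<bar> powr q)" using lp_norm_nonneg[OF a] by simp
    also have "\<dots> \<le> K powr q"
      using lp_finite_iff[OF 2(2) K, of "\<lambda>k. lp_norm p (a k)"] aa G K_def unfolding 2(1) by blast
    finally show ?thesis .
  qed
  then show ?thesis using lp_finite_iff[OF 2(2) K] unfolding K_def 2(1) by blast
qed

lemma lp_unflatten:
  assumes p: "1 \<le> p" and b: "in_lp p b"
  shows "in_lp p (\<lambda>n. b (prod_encode (k, n)))"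
    and "in_lp p (\<lambda>k. lp_norm p (\<lambda>n. b (prod_encode (k, n)))) \<and>
      lp_norm p (\<lambda>k. lp_norm p (\<lambda>n. b (prod_encode (k, n)))) \<le> lp_norm p b"
proof -
  have row: "in_lp p (\<lambda>n. b (prod_encode (k, n))) \<and> lp_norm p (\<lambda>n. b (prod_encode (k, n))) \<le> lp_norm p b" for k
    by (rule lp_dominated[where h = "\<lambda>n. prod_encode (k, n)"]) (use p b in \<open>auto simp: inj_on_def\<close>)
  then show "in_lp p (\<lambda>n. b (prod_encode (k, n)))" by blast
  show "in_lp p (\<lambda>k. lp_norm p (\<lambda>n. b (prod_encode (k, n)))) \<and>
      lp_norm p (\<lambda>k. lp_norm p (\<lambda>n. b (prod_encode (k, n)))) \<le> lp_norm p b"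
    using p
  proof (cases p rule: ereal_ge_1_cases)
    case 1
    show ?thesis using row lp_norm_nonneg unfolding 1 by (intro lp_infinity_iff[THEN iffD2]) auto
  next
    case (2 q)
    define K where "K = lp_norm p b"
    have K: "0 \<le> K" unfolding K_def using lp_norm_nonneg b by blast
    have bK: "\<forall>F. finite F \<longrightarrow> (\<Sum>n\<in>F. \<bar>b n\<bar> powr q) \<le> K powr q"
      using lp_finite_iff[OF 2(2) K, of b] b unfolding K_def 2(1) by blast
    \<comment> \<open>The row norms are infinite sums. Truncating every row to \<open>m\<close>
      columns leaves a finite sum of entries of \<open>b\<close>, and then \<open>m\<close> tends to
      infinity.\<close>
    have "(\<Sum>k\<in>F. \<bar>lp_norm p (\<lambda>n. b (prod_encode (k, n)))\<bar> powr q) \<le> K powr q" if F: "finite F" for F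
    proof (rule LIMSEQ_le_const2)
      have "(\<lambda>m. \<Sum>n<m. \<bar>b (prod_encode (k, n))\<bar> powr q) \<longlonglongrightarrow>
             \<bar>lp_norm p (\<lambda>n. b (prod_encode (k, n)))\<bar> powr q" for k
      proof -
        have "summable (\<lambda>n. \<bar>b (prod_encode (k, n))\<bar> powr q)" using row[of k] by (simp add: 2 in_lp_def)
        then show ?thesis
          using lp_finite_powr_norm[OF 2(2)] row[of k] lp_norm_nonneg unfolding 2(1)
          by (metis abs_of_nonneg summable_LIMSEQ)
      qed
      then show "(\<lambda>m. \<Sum>k\<in>F. \<Sum>n<m. \<bar>b (prod_encode (k, n))\<bar> powr q) \<longlonglongrightarrow>
             (\<Sum>k\<in>F. \<bar>lp_norm p (\<lambda>n. b (prod_encode (k, n)))\<bar> powr q)" by (intro tendsto_sum) auto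
      have "(\<Sum>k\<in>F. \<Sum>n<m. \<bar>b (prod_encode (k, n))\<bar> powr q) \<le> K powr q" for m
      proof -
        have "(\<Sum>k\<in>F. \<Sum>n<m. \<bar>b (prod_encode (k, n))\<bar> powr q) = (\<Sum>i\<in>prod_encode ` (F \<times> {..<m}). \<bar>b i\<bar> powr q)"
          by (subst sum.reindex) (auto simp: sum.cartesian_product inj_on_def case_prod_unfold)
        then show ?thesis using bK F by simp
      qed
      then show "\<exists>N. \<forall>m\<ge>N. (\<Sum>k\<in>F. \<Sum>n<m. \<bar>b (prod_encode (k, n))\<bar> powr q) \<le> K powr q" by blast
    qed
    then show ?thesis using lp_finite_iff[OF 2(2) K] unfolding K_def 2(1) by blast
  qed
qed

section \<open>Infinite direct sums\<close>

lemma lp_sum_simps: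
  "f \<in> car (lp_sum p X) \<longleftrightarrow> (\<forall>n. f n \<in> car X) \<and> in_lp p (\<lambda>n. nrm X (f n))"
  "scl (lp_sum p X) c f = (\<lambda>n. scl X c (f n))"
  "nrm (lp_sum p X) f = lp_norm p (\<lambda>n. nrm X (f n))"
  by (simp_all add: lp_sum_def)

lemma lp_sum_bounded_by:
  assumes p: "1 \<le> p" and X: "normed_space X" and a: "in_lp p a"
    and f: "\<And>n. f n \<in> car X" and le: "\<And>n. nrm X (f n) \<le> a n"
  shows "f \<in> car (lp_sum p X) \<and> nrm (lp_sum p X) f \<le> lp_norm p a"
proof -
  have "\<bar>nrm X (f n)\<bar> \<le> \<bar>a n\<bar>" for n using le[of n] nspace_nonneg[OF X f[of n]] by linarith
  then show ?thesis using lp_mono[OF p a, of "\<lambda>n. nrm X (f n)"] f by (simp add: lp_sum_simps)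
qed

lemma normed_space_lp_sum:
  assumes p: "1 \<le> p" and X: "normed_space X"
  shows "normed_space (lp_sum p X)"
proof (rule normed_spaceI)
  note L = lp_sum_simps
  show "vector_space (scl (lp_sum p X))"
    by unfold_locales (auto simp: L fun_eq_iff nspace_scl_laws[OF X])
  show "0 \<in> car (lp_sum p X)"
    using lp_single[OF p, of 0 0] by (simp add: L nspace_zero[OF X] nspace_nrm_zero[OF X])
  fix f assume f: "f \<in> car (lp_sum p X)"
  then have fl: "in_lp p (\<lambda>n. nrm X (f n))" and fc: "\<And>n. f n \<in> car X" by (auto simp: L)
  show nn: "0 \<le> nrm (lp_sum p X) f" using lp_norm_nonneg[OF fl] by (simp add: L)
  show "nrm (lp_sum p X) f = 0 \<longleftrightarrow> f = 0"
  proof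
    assume "nrm (lp_sum p X) f = 0"
    then have "nrm X (f n) = 0" for n
      using lp_component_le[OF p fl, of n] nspace_nonneg[OF X fc[of n]] by (simp add: L)
    then show "f = 0" using nspace_eq0[OF X fc] by (simp add: fun_eq_iff)
  next
    assume "f = 0"
    then show "nrm (lp_sum p X) f = 0"
      using lp_single[OF p, of 0 0] lp_norm_nonneg[of p "\<lambda>_. 0"] by (simp add: L nspace_nrm_zero[OF X])
  qed
  fix c
  show "scl (lp_sum p X) c f \<in> car (lp_sum p X)"
    using lp_scale_le[OF p fl, of "norm c"] by (simp add: L nspace_scl[OF X fc] nspace_nscl[OF X fc])
  show "nrm (lp_sum p X) (scl (lp_sum p X) c f) = norm c * nrm (lp_sum p X) f"
    using lp_scale[OF p fl, of "norm c"] by (simp add: L nspace_nscl[OF X fc])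
next
  fix f g assume f: "f \<in> car (lp_sum p X)" and g: "g \<in> car (lp_sum p X)"
  have "(f + g) \<in> car (lp_sum p X) \<and> nrm (lp_sum p X) (f + g) \<le> lp_norm p (\<lambda>n. nrm X (f n) + nrm X (g n))"
    using f g lp_triangle[OF p, of "\<lambda>n. nrm X (f n)" "\<lambda>n. nrm X (g n)"]
    by (intro lp_sum_bounded_by[OF p X]) (auto simp: lp_sum_simps nspace_add[OF X] nspace_tri[OF X])
  then show "f + g \<in> car (lp_sum p X)"
    "nrm (lp_sum p X) (f + g) \<le> nrm (lp_sum p X) f + nrm (lp_sum p X) g"
    using lp_triangle[OF p, of "\<lambda>n. nrm X (f n)" "\<lambda>n. nrm X (g n)"] f g by (auto simp: lp_sum_simps)
qed

lemma lp_sum_component: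
  assumes "1 \<le> p" "normed_space X" "f \<in> car (lp_sum p X)"
  shows "f n \<in> car X" "nrm X (f n) \<le> nrm (lp_sum p X) f"
  using assms lp_component_le[OF assms(1), of "\<lambda>n. nrm X (f n)" n] nspace_nonneg[OF assms(2), of "f n"]
  by (auto simp: lp_sum_simps)

lemma tendsto_nrm:
  assumes X: "normed_space X" and x: "\<And>n. x n \<in> car X" and l: "l \<in> car X" and y: "y \<in> car X"
    and lim: "(\<lambda>n. nrm X (x n - l)) \<longlonglongrightarrow> 0"
  shows "(\<lambda>n. nrm X (y - x n)) \<longlonglongrightarrow> nrm X (y - l)"
proof -
  have "\<bar>nrm X (y - x n) - nrm X (y - l)\<bar> \<le> nrm X (x n - l)" for n
  proof -
    have c: "y - x n \<in> car X" "y - l \<in> car X" using x y l nspace_diff[OF X] by auto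
    show ?thesis
      using nspace_tri_diff[OF X c] nspace_tri_diff[OF X c(2,1)] nspace_nrm_diff_commute[OF X x[of n] l] by simp
  qed
  then have "(\<lambda>n. nrm X (y - x n) - nrm X (y - l)) \<longlonglongrightarrow> 0"
    by (intro Lim_null_comparison[OF _ lim]) auto
  then show ?thesis by (rule LIM_zero_cancel)
qed

lemma banach_space_lp_sum:
  assumes p: "1 \<le> p" and X: "banach_space X"
  shows "banach_space (lp_sum p X)"
proof -
  have ns: "normed_space X" using X by (simp add: banach_space_def)
  let ?L = "lp_sum p X"
  have nsL: "normed_space ?L" by (rule normed_space_lp_sum[OF p ns])
  have "\<exists>l\<in>car ?L. (\<lambda>n. nrm ?L (f n - l)) \<longlonglongrightarrow> 0"
    if f: "\<And>n. f n \<in> car ?L" and C: "\<And>e. e > 0 \<Longrightarrow> \<exists>N. \<forall>m\<ge>N. \<forall>n\<ge>N. nrm ?L (f m - f n) < e" for f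
  proof -
    have fk: "f n k \<in> car X" for n k using f by (simp add: lp_sum_simps)
    have "\<exists>l\<in>car X. (\<lambda>n. nrm X (f n k - l)) \<longlonglongrightarrow> 0" for k
    proof -
      have "\<exists>N. \<forall>m\<ge>N. \<forall>n\<ge>N. nrm X (f m k - f n k) < e" if e: "e > 0" for e
      proof -
        obtain N where N: "\<forall>m\<ge>N. \<forall>n\<ge>N. nrm ?L (f m - f n) < e" using C[OF e] by blast
        have "nrm X (f m k - f n k) \<le> nrm ?L (f m - f n)" for m n
          using lp_sum_component(2)[OF p ns nspace_diff[OF nsL f f], of m n k] by simp
        then show ?thesis using N by (meson le_less_trans)
      qed
      then show ?thesis using X fk unfolding banach_space_def by (elim conjE allE[of _ "\<lambda>n. f n k"]) blast
    qed
    then obtain l where l: "\<And>k. l k \<in> car X" "\<And>k. (\<lambda>n. nrm X (f n k - l k)) \<longlonglongrightarrow> 0" by metis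
    have close: "f m - l \<in> car ?L \<and> nrm ?L (f m - l) \<le> e"
      if N: "\<forall>m\<ge>N. \<forall>n\<ge>N. nrm ?L (f m - f n) < e" and m: "m \<ge> N" for N e m
    proof -
      \<comment> \<open>In the Cauchy condition \<open>m\<close> is fixed and the other index tends
        to infinity.\<close>
      have "in_lp p (\<lambda>k. nrm X (f m k - l k)) \<and> lp_norm p (\<lambda>k. nrm X (f m k - l k)) \<le> e"
      proof (rule lp_fatou[OF p, where a = "\<lambda>n k. nrm X (f m k - f (n + N) k)"])
        fix n
        have d: "f m - f (n + N) \<in> car ?L" by (rule nspace_diff[OF nsL f f])
        then show "in_lp p (\<lambda>k. nrm X (f m k - f (n + N) k))" by (simp add: lp_sum_simps)
        show "lp_norm p (\<lambda>k. nrm X (f m k - f (n + N) k)) \<le> e"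
          using N[rule_format, of m "n + N"] m by (simp add: lp_sum_simps)
      next
        fix k
        show "(\<lambda>n. nrm X (f m k - f (n + N) k)) \<longlonglongrightarrow> nrm X (f m k - l k)"
          by (rule LIMSEQ_ignore_initial_segment[OF tendsto_nrm[OF ns fk l(1) fk l(2)]])
      qed
      then show ?thesis using fk l(1) by (simp add: lp_sum_simps nspace_diff[OF ns])
    qed
    obtain N where "\<forall>m\<ge>N. \<forall>n\<ge>N. nrm ?L (f m - f n) < 1" using C[of 1] by auto
    \<comment> \<open>The limit belongs to the space as a difference of the two members
      \<open>f N\<close> and \<open>f N - l\<close>.\<close>
    from close[OF this, of N] have "f N - (f N - l) \<in> car ?L" using nspace_diff[OF nsL f] by blast
    then have lL: "l \<in> car ?L" by simp
    have "(\<lambda>n. nrm ?L (f n - l)) \<longlonglongrightarrow> 0"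
    proof (rule LIMSEQ_I)
      fix e :: real assume "0 < e"
      then obtain N where N: "\<forall>m\<ge>N. \<forall>n\<ge>N. nrm ?L (f m - f n) < e/2" using C[of "e/2"] by auto
      have "norm (nrm ?L (f m - l) - 0) < e" if "m \<ge> N" for m
        using close[OF N that] nspace_nonneg[OF nsL, of "f m - l"] \<open>0 < e\<close> by simp
      then show "\<exists>N. \<forall>m\<ge>N. norm (nrm ?L (f m - l) - 0) < e" by blast
    qed
    then show ?thesis using lL by blast
  qed
  then show ?thesis using nsL unfolding banach_space_def by blast
qed

lemma bop_lp_sum:
  assumes p: "1 \<le> p" and X: "normed_space X" and Y: "normed_space Y" and T: "bounded_operator X Y T"
  shows "bounded_operator (lp_sum p X) (lp_sum p Y) (\<lambda>f n. T (f n))"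
proof -
  obtain K where K: "K > 0" "\<And>x. x \<in> car X \<Longrightarrow> nrm Y (T x) \<le> K * nrm X x" using bop_bound[OF X T] by blast
  have *: "(\<lambda>n. T (f n)) \<in> car (lp_sum p Y) \<and> nrm (lp_sum p Y) (\<lambda>n. T (f n)) \<le> K * nrm (lp_sum p X) f"
    if f: "f \<in> car (lp_sum p X)" for f
    using lp_sum_bounded_by[OF p Y, of "\<lambda>n. K * nrm X (f n)" "\<lambda>n. T (f n)"]
      lp_scale_le[OF p, of "\<lambda>n. nrm X (f n)" K] f K bop_car[OF T]
    by (fastforce simp: lp_sum_simps)
  show ?thesis
    by (rule bounded_operatorI[where K = K])
       (use * in \<open>auto simp: lp_sum_simps fun_eq_iff bop_add[OF T] bop_scl[OF T]\<close>)
qed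

section \<open>Isomorphisms between infinite direct sums\<close>

lemma isomorphic_lp_sum:
  assumes p: "1 \<le> p" and X: "normed_space X" and Y: "normed_space Y" and "isomorphic X Y"
  shows "isomorphic (lp_sum p X) (lp_sum p Y)"
proof -
  obtain T S where a: "bounded_operator X Y T" "bounded_operator Y X S"
    "\<forall>x\<in>car X. S (T x) = x" "\<forall>y\<in>car Y. T (S y) = y" using assms(4) unfolding isomorphic_def by blast
  show ?thesis
    by (rule isomorphicI[OF bop_lp_sum[OF p X Y a(1)] bop_lp_sum[OF p Y X a(2)]])
       (use a in \<open>auto simp: lp_sum_simps\<close>)
qed

lemma isomorphic_lp_sum_direct_sum:
  assumes p: "1 \<le> p" and V: "normed_space V" and W: "normed_space W"
  shows "isomorphic (lp_sum p (direct_sum V W)) (direct_sum (lp_sum p V) (lp_sum p W))"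
proof (rule isomorphicI)
  show "bounded_operator (lp_sum p (direct_sum V W)) (direct_sum (lp_sum p V) (lp_sum p W))
    (\<lambda>f. (\<lambda>n. fst (f n), \<lambda>n. snd (f n)))"
  proof (rule bounded_operatorI[where K = 2])
    fix f assume f: "f \<in> car (lp_sum p (direct_sum V W))"
    then have c: "fst (f n) \<in> car V" "snd (f n) \<in> car W" for n by (auto simp: lp_sum_simps mem_Times_iff)
    have n: "nrm (direct_sum V W) (f n) = nrm V (fst (f n)) + nrm W (snd (f n))" for n
      by (metis direct_sum_simps(3) prod.collapse)
    have l: "in_lp p (\<lambda>n. nrm V (fst (f n)) + nrm W (snd (f n)))" using f by (simp add: lp_sum_simps n)
    have "(\<lambda>n. fst (f n)) \<in> car (lp_sum p V) \<and>
        nrm (lp_sum p V) (\<lambda>n. fst (f n)) \<le> lp_norm p (\<lambda>n. nrm V (fst (f n)) + nrm W (snd (f n)))"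
      "(\<lambda>n. snd (f n)) \<in> car (lp_sum p W) \<and>
        nrm (lp_sum p W) (\<lambda>n. snd (f n)) \<le> lp_norm p (\<lambda>n. nrm V (fst (f n)) + nrm W (snd (f n)))"
      using c nspace_nonneg[OF V c(1)] nspace_nonneg[OF W c(2)]
      by (intro lp_sum_bounded_by[OF p _ l] V W; simp)+
    then show "(\<lambda>n. fst (f n), \<lambda>n. snd (f n)) \<in> car (direct_sum (lp_sum p V) (lp_sum p W))"
      "nrm (direct_sum (lp_sum p V) (lp_sum p W)) (\<lambda>n. fst (f n), \<lambda>n. snd (f n))
        \<le> 2 * nrm (lp_sum p (direct_sum V W)) f"
      by (auto simp: lp_sum_simps(3) n)
  qed (auto simp: lp_sum_simps fun_eq_iff direct_sum_def split: prod.splits)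
  show "bounded_operator (direct_sum (lp_sum p V) (lp_sum p W)) (lp_sum p (direct_sum V W))
    (\<lambda>(f, g) n. (f n, g n))"
  proof (rule bounded_operatorI[where K = 1])
    fix h assume "h \<in> car (direct_sum (lp_sum p V) (lp_sum p W))"
    then obtain f g where h: "h = (f, g)" "f \<in> car (lp_sum p V)" "g \<in> car (lp_sum p W)" by auto
    then show "(case h of (f, g) \<Rightarrow> \<lambda>n. (f n, g n)) \<in> car (lp_sum p (direct_sum V W))"
      "nrm (lp_sum p (direct_sum V W)) (case h of (f, g) \<Rightarrow> \<lambda>n. (f n, g n))
        \<le> 1 * nrm (direct_sum (lp_sum p V) (lp_sum p W)) h"
      using lp_triangle[OF p, of "\<lambda>n. nrm V (f n)" "\<lambda>n. nrm W (g n)"] by (auto simp: lp_sum_simps)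
  qed (auto simp: lp_sum_simps fun_eq_iff)
qed (auto simp: lp_sum_simps)

lemma isomorphic_direct_sum_lp_sum:
  assumes p: "1 \<le> p" and X: "normed_space X"
  shows "isomorphic (direct_sum X (lp_sum p X)) (lp_sum p X)"
proof (rule isomorphicI)
  show "bounded_operator (direct_sum X (lp_sum p X)) (lp_sum p X) (\<lambda>(x, f). case_nat x f)"
  proof (rule bounded_operatorI[where K = 1])
    fix h assume "h \<in> car (direct_sum X (lp_sum p X))"
    then obtain x f where h: "h = (x, f)" "x \<in> car X" "f \<in> car (lp_sum p X)" by auto
    define a where "a n = nrm X (f n)" for n
    define b where "b n = (if n = 0 then nrm X x else 0)" for n :: nat
    \<comment> \<open>The sequence of norms is split into its entry at 0 and the shifted sequence
      \<open>c\<close>. The reindexing \<open>n - 1\<close> sends 0 and 1 to the same place, but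
      \<open>c\<close> vanishes at 0.\<close>
    define c where "c n = (if n = 0 then 0 else a (n - 1))" for n
    have a: "in_lp p a" using h(3) by (simp add: a_def[abs_def] lp_sum_simps)
    have b: "in_lp p b \<and> lp_norm p b \<le> nrm X x"
      unfolding b_def using lp_single[OF p, of 0 "nrm X x"] nspace_nonneg[OF X h(2)] by simp
    have c: "in_lp p c \<and> lp_norm p c \<le> lp_norm p a"
      by (rule lp_dominated[OF p a, where h = "\<lambda>n. n - 1"]) (auto simp: c_def inj_on_def split: if_splits)
    have bc: "in_lp p (\<lambda>n. b n + c n)" "lp_norm p (\<lambda>n. b n + c n) \<le> nrm X x + lp_norm p a"
      using lp_triangle[OF p conjunct1[OF b] conjunct1[OF c]] b c by auto
    have eq: "(\<lambda>n. nrm X (case_nat x f n)) = (\<lambda>n. b n + c n)"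
      by (auto simp: a_def b_def c_def split: nat.splits)
    show "(case h of (x, f) \<Rightarrow> case_nat x f) \<in> car (lp_sum p X)"
      using h bc(1) by (auto simp: lp_sum_simps eq split: nat.splits)
    show "nrm (lp_sum p X) (case h of (x, f) \<Rightarrow> case_nat x f) \<le> 1 * nrm (direct_sum X (lp_sum p X)) h"
      using h bc(2) by (simp add: lp_sum_simps eq a_def[abs_def])
  qed (auto simp: lp_sum_simps fun_eq_iff split: nat.splits)
  show "bounded_operator (lp_sum p X) (direct_sum X (lp_sum p X)) (\<lambda>f. (f 0, \<lambda>n. f (Suc n)))"
  proof (rule bounded_operatorI[where K = 2])
    fix f assume f: "f \<in> car (lp_sum p X)"
    have "in_lp p (\<lambda>n. nrm X (f (Suc n))) \<and> lp_norm p (\<lambda>n. nrm X (f (Suc n))) \<le> lp_norm p (\<lambda>n. nrm X (f n))"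
      by (rule lp_dominated[OF p, where h = Suc]) (use f in \<open>auto simp: lp_sum_simps\<close>)
    then show "(f 0, \<lambda>n. f (Suc n)) \<in> car (direct_sum X (lp_sum p X))"
      "nrm (direct_sum X (lp_sum p X)) (f 0, \<lambda>n. f (Suc n)) \<le> 2 * nrm (lp_sum p X) f"
      using lp_sum_component[OF p X f, of 0] f by (auto simp: lp_sum_simps)
  qed (auto simp: lp_sum_simps fun_eq_iff)
qed (auto simp: lp_sum_simps fun_eq_iff split: nat.splits)

lemma isomorphic_lp_sum_lp_sum:
  assumes p: "1 \<le> p" and X: "normed_space X"
  shows "isomorphic (lp_sum p (lp_sum p X)) (lp_sum p X)"
proof (rule isomorphicI)
  show "bounded_operator (lp_sum p (lp_sum p X)) (lp_sum p X)
    (\<lambda>f i. f (fst (prod_decode i)) (snd (prod_decode i)))"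
  proof (rule bounded_operatorI[where K = 1])
    fix f assume "f \<in> car (lp_sum p (lp_sum p X))"
    then show "(\<lambda>i. f (fst (prod_decode i)) (snd (prod_decode i))) \<in> car (lp_sum p X)"
      "nrm (lp_sum p X) (\<lambda>i. f (fst (prod_decode i)) (snd (prod_decode i))) \<le> 1 * nrm (lp_sum p (lp_sum p X)) f"
      using lp_flatten[OF p, of "\<lambda>k n. nrm X (f k n)"] by (auto simp: lp_sum_simps)
  qed (auto simp: lp_sum_simps fun_eq_iff)
  show "bounded_operator (lp_sum p X) (lp_sum p (lp_sum p X)) (\<lambda>f k n. f (prod_encode (k, n)))"
  proof (rule bounded_operatorI[where K = 1])
    fix f assume "f \<in> car (lp_sum p X)"
    then show "(\<lambda>k n. f (prod_encode (k, n))) \<in> car (lp_sum p (lp_sum p X))"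
      "nrm (lp_sum p (lp_sum p X)) (\<lambda>k n. f (prod_encode (k, n))) \<le> 1 * nrm (lp_sum p X) f"
      using lp_unflatten[OF p, of "\<lambda>n. nrm X (f n)"] by (auto simp: lp_sum_simps)
  qed (auto simp: lp_sum_simps fun_eq_iff)
qed (auto simp: lp_sum_simps)

text \<open>Pelczynski's decomposition method.\<close>

lemma isomorphic_complemented_lp_sum:
  fixes V :: "('f::{real_normed_field, euclidean_space}, 'v::ab_group_add) nspace"
    and W :: "('f, 'w::ab_group_add) nspace"
    and X :: "('f, 'x::ab_group_add) nspace"
  assumes p: "1 \<le> p" and V: "normed_space V" and W: "normed_space W" and X: "normed_space X"
    and iso: "isomorphic (direct_sum V W) (lp_sum p X)"
    and A: "bounded_operator (lp_sum p X) V A" and B: "bounded_operator V (lp_sum p X) B"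
    and BA: "\<And>x. x \<in> car (lp_sum p X) \<Longrightarrow> B (A x) = x"
  shows "isomorphic V (lp_sum p X)"
proof -
  define L where "L = lp_sum p X"
  define Z where "Z = V\<lparr>car := {v \<in> car V. B v = 0}\<rparr>"
  note D = normed_space_direct_sum and S = normed_space_lp_sum[OF p]
  have L: "normed_space L" unfolding L_def by (rule S[OF X])
  have Z: "normed_space Z" and VZ: "isomorphic V (direct_sum L Z)"
    unfolding Z_def L_def
    by (rule isomorphic_complement[OF V S[OF X] A B BA]; assumption)+
  have LL: "isomorphic L (lp_sum p L)"
    unfolding L_def by (rule isomorphic_sym[OF isomorphic_lp_sum_lp_sum[OF p X]])
  \<comment> \<open>The space \<open>L\<close> is isomorphic to \<open>lp_sum p L\<close>, which
    absorbs one further copy of \<open>L\<close>.\<close>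
  have L2: "isomorphic (direct_sum L L) L"
  proof (rule isomorphic_trans[OF D[OF L L] D[OF L S[OF L]] L])
    show "isomorphic (direct_sum L L) (direct_sum L (lp_sum p L))"
      by (rule isomorphic_direct_sum[OF L L L S[OF L] isomorphic_refl LL])
    show "isomorphic (direct_sum L (lp_sum p L)) L"
      by (rule isomorphic_trans[OF D[OF L S[OF L]] S[OF L] L
            isomorphic_direct_sum_lp_sum[OF p L] isomorphic_sym[OF LL]])
  qed
  \<comment> \<open>By the isomorphism of \<open>L\<close> with \<open>lp_sum p L\<close>, the space
    \<open>L\<close> is also the sum of \<open>lp_sum p V\<close> and \<open>lp_sum p W\<close>, and
    the first of these absorbs one further copy of \<open>V\<close>.\<close>
  have VL: "isomorphic (direct_sum V L) L"
  proof -
    note n = L S[OF V] S[OF W] V W D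
    let ?VW = "direct_sum (lp_sum p V) (lp_sum p W)"
    have 1: "isomorphic ?VW L"
    proof -
      have "isomorphic (lp_sum p (direct_sum V W)) (lp_sum p L)"
        using isomorphic_lp_sum[OF p D[OF V W] L] iso unfolding L_def by blast
      then have "isomorphic (lp_sum p (direct_sum V W)) L"
        by (rule isomorphic_trans[OF S[OF D[OF V W]] S[OF L] L _ isomorphic_sym[OF LL]])
      then show ?thesis
        by (rule isomorphic_trans[OF D[OF S[OF V] S[OF W]] S[OF D[OF V W]] L
              isomorphic_sym[OF isomorphic_lp_sum_direct_sum[OF p V W]]])
    qed
    have 2: "isomorphic (direct_sum V ?VW) ?VW"
      by (rule isomorphic_trans[OF _ _ _ isomorphic_sym[OF isomorphic_direct_sum_assoc]
            isomorphic_direct_sum[OF _ _ _ _ isomorphic_direct_sum_lp_sum[OF p V] isomorphic_refl]])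
        (intro n)+
    show ?thesis
      by (rule isomorphic_trans[OF _ _ _ isomorphic_direct_sum[OF _ _ _ _ isomorphic_refl isomorphic_sym[OF 1]]
            isomorphic_trans[OF _ _ _ 2 1]]) (intro n)+
  qed
  \<comment> \<open>Doubling the summand \<open>L\<close> of \<open>V\<close> gives
    \<open>V\<close>, \<open>L + Z\<close>, \<open>L + L + Z\<close> and \<open>L + V\<close> in
    turn, all isomorphic.\<close>
  have "isomorphic V (direct_sum V L)"
  proof -
    note n = L V Z D
    have "isomorphic (direct_sum L Z) (direct_sum (direct_sum L L) Z)"
      by (rule isomorphic_direct_sum[OF _ _ _ _ isomorphic_sym[OF L2] isomorphic_refl]) (intro n)+
    then have "isomorphic (direct_sum L Z) (direct_sum L (direct_sum L Z))"
      by (rule isomorphic_trans[OF _ _ _ _ isomorphic_direct_sum_assoc, rotated 3]) (intro n)+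
    then have "isomorphic V (direct_sum L (direct_sum L Z))"
      by (rule isomorphic_trans[OF _ _ _ VZ, rotated 3]) (intro n)+
    moreover have "isomorphic (direct_sum L (direct_sum L Z)) (direct_sum L V)"
      by (rule isomorphic_direct_sum[OF _ _ _ _ isomorphic_refl isomorphic_sym[OF VZ]]) (intro n)+
    ultimately have "isomorphic V (direct_sum L V)"
      by (rule isomorphic_trans[rotated 3]) (intro n)+
    then show ?thesis
      by (rule isomorphic_trans[OF _ _ _ _ isomorphic_direct_sum_commute, rotated 3]) (intro n)+
  qed
  then show ?thesis
    unfolding L_def[symmetric] using isomorphic_trans[OF V D[OF V L] L _ VL] by blast
qed

text \<open>The factorization hypothesis is applied to the projection onto \<open>V\<close> along
  \<open>W\<close>, transported to the sum space. If the identity factors through it, the whole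
  space is isomorphic to a complemented subspace of \<open>V\<close>, and the decomposition method
  applies; otherwise the same holds for \<open>W\<close>.\<close>

lemma primary_lp_sum:
  fixes X :: "('f::{real_normed_field, euclidean_space}, 'x::ab_group_add) nspace"
  assumes p: "1 \<le> p" and X: "banach_space X"
    and factor: "\<And>T. bounded_operator (lp_sum p X) (lp_sum p X) T \<Longrightarrow>
      identity_factors_through (lp_sum p X) T \<or> identity_factors_through (lp_sum p X) (\<lambda>x. x - T x)"
  shows "primary TYPE('v::ab_group_add) TYPE('w::ab_group_add) (lp_sum p X)"
  unfolding primary_def
proof (intro conjI allI impI)
  let ?L = "lp_sum p X"
  show "banach_space ?L" by (rule banach_space_lp_sum[OF p X])
  have nX: "normed_space X" using X by (simp add: banach_space_def)
  have L: "normed_space ?L" by (rule normed_space_lp_sum[OF p nX])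
  \<comment> \<open>Stated for an arbitrary pair of summands, since it is used once more with their
    order reversed.\<close>
  have factor_summand: "isomorphic V ?L"
    if V: "normed_space V" and W: "normed_space W" and iso: "isomorphic (direct_sum V W) ?L"
      and Q: "bounded_operator ?L V Q" and J: "bounded_operator V ?L J"
      and f: "identity_factors_through ?L R" and R: "\<And>x. x \<in> car ?L \<Longrightarrow> R x = J (Q x)"
    for V :: "('f, 'a::ab_group_add) nspace" and W :: "('f, 'b::ab_group_add) nspace" and Q J R
  proof -
    obtain S U where SU: "bounded_operator ?L ?L S" "bounded_operator ?L ?L U" "\<forall>x\<in>car ?L. U (R (S x)) = x"
      using f unfolding identity_factors_through_def by blast
    show ?thesis
      by (rule isomorphic_complemented_lp_sum[OF p V W nX iso bop_compose[OF L L SU(1) Q] bop_compose[OF V L J SU(2)]])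
        (use SU(3) R bop_car[OF SU(1)] in force)
  qed
  fix V :: "('f, 'v) nspace" and W :: "('f, 'w) nspace"
  assume "banach_space V \<and> banach_space W \<and> isomorphic (direct_sum V W) ?L"
  then have V: "normed_space V" and W: "normed_space W" and iso: "isomorphic (direct_sum V W) ?L"
    by (auto simp: banach_space_def)
  obtain T S where T: "bounded_operator (direct_sum V W) ?L T" and S: "bounded_operator ?L (direct_sum V W) S"
    and TS: "\<forall>y\<in>car ?L. T (S y) = y" using iso unfolding isomorphic_def by blast
  note D = normed_space_direct_sum[OF V W]
  have j1: "bounded_operator V (direct_sum V W) (\<lambda>v. (v, 0))"
    and j2: "bounded_operator W (direct_sum V W) (\<lambda>w. (0, w))"
    by (rule bounded_operatorI[where K = 1];
        simp add: nspace_zero V W nspace_scl_zero nspace_nrm_zero)+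
  have q1: "bounded_operator (direct_sum V W) V fst" and q2: "bounded_operator (direct_sum V W) W snd"
    by (rule bounded_operatorI[where K = 1]; auto simp: nspace_nonneg V W)+
  note J1 = bop_compose[OF V D j1 T] and J2 = bop_compose[OF W D j2 T]
    and Q1 = bop_compose[OF L D S q1] and Q2 = bop_compose[OF L D S q2]
  have "identity_factors_through ?L (\<lambda>x. T (fst (S x), 0)) \<or>
        identity_factors_through ?L (\<lambda>x. x - T (fst (S x), 0))"
    by (rule factor[OF bop_compose[OF L V Q1 J1]])
  then show "isomorphic V ?L \<or> isomorphic W ?L"
  proof
    assume "identity_factors_through ?L (\<lambda>x. T (fst (S x), 0))"
    from factor_summand[OF V W iso Q1 J1 this] show ?thesis by blast
  next
    assume *: "identity_factors_through ?L (\<lambda>x. x - T (fst (S x), 0))"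
    \<comment> \<open>The complementary projection is the one onto \<open>W\<close>, so it factors
      through \<open>W\<close> in the same way.\<close>
    have eq: "x - T (fst (S x), 0) = T (0, snd (S x))" if x: "x \<in> car ?L" for x
    proof -
      have "fst (S x) \<in> car V" "snd (S x) \<in> car W" using bop_car[OF S x] by (auto simp: mem_Times_iff)
      then have "T ((fst (S x), 0) + (0, snd (S x))) = T (fst (S x), 0) + T (0, snd (S x))"
        by (intro bop_add[OF T]) (auto simp: nspace_zero V W)
      then show ?thesis using TS x by (simp add: algebra_simps)
    qed
    have "isomorphic (direct_sum W V) ?L"
      by (rule isomorphic_trans[OF normed_space_direct_sum[OF W V] D L isomorphic_direct_sum_commute iso])
    from factor_summand[OF W V this Q2 J2 * eq] show ?thesis by blast
  qed
qed

section \<open>Marcinkiewicz spaces\<close>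

lemma marcinkiewicz_simps:
  "f \<in> car (marcinkiewicz s) \<longleftrightarrow> bdd_above (marcinkiewicz_averages s f)"
  "scl (marcinkiewicz s) c f = (\<lambda>j. c * f j)"
  "nrm (marcinkiewicz s) f = Sup (marcinkiewicz_averages s f)"
  by (simp_all add: marcinkiewicz_def)

text \<open>Clearing the denominators \<open>s (card A)\<close> removes the supremum. The empty set
  is excluded because the value of \<open>s\<close> at 0 is arbitrary.\<close>

lemma marcinkiewicz_le_iff:
  assumes "weight s"
  shows "f \<in> car (marcinkiewicz s) \<and> nrm (marcinkiewicz s) f \<le> K \<longleftrightarrow>
    (\<forall>A. finite A \<longrightarrow> A \<noteq> {} \<longrightarrow> (\<Sum>j\<in>A. norm (f j)) \<le> K * s (card A))"
proof -
  have s: "0 < s n" if "1 \<le> n" for n using assms that by (simp add: weight_def)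
  have ne: "marcinkiewicz_averages s f \<noteq> {}"
    unfolding marcinkiewicz_averages_def by (auto intro!: exI[of _ 1] exI[of _ "{0}"])
  have *: "(\<forall>x\<in>marcinkiewicz_averages s f. x \<le> K) \<longleftrightarrow>
    (\<forall>A. finite A \<longrightarrow> A \<noteq> {} \<longrightarrow> (\<Sum>j\<in>A. norm (f j)) \<le> K * s (card A))" for K
  proof -
    have avg: "marcinkiewicz_averages s f = {(\<Sum>j\<in>A. norm (f j)) / s (card A) | A. finite A \<and> A \<noteq> {}}"
      unfolding marcinkiewicz_averages_def by (auto simp: Suc_le_eq card_gt_0_iff)
    have "(\<Sum>j\<in>A. norm (f j)) / s (card A) \<le> K \<longleftrightarrow> (\<Sum>j\<in>A. norm (f j)) \<le> K * s (card A)"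
      if "finite A" "A \<noteq> {}" for A
      using s[of "card A"] that by (simp add: divide_le_eq Suc_le_eq card_gt_0_iff)
    then show ?thesis unfolding avg by blast
  qed
  show ?thesis
    unfolding *[symmetric] marcinkiewicz_simps
    using ne cSup_le_iff[OF ne] by (auto simp: bdd_above_def)
qed

text \<open>The scalar field as a normed space, so that functionals are operators.\<close>

definition scalars :: "('f::{real_normed_field, euclidean_space}, 'f) nspace" where
  "scalars = \<lparr>car = UNIV, scl = (*), nrm = norm\<rparr>"

lemma scalars_simps [simp]: "car scalars = UNIV" "scl scalars = (*)" "nrm scalars = norm"
  by (simp_all add: scalars_def)

lemma normed_space_scalars: "normed_space scalars"
proof (rule normed_spaceI)
  show "vector_space (scl scalars :: 'f::{real_normed_field, euclidean_space} \<Rightarrow> _)"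
    by unfold_locales (auto simp: algebra_simps)
qed (auto simp: norm_mult norm_triangle_ineq)

lemma sum_apply: "(\<Sum>i\<in>I. f i) x = (\<Sum>i\<in>I. f i x)"
  by (induction I rule: infinite_finite_induct) auto

locale marcinkiewicz_weight =
  fixes s w :: "nat \<Rightarrow> real"
  assumes weight: "weight s" and mono: "mono_on {1..} s"
    and deriv: "discrete_derivative s w" and ess_decr: "essentially_decreasing w"
    and inf_sup: "(INF n\<in>{1..}. SUP k\<in>{1..}. s k / s (k * n)) = 0"
begin

abbreviation M :: "('f::{real_normed_field, euclidean_space}, nat \<Rightarrow> 'f) nspace" where
  "M \<equiv> marcinkiewicz s"

lemma s_pos: "1 \<le> n \<Longrightarrow> 0 < s n"
  using weight by (simp add: weight_def)

lemma s_mono: "1 \<le> m \<Longrightarrow> m \<le> n \<Longrightarrow> s m \<le> s n"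
  using mono by (auto simp: mono_on_def)

lemmas M_le_iff = marcinkiewicz_le_iff[OF weight]

lemma M_sum_le:
  assumes "f \<in> car M" "finite A" "A \<noteq> {}"
  shows "(\<Sum>j\<in>A. norm (f j)) \<le> nrm M f * s (card A)"
  using M_le_iff[of f "nrm M f"] assms by blast

lemma M_component: "norm (f j) \<le> s 1 * nrm M f" if "f \<in> car M"
  using M_sum_le[OF that, of "{j}"] by (simp add: mult.commute)

lemma M_nonneg: "0 \<le> nrm M f" if "f \<in> car M"
proof -
  have "0 \<le> s 1 * nrm M f" using M_component[OF that, of 0] norm_ge_zero order_trans by blast
  then show ?thesis using s_pos[of 1] by (simp add: zero_le_mult_iff)
qed

text \<open>The norm sees an index set only through its cardinality, so injective reindexing is
  harmless. Only the indices in \<open>A\<close> with \<open>g j \<noteq> 0\<close> are moved,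
  possibly fewer than \<open>card A\<close>, and this is made up for by monotonicity of
  \<open>s\<close>.\<close>

lemma M_dominated:
  assumes f: "f \<in> car M" and inj: "inj_on h {j. g j \<noteq> 0}"
    and le: "\<And>j. g j \<noteq> 0 \<Longrightarrow> norm (g j) \<le> norm (f (h j))"
  shows "g \<in> car M \<and> nrm M g \<le> nrm M f"
  unfolding M_le_iff
proof (intro allI impI)
  fix A :: "nat set" assume A: "finite A" "A \<noteq> {}"
  let ?G = "{j\<in>A. g j \<noteq> 0}"
  have "(\<Sum>j\<in>A. norm (g j)) = (\<Sum>j\<in>?G. norm (g j))" using A by (intro sum.mono_neutral_right) auto
  also have "\<dots> \<le> (\<Sum>j\<in>?G. norm (f (h j)))" using le by (intro sum_mono) auto
  also have "\<dots> = (\<Sum>j\<in>h ` ?G. norm (f j))"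
    using inj_on_subset[OF inj, of ?G] by (subst sum.reindex) auto
  also have "\<dots> \<le> nrm M f * s (card A)"
  \<comment> \<open>The empty image is treated apart, as nothing is known about
    \<open>s 0\<close>.\<close>
  proof (cases "?G = {}")
    case True
    then show ?thesis using M_nonneg[OF f] s_pos[of "card A"] A
      by (simp add: Suc_le_eq card_gt_0_iff less_imp_le del: Collect_empty_eq)
  next
    case False
    have "1 \<le> card (h ` ?G)" using False A by (simp add: Suc_le_eq card_gt_0_iff)
    moreover have "card (h ` ?G) \<le> card A"
      using A by (intro order_trans[OF card_image_le card_mono]) auto
    ultimately have "nrm M f * s (card (h ` ?G)) \<le> nrm M f * s (card A)"
      by (intro mult_left_mono s_mono M_nonneg[OF f])
    then show ?thesis using M_sum_le[OF f, of "h ` ?G"] A False by auto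
  qed
  finally show "(\<Sum>j\<in>A. norm (g j)) \<le> nrm M f * s (card A)" .
qed

lemma normed_space_M: "normed_space (M :: ('f::{real_normed_field, euclidean_space}, nat \<Rightarrow> 'f) nspace)"
proof (rule normed_spaceI)
  show "vector_space (scl (M :: ('f, nat \<Rightarrow> 'f) nspace))"
    by unfold_locales (auto simp: marcinkiewicz_simps(2) fun_eq_iff algebra_simps)
  have z: "(0 :: nat \<Rightarrow> 'f) \<in> car M \<and> nrm M (0 :: nat \<Rightarrow> 'f) \<le> 0" by (simp add: M_le_iff)
  then show "(0 :: nat \<Rightarrow> 'f) \<in> car M" by blast
  fix f :: "nat \<Rightarrow> 'f" and c :: 'f assume f: "f \<in> car M"
  show "0 \<le> nrm M f" by (rule M_nonneg[OF f])
  show "nrm M f = 0 \<longleftrightarrow> f = 0"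
  proof
    assume "nrm M f = 0"
    then show "f = 0" using M_component[OF f] by (simp add: fun_eq_iff)
  next
    assume "f = 0"
    then show "nrm M f = 0" using z M_nonneg[OF conjunct1[OF z]] by simp
  qed
  have sc: "scl M c f \<in> car M \<and> nrm M (scl M c f) \<le> norm c * nrm M f" if f: "f \<in> car M" for c and f :: "nat \<Rightarrow> 'f"
    unfolding M_le_iff
    using M_sum_le[OF f]
    by (simp add: marcinkiewicz_simps(2) norm_mult sum_distrib_left[symmetric] mult.assoc mult_left_mono)
  show c: "scl M c f \<in> car M" using sc[OF f] by blast
  show "nrm M (scl M c f) = norm c * nrm M f"
  proof (cases "c = 0")
    case True
    then show ?thesis using sc[OF f, of c] M_nonneg[OF c] by simp
  next
    case False
    have "scl M (1/c) (scl M c f) = f" using False by (simp add: marcinkiewicz_simps(2))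
    then have "nrm M f \<le> norm (1/c) * nrm M (scl M c f)" using sc[OF c, of "1/c"] by simp
    then have "norm c * nrm M f \<le> nrm M (scl M c f)" using False by (simp add: norm_divide field_simps)
    then show ?thesis using sc[OF f, of c] by linarith
  qed
next
  fix f g :: "nat \<Rightarrow> 'f" assume f: "f \<in> car M" and g: "g \<in> car M"
  have "f + g \<in> car M \<and> nrm M (f + g) \<le> nrm M f + nrm M g"
    unfolding M_le_iff
  proof (intro allI impI)
    fix A :: "nat set" assume A: "finite A" "A \<noteq> {}"
    have "(\<Sum>j\<in>A. norm ((f + g) j)) \<le> (\<Sum>j\<in>A. norm (f j)) + (\<Sum>j\<in>A. norm (g j))"
      unfolding sum.distrib[symmetric] by (intro sum_mono) (simp add: norm_triangle_ineq)
    also have "\<dots> \<le> (nrm M f + nrm M g) * s (card A)"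
      using M_sum_le[OF f A] M_sum_le[OF g A] by (simp add: distrib_right)
    finally show "(\<Sum>j\<in>A. norm ((f + g) j)) \<le> (nrm M f + nrm M g) * s (card A)" .
  qed
  then show "f + g \<in> car M" "nrm M (f + g) \<le> nrm M f + nrm M g" by auto
qed

lemma banach_space_M: "banach_space (M :: ('f::{real_normed_field, euclidean_space}, nat \<Rightarrow> 'f) nspace)"
proof -
  note ns = normed_space_M
  have "\<exists>l\<in>car M. (\<lambda>n. nrm M (f n - l)) \<longlonglongrightarrow> 0"
    if f: "\<And>n. f n \<in> car M" and C: "\<And>e. e > 0 \<Longrightarrow> \<exists>N. \<forall>m\<ge>N. \<forall>n\<ge>N. nrm M (f m - f n) < e"
    for f :: "nat \<Rightarrow> nat \<Rightarrow> 'f"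
  proof -
    have "convergent (\<lambda>n. f n j)" for j
    proof (rule Cauchy_convergent, rule metric_CauchyI)
      fix e :: real assume e: "0 < e"
      then obtain N where N: "\<forall>m\<ge>N. \<forall>n\<ge>N. nrm M (f m - f n) < e / s 1" using C[of "e / s 1"] s_pos[of 1] by auto
      have "dist (f m j) (f n j) < e" if "m \<ge> N" "n \<ge> N" for m n
      proof -
        have "dist (f m j) (f n j) \<le> s 1 * nrm M (f m - f n)"
          using M_component[OF nspace_diff[OF ns f f], of m n j] by (simp add: dist_norm)
        also have "\<dots> < e" using N[rule_format, OF that] s_pos[of 1] by (simp add: field_simps)
        finally show ?thesis .
      qed
      then show "\<exists>N. \<forall>m\<ge>N. \<forall>n\<ge>N. dist (f m j) (f n j) < e" by blast
    qed
    then obtain l where l: "\<And>j. (\<lambda>n. f n j) \<longlonglongrightarrow> l j" unfolding convergent_def by metis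
    \<comment> \<open>For each finite set \<open>A\<close> the defining inequality involves a finite
      sum, which passes to the coordinatewise limit.\<close>
    have close: "f m - l \<in> car M \<and> nrm M (f m - l) \<le> e"
      if N: "\<forall>m\<ge>N. \<forall>n\<ge>N. nrm M (f m - f n) < e" and m: "m \<ge> N" for N e m
      unfolding M_le_iff
    proof (intro allI impI)
      fix A :: "nat set" assume A: "finite A" "A \<noteq> {}"
      show "(\<Sum>j\<in>A. norm ((f m - l) j)) \<le> e * s (card A)"
      proof (rule LIMSEQ_le_const2)
        show "(\<lambda>n. \<Sum>j\<in>A. norm ((f m - f n) j)) \<longlonglongrightarrow> (\<Sum>j\<in>A. norm ((f m - l) j))"
          by (simp, intro tendsto_intros l)
        have "(\<Sum>j\<in>A. norm ((f m - f n) j)) \<le> e * s (card A)" if "n \<ge> N" for n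
        proof -
          have "nrm M (f m - f n) * s (card A) \<le> e * s (card A)"
            using N m that s_pos[of "card A"] A
            by (intro mult_right_mono) (auto simp: Suc_le_eq card_gt_0_iff less_imp_le)
          then show ?thesis using M_sum_le[OF nspace_diff[OF ns f f] A, of m n] by linarith
        qed
        then show "\<exists>N. \<forall>n\<ge>N. (\<Sum>j\<in>A. norm ((f m - f n) j)) \<le> e * s (card A)" by blast
      qed
    qed
    obtain N where "\<forall>m\<ge>N. \<forall>n\<ge>N. nrm M (f m - f n) < 1" using C[of 1] by auto
    from close[OF this, of N] have "f N - (f N - l) \<in> car M" using nspace_diff[OF ns f] by blast
    then have lM: "l \<in> car M" by simp
    have "(\<lambda>n. nrm M (f n - l)) \<longlonglongrightarrow> 0"
    proof (rule LIMSEQ_I)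
      fix e :: real assume "0 < e"
      then obtain N where N: "\<forall>m\<ge>N. \<forall>n\<ge>N. nrm M (f m - f n) < e/2" using C[of "e/2"] by auto
      have "norm (nrm M (f m - l) - 0) < e" if "m \<ge> N" for m
        using close[OF N that] nspace_nonneg[OF ns, of "f m - l"] \<open>0 < e\<close> by simp
      then show "\<exists>N. \<forall>m\<ge>N. norm (nrm M (f m - l) - 0) < e" by blast
    qed
    then show ?thesis using lM by blast
  qed
  then show ?thesis using ns unfolding banach_space_def by blast
qed

text \<open>Up to a constant, \<open>s n / n\<close> is decreasing, because it is the average of the
  first \<open>n\<close> terms of an essentially decreasing sequence. The constant is the reciprocal
  of the infimum \<open>c\<close> of the ratios.\<close>

lemma quasi_concave: "\<exists>C>0. \<forall>k n. 1 \<le> k \<longrightarrow> k \<le> n \<longrightarrow> real k * s n \<le> C * real n * s k"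
proof -
  define c where "c = (INF (m, n) \<in> {(m, n). 1 \<le> m \<and> m \<le> n}. w m / w n)"
  have c: "0 < c" using ess_decr by (simp add: essentially_decreasing_def c_def)
  have w: "0 < w n" if "1 \<le> n" for n using deriv that by (simp add: discrete_derivative_def weight_def)
  have sw: "s n = (\<Sum>j=1..n. w j)" if "1 \<le> n" for n using deriv that by (simp add: discrete_derivative_def)
  have ratio: "c * w n \<le> w m" if "1 \<le> m" "m \<le> n" for m n
  proof -
    have "c \<le> (case (m, n) of (m, n) \<Rightarrow> w m / w n)"
      unfolding c_def
      by (rule cINF_lower) (use that in \<open>auto intro!: bdd_belowI2[where m = 0] less_imp_le[OF divide_pos_pos] w\<close>)
    then show ?thesis using w[of n] that by (simp add: field_simps)
  qed
  have c1: "c \<le> 1" using ratio[of 1 1] w[of 1] by simp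
  have "real k * s n \<le> (1 / c) * real n * s k" if k: "1 \<le> k" "k \<le> n" for k n
  proof -
    \<comment> \<open>Each of the first \<open>k\<close> terms of \<open>w\<close> is at least
      \<open>c * w j\<close>, so a later term is at most \<open>1 / c\<close> times their
      average.\<close>
    have each: "c * (real k * w j) \<le> s k" if "k < j" for j
    proof -
      have "(\<Sum>i=1..k. c * w j) \<le> (\<Sum>i=1..k. w i)" by (intro sum_mono ratio) (use that in auto)
      then show ?thesis using sw[OF k(1)] by (simp add: mult.left_commute)
    qed
    have "s n = (\<Sum>j=1..k. w j) + (\<Sum>j=k+1..n. w j)"
      using sw[of n] sum.ub_add_nat[of 1 k w "n - k"] k by simp
    then have "c * (real k * s n) = c * real k * s k + (\<Sum>j=k+1..n. c * (real k * w j))"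
      using sw[OF k(1)] by (simp add: distrib_left sum_distrib_left mult.assoc)
    also have "\<dots> \<le> real k * s k + (\<Sum>j=k+1..n. s k)"
      using c1 k s_pos[OF k(1)] by (intro add_mono sum_mono each mult_right_mono) (auto simp: mult_le_cancel_right1)
    also have "\<dots> = real n * s k" using k by (simp add: of_nat_diff algebra_simps)
    finally show ?thesis using c by (simp add: field_simps)
  qed
  then show ?thesis using c by (intro exI[of _ "1/c"]) auto
qed

text \<open>The infimum being 0, some supremum lies below \<open>\<eta>\<close>. To read this off
  for real numbers, the families must be known to be bounded: by monotonicity of \<open>s\<close>
  all ratios lie in the unit interval.\<close>

lemma lower_regular:
  assumes "0 < \<eta>"
  obtains N where "1 \<le> N" "\<And>k. 1 \<le> k \<Longrightarrow> s k \<le> \<eta> * s (k * N)"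
proof -
  have ratio: "0 \<le> s k / s (k * n)" "s k / s (k * n) \<le> 1" if "1 \<le> k" "1 \<le> n" for k n
  proof -
    have "1 \<le> k * n" using that mult_le_mono[of 1 k 1 n] by simp
    then show "0 \<le> s k / s (k * n)" "s k / s (k * n) \<le> 1"
      using s_pos[of k] s_pos[of "k * n"] s_mono[of k "k * n"] that by auto
  qed
  have bdd: "bdd_above ((\<lambda>k. s k / s (k * n)) ` {1..})" if "1 \<le> n" for n
    using ratio(2) that by (intro bdd_aboveI2[where M = 1]) auto
  have "0 \<le> (SUP k\<in>{1..}. s k / s (k * n))" if "1 \<le> n" for n
    using cSUP_upper[OF _ bdd[OF that], of 1] ratio(1)[of 1 n] that by auto
  then have below: "bdd_below ((\<lambda>n. SUP k\<in>{1..}. s k / s (k * n)) ` {1..})" by (intro bdd_belowI2[where m = 0]) simp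
  have "(INF n\<in>{1..}. SUP k\<in>{1..}. s k / s (k * n)) < \<eta>" using inf_sup assms by simp
  then obtain N where N: "1 \<le> N" "(SUP k\<in>{1..}. s k / s (k * N)) < \<eta>"
    using cINF_less_iff[OF _ below, of \<eta>] by fastforce
  have "s k \<le> \<eta> * s (k * N)" if "1 \<le> k" for k
  proof -
    have "1 \<le> k * N" using that N mult_le_mono[of 1 k 1 N] by simp
    moreover have "s k / s (k * N) \<le> \<eta>" using cSUP_upper[OF _ bdd[OF N(1)], of k] that N by auto
    ultimately show ?thesis using s_pos[of "k * N"] by (simp add: divide_le_eq)
  qed
  then show thesis using that N(1) by blast
qed

text \<open>On a test set \<open>A\<close> with \<open>n\<close> elements, the piece
  \<open>g i\<close> contributes at most \<open>s\<close> of the number of its support points in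
  \<open>A\<close>. These numbers add up to at most \<open>n\<close>, so on average a piece meets
  \<open>n / N\<close> points, where \<open>s\<close> is small compared with \<open>s n\<close>. The
  number \<open>N\<close> depends on \<open>\<delta>\<close> but not on the elements.\<close>

lemma disjoint_sum_small:
  assumes "0 < \<delta>"
  shows "\<exists>N\<ge>1. \<forall>g :: nat \<Rightarrow> nat \<Rightarrow> 'f::{real_normed_field, euclidean_space}.
      (\<forall>i<N. g i \<in> car M \<and> nrm M (g i) \<le> 1) \<longrightarrow>
      (\<forall>i<N. \<forall>i'<N. i \<noteq> i' \<longrightarrow> (\<forall>j. g i j = 0 \<or> g i' j = 0)) \<longrightarrow>
      nrm M (\<Sum>i<N. g i) \<le> \<delta> * real N"
proof -
  obtain C where C: "C > 0" "\<And>k n. 1 \<le> k \<Longrightarrow> k \<le> n \<Longrightarrow> real k * s n \<le> C * real n * s k"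
    using quasi_concave by blast
  \<comment> \<open>The estimates of the \<open>N\<close> pieces add up to
    \<open>\<eta> * s n * (N + C * N)\<close>, which then equals
    \<open>\<delta> * N * s n\<close>.\<close>
  define \<eta> where "\<eta> = \<delta> / (1 + C)"
  have \<eta>: "0 < \<eta>" using C(1) assms by (simp add: \<eta>_def)
  obtain N where N: "1 \<le> N" "\<And>k. 1 \<le> k \<Longrightarrow> s k \<le> \<eta> * s (k * N)" using lower_regular[OF \<eta>] by blast
  \<comment> \<open>An upper bound for \<open>s m\<close> that is affine in \<open>m\<close>, so
    that it can be summed over the pieces: \<open>s m \<le> \<eta> * s (m * N)\<close>, and
    \<open>s (m * N)\<close> is compared with \<open>s n\<close> by monotonicity if
    \<open>m * N \<le> n\<close> and by quasi-concavity otherwise.\<close>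
  have key: "s m \<le> \<eta> * s n * (1 + C * real N * real m / real n)" if mn: "1 \<le> m" "1 \<le> n" for m n
  proof -
    have mN: "1 \<le> m * N" using mn N mult_le_mono[of 1 m 1 N] by simp
    have "s (m * N) \<le> s n * (1 + C * real N * real m / real n)"
    proof (cases "m * N \<le> n")
      case True
      have "s (m * N) \<le> s n * 1" using s_mono[OF mN True] by simp
      also have "\<dots> \<le> s n * (1 + C * real N * real m / real n)"
        using s_pos[OF mn(2)] C(1) by (intro mult_left_mono) auto
      finally show ?thesis .
    next
      case False
      then have "real n * s (m * N) \<le> C * real (m * N) * s n" using C(2)[of n "m * N"] mn by simp
      then have "s (m * N) \<le> s n * (C * real N * real m / real n)" using mn by (simp add: field_simps)
      also have "\<dots> \<le> s n * (1 + C * real N * real m / real n)" using s_pos[OF mn(2)] by (intro mult_left_mono) auto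
      finally show ?thesis .
    qed
    then have "\<eta> * s (m * N) \<le> \<eta> * (s n * (1 + C * real N * real m / real n))" using \<eta> by (intro mult_left_mono) auto
    then show ?thesis using N(2)[OF mn(1)] by (simp add: mult.assoc)
  qed
  show ?thesis
  proof (intro exI[of _ N] conjI N(1) allI impI)
    fix g :: "nat \<Rightarrow> nat \<Rightarrow> 'f"
    assume g': "\<forall>i<N. g i \<in> car M \<and> nrm M (g i) \<le> 1"
      and disj: "\<forall>i<N. \<forall>i'<N. i \<noteq> i' \<longrightarrow> (\<forall>j. g i j = 0 \<or> g i' j = 0)"
    note g = g'[rule_format]
    have "(\<Sum>i<N. g i) \<in> car M \<and> nrm M (\<Sum>i<N. g i) \<le> \<delta> * real N"
      unfolding M_le_iff
    proof (intro allI impI)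
      fix A :: "nat set" assume A: "finite A" "A \<noteq> {}"
      define n where "n = card A"
      have n: "1 \<le> n" using A by (simp add: n_def Suc_le_eq card_gt_0_iff)
      \<comment> \<open>Disjointness of the supports enters only through these sets: they are
        disjoint subsets of \<open>A\<close>.\<close>
      define a where "a i = {j\<in>A. g i j \<noteq> 0}" for i
      have fa: "finite (a i)" for i using A by (simp add: a_def)
      have "(\<Sum>i<N. card (a i)) = card (\<Union>i<N. a i)"
        using disj fa by (intro card_UN_disjoint[symmetric]) (auto simp: a_def)
      also have "\<dots> \<le> n" unfolding n_def using A by (intro card_mono) (auto simp: a_def)
      finally have cards: "(\<Sum>i<N. real (card (a i))) \<le> real n" by (simp flip: of_nat_sum)
      have each: "(\<Sum>j\<in>A. norm (g i j)) \<le> \<eta> * s n * (1 + C * real N * real (card (a i)) / real n)"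
        if i: "i < N" for i
      proof (cases "a i = {}")
        case True
        then have "(\<Sum>j\<in>A. norm (g i j)) = 0" by (auto simp: a_def)
        then show ?thesis using \<eta> s_pos[OF n] C(1) by (simp add: add_nonneg_nonneg)
      next
        case False
        have ca: "1 \<le> card (a i)" using False fa by (simp add: Suc_le_eq card_gt_0_iff)
        have "(\<Sum>j\<in>A. norm (g i j)) = (\<Sum>j\<in>a i. norm (g i j))"
          using A by (intro sum.mono_neutral_right) (auto simp: a_def)
        also have "\<dots> \<le> nrm M (g i) * s (card (a i))" using g[OF i] fa False by (intro M_sum_le) auto
        also have "\<dots> \<le> 1 * s (card (a i))" using g[OF i] s_pos[OF ca] by (intro mult_right_mono) auto
        finally show ?thesis using key[OF ca n] by simp
      qed
      have "(\<Sum>j\<in>A. norm ((\<Sum>i<N. g i) j)) \<le> (\<Sum>j\<in>A. \<Sum>i<N. norm (g i j))"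
        by (intro sum_mono) (simp add: sum_apply norm_sum)
      also have "\<dots> = (\<Sum>i<N. \<Sum>j\<in>A. norm (g i j))" by (rule sum.swap)
      also have "\<dots> \<le> (\<Sum>i<N. \<eta> * s n * (1 + C * real N * real (card (a i)) / real n))"
        by (intro sum_mono each) auto
      also have "\<dots> = \<eta> * s n * (real N + C * real N * (\<Sum>i<N. real (card (a i))) / real n)"
        by (simp add: sum_distrib_left[symmetric] sum.distrib sum_divide_distrib[symmetric])
      also have "\<dots> \<le> \<eta> * s n * (real N + C * real N)"
        using \<eta> s_pos[OF n] C(1) cards n
        by (intro mult_left_mono add_left_mono) (auto simp: divide_le_eq mult_left_mono)
      also have "\<dots> = \<delta> * real N * s (card A)"
        using C(1) by (simp add: \<eta>_def n_def field_simps)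
      finally show "(\<Sum>j\<in>A. norm ((\<Sum>i<N. g i) j)) \<le> \<delta> * real N * s (card A)" .
    qed
    then show "nrm M (\<Sum>i<N. g i) \<le> \<delta> * real N" by blast
  qed
qed

end

section \<open>Small restrictions of functionals and oscillations\<close>

text \<open>The elements are distributed according to the residue modulo \<open>N\<close> of their
  position in the increasing enumeration.\<close>

lemma split_infinite:
  assumes A: "infinite (A :: nat set)" and N: "1 \<le> (N :: nat)"
  obtains B where "\<And>i. infinite (B i)" "\<And>i. B i \<subseteq> A"
    "\<And>i i'. i < N \<Longrightarrow> i' < N \<Longrightarrow> i \<noteq> i' \<Longrightarrow> B i \<inter> B i' = {}"
proof -
  define B where "B i = range (\<lambda>m. enumerate A (N * m + i))" for i
  have inj: "inj (enumerate A)" by (rule strict_mono_imp_inj_on[OF strict_mono_enumerate[OF A]])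
  show thesis
  proof (rule that[of B])
    fix i
    show "infinite (B i)" unfolding B_def
      using N by (intro range_inj_infinite injI) (auto simp: inj_eq[OF inj])
    show "B i \<subseteq> A" using enumerate_in_set[OF A] by (auto simp: B_def)
    fix i' assume i: "i < N" "i' < N" "i \<noteq> i'"
    have "N * m + i \<noteq> N * m' + i'" for m m'
    proof
      assume "N * m + i = N * m' + i'"
      then have "(N * m + i) mod N = (N * m' + i') mod N" by simp
      then show False using i by simp
    qed
    then show "B i \<inter> B i' = {}" by (auto simp: B_def inj_eq[OF inj])
  qed
qed

text \<open>Bolzano-Weierstrass for one index \<open>i\<close> after the other. Finite dimension of
  the values is essential; the limit of the subsequence is arbitrary, hence differences rather than
  values become small.\<close>

lemma small_oscillation:
  fixes x :: "'i \<Rightarrow> nat \<Rightarrow> 'a::euclidean_space"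
  assumes "finite F" and A: "infinite A" and b: "\<And>i. i \<in> F \<Longrightarrow> bounded (range (x i))" and e: "0 < \<epsilon>"
  shows "\<exists>B. infinite B \<and> B \<subseteq> A \<and> (\<forall>i\<in>F. \<forall>m\<in>B. \<forall>n\<in>B. norm (x i m - x i n) \<le> \<epsilon>)"
  using assms(1) b
proof (induction F rule: finite_induct)
  case empty
  show ?case using A by blast
next
  case (insert i F)
  then obtain B where B: "infinite B" "B \<subseteq> A" "\<forall>i\<in>F. \<forall>m\<in>B. \<forall>n\<in>B. norm (x i m - x i n) \<le> \<epsilon>" by auto
  have "bounded (range (x i \<circ> enumerate B))"
    using insert.prems[of i] by (rule bounded_subset) auto
  then obtain l r where r: "strict_mono r" "((x i \<circ> enumerate B) \<circ> r) \<longlonglongrightarrow> l"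
    using bounded_imp_convergent_subsequence by blast
  then obtain n0 where n0: "\<And>n. n \<ge> n0 \<Longrightarrow> dist (x i (enumerate B (r n))) l < \<epsilon> / 2"
    using r(2)[unfolded lim_sequentially, rule_format, of "\<epsilon> / 2"] e by auto
  define B' where "B' = (\<lambda>n. enumerate B (r n)) ` {n0..}"
  have "inj_on (\<lambda>n. enumerate B (r n)) {n0..}"
    using inj_eq[OF strict_mono_imp_inj_on[OF strict_mono_enumerate[OF B(1)]]]
      inj_eq[OF strict_mono_imp_inj_on[OF r(1)]] by (auto simp: inj_on_def)
  then have "infinite B'" unfolding B'_def using finite_imageD infinite_Ici by blast
  moreover have "B' \<subseteq> B" using enumerate_in_set[OF B(1)] by (auto simp: B'_def)
  moreover have "norm (x i m - x i n) \<le> \<epsilon>" if "m \<in> B'" "n \<in> B'" for m n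
  proof -
    have "dist (x i m) l < \<epsilon> / 2" "dist (x i n) l < \<epsilon> / 2" using that n0 by (auto simp: B'_def)
    then have "dist (x i m) (x i n) < \<epsilon>" by (rule dist_triangle_half_l)
    then show ?thesis by (simp add: dist_norm)
  qed
  ultimately show ?case using B by (intro exI[of _ B']) (auto, meson subsetD)
qed

section \<open>Double sequences and changes of coordinates\<close>

definition unit_at :: "nat \<Rightarrow> nat \<Rightarrow> nat \<Rightarrow> nat \<Rightarrow> 'f::zero_neq_one" where
  "unit_at k j = (\<lambda>k' j'. if k' = k \<and> j' = j then 1 else 0)"

definition supported :: "(nat \<Rightarrow> nat set) \<Rightarrow> (nat \<Rightarrow> nat \<Rightarrow> 'f::zero) \<Rightarrow> bool" where
  "supported B f \<longleftrightarrow> (\<forall>k j. j \<notin> B k \<longrightarrow> f k j = 0)"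

text \<open>A fixed element of the sum space with positive entries, used to turn entrywise error
  bounds into a norm bound.\<close>

definition geometric :: "nat \<Rightarrow> nat \<Rightarrow> 'f::real_normed_field" where
  "geometric k j = of_real ((1/2) ^ k * (1/2) ^ j)"

text \<open>Moves the entry at \<open>(k, j)\<close> to \<open>(\<kappa> k, \<tau> k j)\<close> and
  fills up with zeros. For injective maps it is a right inverse of the restriction of double
  sequences to these places; \<open>inv\<close> is evaluated only on the ranges.\<close>

definition spread :: "(nat \<Rightarrow> nat) \<Rightarrow> (nat \<Rightarrow> nat \<Rightarrow> nat) \<Rightarrow> (nat \<Rightarrow> nat \<Rightarrow> 'f::zero) \<Rightarrow> nat \<Rightarrow> nat \<Rightarrow> 'f" where
  "spread \<kappa> \<tau> f = (\<lambda>k m. if k \<in> range \<kappa> \<and> m \<in> range (\<tau> (inv \<kappa> k))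
     then f (inv \<kappa> k) (inv (\<tau> (inv \<kappa> k)) m) else 0)"

lemma spread_at:
  assumes "inj \<kappa>" "\<And>k. inj (\<tau> k)"
  shows "spread \<kappa> \<tau> f (\<kappa> k) (\<tau> k j) = f k j"
  by (simp add: spread_def assms)

lemma spread_eq_0:
  assumes "inj \<kappa>" "\<And>k. inj (\<tau> k)" "\<And>k' j. k = \<kappa> k' \<Longrightarrow> m = \<tau> k' j \<Longrightarrow> f k' j = 0"
  shows "spread \<kappa> \<tau> f k m = 0"
  using assms(3) by (auto simp: spread_def assms(1,2))

lemma spread_unit_at:
  assumes "inj \<kappa>" "\<And>k. inj (\<tau> k)"
  shows "spread \<kappa> \<tau> (unit_at k j) = unit_at (\<kappa> k) (\<tau> k j)"
proof (intro ext)
  fix k' m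
  show "spread \<kappa> \<tau> (unit_at k j) k' m = (unit_at (\<kappa> k) (\<tau> k j) k' m :: 'a)"
  proof (cases "k' = \<kappa> k \<and> m = \<tau> k j")
    case True then show ?thesis by (simp add: spread_at assms unit_at_def)
  next
    case False then show ?thesis by (subst spread_eq_0[OF assms]) (auto simp: unit_at_def)
  qed
qed

section \<open>The space \<open>L\<close>: solidity, special elements and coordinate
  operators\<close>

locale marcinkiewicz_sum = marcinkiewicz_weight +
  fixes p :: ereal
  assumes p: "1 \<le> p"
begin

abbreviation L :: "('f::{real_normed_field, euclidean_space}, nat \<Rightarrow> nat \<Rightarrow> 'f) nspace" where
  "L \<equiv> lp_sum p M"

lemmas normed_space_L = normed_space_lp_sum[OF p normed_space_M]
lemmas banach_space_L = banach_space_lp_sum[OF p banach_space_M]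

lemma scl_L: "scl L c f = (\<lambda>k j. c * f k j)"
  by (simp add: lp_sum_simps marcinkiewicz_simps)

lemma L_component:
  assumes f: "f \<in> car L"
  shows "norm (f k j) \<le> s 1 * nrm L f"
proof -
  have "norm (f k j) \<le> s 1 * nrm M (f k)" using M_component lp_sum_component(1)[OF p normed_space_M f] by blast
  also have "\<dots> \<le> s 1 * nrm L f"
    using lp_sum_component(2)[OF p normed_space_M f] s_pos[of 1] by (intro mult_left_mono) auto
  finally show ?thesis .
qed

text \<open>Injectivity on the nonzero rows and entries is enough to apply the corresponding facts
  for \<open>M\<close> and for the sequence of row norms. Restricting, spreading and multiplying
  coordinates all come from this.\<close>

lemma L_dominated:
  assumes f: "f \<in> car L" and \<kappa>: "inj_on \<kappa> {k. g k \<noteq> 0}"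
    and h: "\<And>k. inj_on (h k) {j. g k j \<noteq> 0}"
    and le: "\<And>k j. g k j \<noteq> 0 \<Longrightarrow> norm (g k j) \<le> norm (f (\<kappa> k) (h k j))"
  shows "g \<in> car L \<and> nrm L g \<le> nrm L f"
proof -
  have row: "g k \<in> car M \<and> nrm M (g k) \<le> nrm M (f (\<kappa> k))" for k
    by (rule M_dominated[OF _ h le]) (use f in \<open>auto simp: lp_sum_simps\<close>)
  have "in_lp p (\<lambda>k. nrm M (g k)) \<and> lp_norm p (\<lambda>k. nrm M (g k)) \<le> lp_norm p (\<lambda>k. nrm M (f k))"
  proof (rule lp_dominated[OF p])
    show "in_lp p (\<lambda>k. nrm M (f k))" using f by (simp add: lp_sum_simps)
    show "inj_on \<kappa> {k. nrm M (g k) \<noteq> 0}"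
      by (rule inj_on_subset[OF \<kappa>]) (auto simp: nspace_nrm_zero[OF normed_space_M])
    show "\<bar>nrm M (g k)\<bar> \<le> \<bar>nrm M (f (\<kappa> k))\<bar>" for k using row[of k] M_nonneg[of "g k"] by simp
  qed
  then show ?thesis using row by (simp add: lp_sum_simps)
qed

lemma L_solid:
  assumes "f \<in> car L" "\<And>k j. norm (g k j) \<le> norm (f k j)"
  shows "g \<in> car L \<and> nrm L g \<le> nrm L f"
  by (rule L_dominated[where \<kappa> = id and h = "\<lambda>_. id"]) (use assms in auto)

lemma geometric_L: "(geometric :: nat \<Rightarrow> nat \<Rightarrow> 'f::{real_normed_field, euclidean_space}) \<in> car L"
proof -
  define h :: "nat \<Rightarrow> 'f" where "h j = of_real ((1/2) ^ j)" for j
  \<comment> \<open>All entries of \<open>h\<close> together sum to 2, and \<open>s 1\<close> is the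
    least value of \<open>s\<close>.\<close>
  have "h \<in> car M \<and> nrm M h \<le> 2 / s 1"
    unfolding M_le_iff
  proof (intro allI impI)
    fix A :: "nat set" assume A: "finite A" "A \<noteq> {}"
    have "(\<Sum>j\<in>A. norm (h j)) \<le> (\<Sum>j. (1/2) ^ j)"
      using A by (simp add: h_def norm_power) (intro sum_le_suminf, auto)
    also have "\<dots> = 2" by (subst suminf_geometric) auto
    also have "\<dots> \<le> 2 / s 1 * s (card A)"
      using s_mono[of 1 "card A"] s_pos[of 1] A by (simp add: field_simps Suc_le_eq card_gt_0_iff)
    finally show "(\<Sum>j\<in>A. norm (h j)) \<le> 2 / s 1 * s (card A)" .
  qed
  then have h: "h \<in> car M" by blast
  have row: "(geometric :: nat \<Rightarrow> nat \<Rightarrow> 'f) k = scl M (of_real ((1/2) ^ k)) h" for k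
    by (simp add: geometric_def h_def marcinkiewicz_simps fun_eq_iff)
  have "in_lp p (\<lambda>k. nrm M h * (1/2) ^ k)" using lp_scale_le[OF p in_lp_geometric[OF p]] by blast
  moreover have "nrm M ((geometric :: nat \<Rightarrow> nat \<Rightarrow> 'f) k) = nrm M h * (1/2) ^ k" for k
    unfolding row nspace_nscl[OF normed_space_M h] by (simp add: norm_power norm_divide)
  moreover have "(geometric :: nat \<Rightarrow> nat \<Rightarrow> 'f) k \<in> car M" for k
    unfolding row by (rule nspace_scl[OF normed_space_M h])
  ultimately show ?thesis by (simp add: lp_sum_simps)
qed

text \<open>The bound is uniform in \<open>k\<close> and \<open>j\<close>: any unit vector is
  dominated by the entry of \<open>geometric\<close> at \<open>(0, 0)\<close>, which is 1.\<close>

lemma unit_at_L: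
  "(unit_at k j :: nat \<Rightarrow> nat \<Rightarrow> 'f::{real_normed_field, euclidean_space}) \<in> car L \<and>
   nrm L (unit_at k j :: nat \<Rightarrow> nat \<Rightarrow> 'f) \<le> nrm L (geometric :: nat \<Rightarrow> nat \<Rightarrow> 'f)"
  by (rule L_dominated[OF geometric_L, where \<kappa> = "\<lambda>_. 0" and h = "\<lambda>_ _. 0"])
    (auto simp: unit_at_def geometric_def inj_on_def fun_eq_iff split: if_splits)

lemma bop_restrict:
  assumes "inj \<kappa>" "\<And>k. inj (\<tau> k)"
  shows "bounded_operator L L (\<lambda>f k j. f (\<kappa> k) (\<tau> k j))"
proof (rule bounded_operatorI[where K = 1])
  fix f :: "nat \<Rightarrow> nat \<Rightarrow> 'a" assume f: "f \<in> car L"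
  have "(\<lambda>k j. f (\<kappa> k) (\<tau> k j)) \<in> car L \<and> nrm L (\<lambda>k j. f (\<kappa> k) (\<tau> k j)) \<le> nrm L f"
  proof (rule L_dominated[OF f, where \<kappa> = \<kappa> and h = \<tau>])
    show "inj_on \<kappa> {k. (\<lambda>j. f (\<kappa> k) (\<tau> k j)) \<noteq> 0}" by (rule inj_on_subset[OF assms(1)]) simp
    show "inj_on (\<tau> k) {j. f (\<kappa> k) (\<tau> k j) \<noteq> 0}" for k by (rule inj_on_subset[OF assms(2)]) simp
  qed simp
  then show "(\<lambda>k j. f (\<kappa> k) (\<tau> k j)) \<in> car L" "nrm L (\<lambda>k j. f (\<kappa> k) (\<tau> k j)) \<le> 1 * nrm L f"
    by simp_all
qed (auto simp: scl_L fun_eq_iff)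

lemma spread_L:
  assumes inj: "inj \<kappa>" "\<And>k. inj (\<tau> k)" and f: "f \<in> car L"
  shows "spread \<kappa> \<tau> f \<in> car L \<and> nrm L (spread \<kappa> \<tau> f) \<le> nrm L f"
proof (rule L_dominated[OF f, where \<kappa> = "inv \<kappa>" and h = "\<lambda>k. inv (\<tau> (inv \<kappa> k))"])
  show "inj_on (inv \<kappa>) {k. spread \<kappa> \<tau> f k \<noteq> 0}"
    by (rule inj_on_subset[OF inj_on_inv_into[OF order_refl]]) (auto simp: spread_def fun_eq_iff split: if_splits)
  show "inj_on (inv (\<tau> (inv \<kappa> k))) {m. spread \<kappa> \<tau> f k m \<noteq> 0}" for k
    by (rule inj_on_subset[OF inj_on_inv_into[OF order_refl]]) (auto simp: spread_def split: if_splits)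
qed (simp add: spread_def)

lemma bop_spread:
  assumes inj: "inj \<kappa>" "\<And>k. inj (\<tau> k)"
  shows "bounded_operator L L (spread \<kappa> \<tau>)"
proof (rule bounded_operatorI[where K = 1])
  fix f :: "nat \<Rightarrow> nat \<Rightarrow> 'a" assume f: "f \<in> car L"
  show "spread \<kappa> \<tau> f \<in> car L" "nrm L (spread \<kappa> \<tau> f) \<le> 1 * nrm L f"
    using spread_L[where \<kappa> = \<kappa> and \<tau> = \<tau>, OF inj f] by simp_all
qed (simp_all add: scl_L fun_eq_iff spread_def)

lemma bop_multiplier:
  assumes "\<And>k j. norm (c k j) \<le> C"
  shows "bounded_operator L L (\<lambda>f k j. c k j * f k j)"
proof (rule bounded_operatorI[where K = "\<bar>C\<bar>"])
  fix f :: "nat \<Rightarrow> nat \<Rightarrow> 'a" assume f: "f \<in> car L"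
  have "(\<lambda>k j. c k j * f k j) \<in> car L \<and> nrm L (\<lambda>k j. c k j * f k j) \<le> nrm L (scl L (of_real C) f)"
    by (intro L_solid nspace_scl[OF normed_space_L f])
      (simp add: scl_L norm_mult mult_right_mono order_trans[OF assms abs_ge_self])
  then show "(\<lambda>k j. c k j * f k j) \<in> car L" "nrm L (\<lambda>k j. c k j * f k j) \<le> \<bar>C\<bar> * nrm L f"
    using nspace_nscl[OF normed_space_L f, of "of_real C"] by auto
qed (auto simp: scl_L fun_eq_iff algebra_simps)

lemma bop_coordinate: "bounded_operator L scalars (\<lambda>f. f k j)"
  by (rule bounded_operatorI[where K = "s 1"]) (auto simp: scl_L L_component[unfolded One_nat_def])

text \<open>Otherwise \<open>N\<close> disjoint pieces would carry normalised elements on each of which the functional is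
  larger than \<open>\<epsilon>\<close>, whereas the norm of their sum is small compared with \<open>N\<close>.\<close>

lemma functional_small_on_rows:
  assumes \<phi>: "bounded_operator L scalars (\<phi> :: (nat \<Rightarrow> nat \<Rightarrow> 'f::{real_normed_field, euclidean_space}) \<Rightarrow> 'f)"
    and Q: "in_lp p (indicator Q)" "lp_norm p (indicator Q) \<le> 1"
    and A: "\<And>k. infinite (A k)" and e: "0 < \<epsilon>"
  shows "\<exists>B. (\<forall>k. infinite (B k) \<and> B k \<subseteq> A k) \<and>
    (\<forall>f\<in>car L. supported B f \<longrightarrow> (\<forall>k. k \<notin> Q \<longrightarrow> f k = 0) \<longrightarrow> norm (\<phi> f) \<le> \<epsilon> * nrm L f)"
proof -
  have ns: "normed_space (L :: ('f, _) nspace)" by (rule normed_space_L)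
  obtain K where K: "K > 0" "\<And>f. f \<in> car L \<Longrightarrow> norm (\<phi> f) \<le> K * nrm L f" using bop_bound[OF ns \<phi>] by auto
  \<comment> \<open>With this choice the upper bound \<open>K * (\<delta> * N)\<close> for the
    functional at the sum equals the strict lower bound \<open>N * \<epsilon>\<close>, a
    contradiction.\<close>
  define \<delta> where "\<delta> = \<epsilon> / K"
  have \<delta>: "0 < \<delta>" using e K by (simp add: \<delta>_def)
  obtain N where N: "1 \<le> N" "\<forall>g :: nat \<Rightarrow> nat \<Rightarrow> 'f.
      (\<forall>i<N. g i \<in> car M \<and> nrm M (g i) \<le> 1) \<longrightarrow>
      (\<forall>i<N. \<forall>i'<N. i \<noteq> i' \<longrightarrow> (\<forall>j. g i j = 0 \<or> g i' j = 0)) \<longrightarrow>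
      nrm M (\<Sum>i<N. g i) \<le> \<delta> * real N"
    using disjoint_sum_small[OF \<delta>] by blast
  have "\<exists>B. (\<forall>i. infinite (B i)) \<and> (\<forall>i. B i \<subseteq> A k) \<and> (\<forall>i i'. i < N \<longrightarrow> i' < N \<longrightarrow> i \<noteq> i' \<longrightarrow> B i \<inter> B i' = {})" for k
    using split_infinite[OF A N(1), of k] by metis
  then obtain B where B: "\<And>k i. infinite (B k i)" "\<And>k i. B k i \<subseteq> A k"
    "\<And>k i i'. i < N \<Longrightarrow> i' < N \<Longrightarrow> i \<noteq> i' \<Longrightarrow> B k i \<inter> B k i' = {}" by metis
  \<comment> \<open>Every row has been split into \<open>N\<close> classes, and one class number
    serves all rows simultaneously.\<close>
  have "\<exists>i<N. \<forall>f\<in>car L. supported (\<lambda>k. B k i) f \<longrightarrow> (\<forall>k. k \<notin> Q \<longrightarrow> f k = 0) \<longrightarrow> norm (\<phi> f) \<le> \<epsilon> * nrm L f"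
  proof (rule ccontr)
    assume "\<not> ?thesis"
    then obtain f where f: "\<And>i. i < N \<Longrightarrow> f i \<in> car L" "\<And>i. i < N \<Longrightarrow> supported (\<lambda>k. B k i) (f i)"
      "\<And>i k. i < N \<Longrightarrow> k \<notin> Q \<Longrightarrow> f i k = 0" "\<And>i. i < N \<Longrightarrow> \<epsilon> * nrm L (f i) < norm (\<phi> (f i))"
      unfolding not_less not_le by (metis not_le)
    have pos: "0 < nrm L (f i)" if i: "i < N" for i
    proof -
      have "f i \<noteq> 0"
      proof
        assume "f i = 0"
        then show False using f(4)[OF i] bop_zero[OF ns \<phi>] nspace_nrm_zero[OF ns] by simp
      qed
      then show ?thesis using nspace_eq0[OF ns f(1)[OF i]] nspace_nonneg[OF ns f(1)[OF i]] by simp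
    qed
    have ne: "\<phi> (f i) \<noteq> 0" if i: "i < N" for i
      using f(4)[OF i] mult_pos_pos[OF e pos[OF i]] by auto
    \<comment> \<open>The scalar normalises \<open>f i\<close> and also rotates it so that the
      functional becomes a positive real number; thus nothing cancels in the sum.\<close>
    define c :: "nat \<Rightarrow> 'f" where "c i = of_real (norm (\<phi> (f i)) / nrm L (f i)) / \<phi> (f i)" for i
    define g where "g i = scl L (c i) (f i)" for i
    have g: "g i \<in> car L" if "i < N" for i unfolding g_def by (rule nspace_scl[OF ns f(1)[OF that]])
    have nc: "norm (c i) = 1 / nrm L (f i)" if "i < N" for i
      using ne[OF that] pos[OF that] by (simp add: c_def norm_divide norm_mult del: of_real_divide)
    have ng: "nrm L (g i) = 1" if i: "i < N" for i
      unfolding g_def nspace_nscl[OF ns f(1)[OF i]] nc[OF i] using pos[OF i] by simp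
    have \<phi>g: "\<phi> (g i) = of_real (norm (\<phi> (f i)) / nrm L (f i))" if i: "i < N" for i
      unfolding g_def bop_scl[OF \<phi> f(1)[OF i]] using ne[OF i] by (simp add: c_def)
    have g0: "f i k j = 0 \<Longrightarrow> g i k j = 0" for i k j by (simp add: g_def scl_L)
    have disj: "g i k j = 0 \<or> g i' k j = 0" if i: "i < N" "i' < N" "i \<noteq> i'" for i i' k j
      using B(3)[OF i, of k] f(2)[OF i(1)] f(2)[OF i(2)] g0 unfolding supported_def by blast
    have sumL: "(\<Sum>i<N. g i) \<in> car L" by (rule nspace_sum[OF ns]) (use g in auto)
    \<comment> \<open>The estimate for disjoint sums applies within one row only. Passing to the
      norm of \<open>L\<close> costs the norm of the indicator of \<open>Q\<close>, which is at most
      1.\<close>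
    have row: "nrm M ((\<Sum>i<N. g i) k) \<le> \<delta> * real N * indicator Q k" for k
    proof (cases "k \<in> Q")
      case True
      have "nrm M (\<Sum>i<N. g i k) \<le> \<delta> * real N"
        using lp_sum_component[OF p normed_space_M g, of _ k] ng disj by (intro N(2)[rule_format]) auto
      then show ?thesis using True by (simp add: sum_apply)
    next
      case False
      have "g i k = 0" if "i < N" for i using f(3)[OF that False] g0 by (auto simp: fun_eq_iff)
      then have "(\<Sum>i<N. g i) k = 0" by (simp add: sum_apply)
      then show ?thesis using False by (simp add: nspace_nrm_zero[OF normed_space_M])
    qed
    have d0: "0 \<le> \<delta> * real N" using \<delta> by simp
    have Qs: "in_lp p (\<lambda>k. \<delta> * real N * indicator Q k)"
      "lp_norm p (\<lambda>k. \<delta> * real N * indicator Q k) \<le> \<delta> * real N"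
      using lp_scale_le[OF p Q(1), of "\<delta> * real N"] mult_left_mono[OF Q(2) d0]
      unfolding abs_of_nonneg[OF d0] mult_1_right by (blast, linarith)
    have "nrm L (\<Sum>i<N. g i) \<le> lp_norm p (\<lambda>k. \<delta> * real N * indicator Q k)"
      using lp_sum_bounded_by[OF p normed_space_M Qs(1) _ row] lp_sum_component(1)[OF p normed_space_M sumL] by blast
    then have "nrm L (\<Sum>i<N. g i) \<le> \<delta> * real N" using Qs(2) by linarith
    then have "norm (\<phi> (\<Sum>i<N. g i)) \<le> K * (\<delta> * real N)"
      using K(2)[OF sumL] K(1) mult_left_mono[of "nrm L (\<Sum>i<N. g i)" "\<delta> * real N" K] by linarith
    moreover have "norm (\<phi> (\<Sum>i<N. g i)) > real N * \<epsilon>"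
    proof -
      have "\<phi> (\<Sum>i<N. g i) = (\<Sum>i<N. \<phi> (g i))" by (rule bop_sum[OF ns \<phi>]) (use g in auto)
      also have "\<dots> = of_real (\<Sum>i<N. norm (\<phi> (f i)) / nrm L (f i))" using \<phi>g by (simp del: of_real_divide)
      finally have "norm (\<phi> (\<Sum>i<N. g i)) = \<bar>\<Sum>i<N. norm (\<phi> (f i)) / nrm L (f i)\<bar>" by (simp only: norm_of_real)
      moreover have "(\<Sum>i<N. \<epsilon>) < (\<Sum>i<N. norm (\<phi> (f i)) / nrm L (f i))"
        using f(4) pos N(1) by (intro sum_strict_mono) (auto simp: less_divide_eq lessThan_empty_iff)
      ultimately show ?thesis by simp
    qed
    ultimately show False using K(1) by (simp add: \<delta>_def mult.commute)
  qed
  then obtain i where i: "\<forall>f\<in>car L. supported (\<lambda>k. B k i) f \<longrightarrow> (\<forall>k. k \<notin> Q \<longrightarrow> f k = 0) \<longrightarrow> norm (\<phi> f) \<le> \<epsilon> * nrm L f"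
    by blast
  show ?thesis by (rule exI[of _ "\<lambda>k. B k i"], intro conjI allI B(1,2)) (rule i)
qed

text \<open>For \<open>p = \<infinity>\<close> all rows are treated at once; for \<open>p < \<infinity>\<close> the elements with finitely many nonzero
  rows are dense, and the rows are treated one by one.\<close>

lemma functional_small:
  assumes \<phi>: "bounded_operator L scalars (\<phi> :: (nat \<Rightarrow> nat \<Rightarrow> 'f::{real_normed_field, euclidean_space}) \<Rightarrow> 'f)"
    and A: "\<And>k. infinite (A k)" and e: "0 < \<epsilon>"
  shows "\<exists>B. (\<forall>k. infinite (B k) \<and> B k \<subseteq> A k) \<and>
    (\<forall>f\<in>car L. supported B f \<longrightarrow> norm (\<phi> f) \<le> \<epsilon> * nrm L f)"
  using p
proof (cases p rule: ereal_ge_1_cases)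
  case 1
  have "in_lp p (indicator UNIV) \<and> lp_norm p (indicator UNIV) \<le> 1"
    unfolding 1 lp_infinity_iff by simp
  then have Q: "in_lp p (indicator UNIV)" "lp_norm p (indicator UNIV) \<le> 1" by blast+
  show ?thesis using functional_small_on_rows[OF \<phi> Q, of A \<epsilon>] A e by simp
next
  case (2 q)
  have ns: "normed_space (L :: ('f, _) nspace)" by (rule normed_space_L)
  obtain K where K: "K > 0" "\<And>f. f \<in> car L \<Longrightarrow> norm (\<phi> f) \<le> K * nrm L f" using bop_bound[OF ns \<phi>] by auto
  \<comment> \<open>The tolerances \<open>\<epsilon> * (1/2) ^ Suc k\<close> of the single rows add
    up to at most \<open>\<epsilon>\<close>.\<close>
  have "\<exists>B. (\<forall>i. infinite (B i) \<and> B i \<subseteq> A i) \<and> (\<forall>f\<in>car L. supported B f \<longrightarrow>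
      (\<forall>i. i \<notin> {k} \<longrightarrow> f i = 0) \<longrightarrow> norm (\<phi> f) \<le> \<epsilon> * (1/2) ^ Suc k * nrm L f)" for k
  proof -
    have "(indicator {k} :: nat \<Rightarrow> real) = (\<lambda>n. if n = k then 1 else 0)" by (auto simp: indicator_def)
    then have Q: "in_lp p (indicator {k})" "lp_norm p (indicator {k}) \<le> 1" using lp_single[OF p, of k 1] by auto
    show ?thesis by (rule functional_small_on_rows[OF \<phi> Q]) (use A e in auto)
  qed
  then have "\<exists>B. \<forall>k. (\<forall>i. infinite (B k i) \<and> B k i \<subseteq> A i) \<and> (\<forall>f\<in>car L. supported (B k) f \<longrightarrow>
      (\<forall>i. i \<notin> {k} \<longrightarrow> f i = 0) \<longrightarrow> norm (\<phi> f) \<le> \<epsilon> * (1/2) ^ Suc k * nrm L f)"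
    by (intro choice allI)
  then obtain B where B: "\<forall>k. (\<forall>i. infinite (B k i) \<and> B k i \<subseteq> A i) \<and> (\<forall>f\<in>car L. supported (B k) f \<longrightarrow>
      (\<forall>i. i \<notin> {k} \<longrightarrow> f i = 0) \<longrightarrow> norm (\<phi> f) \<le> \<epsilon> * (1/2) ^ Suc k * nrm L f)" ..
  \<comment> \<open>Of the sets obtained for row \<open>k\<close> only the one in row
    \<open>k\<close> itself is kept: an element living in that row alone and supported there is
    supported in \<open>B k\<close>.\<close>
  have "norm (\<phi> f) \<le> \<epsilon> * nrm L f" if f: "f \<in> car L" and sup: "supported (\<lambda>k. B k k) f" for f
  proof -
    define row where "row k = (\<lambda>i. if i = k then f i else 0)" for k
    define tail where "tail n = (\<lambda>i. if i < n then 0 else f i)" for n :: nat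
    have row: "row k \<in> car L \<and> nrm L (row k) \<le> nrm L f" for k by (rule L_solid[OF f]) (simp add: row_def)
    have tail: "tail n \<in> car L" for n using L_solid[OF f, of "tail n"] by (simp add: tail_def)
    have "norm (\<phi> f) \<le> \<epsilon> * nrm L f + K * nrm L (tail n)" for n
    proof -
      have "f = (\<Sum>k<n. row k) + tail n"
        by (auto simp: fun_eq_iff sum_apply row_def tail_def sum.delta if_distribR cong: if_cong)
      then have "\<phi> f = (\<Sum>k<n. \<phi> (row k)) + \<phi> (tail n)"
        using bop_add[OF \<phi> nspace_sum[OF ns, of "{..<n}" row] tail, of n] row bop_sum[OF ns \<phi>, of "{..<n}" row] by auto
      then have "norm (\<phi> f) \<le> (\<Sum>k<n. norm (\<phi> (row k))) + norm (\<phi> (tail n))"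
        by (simp add: norm_triangle_le norm_sum)
      also have "(\<Sum>k<n. norm (\<phi> (row k))) \<le> (\<Sum>k<n. \<epsilon> * nrm L f * (1/2) ^ Suc k)"
      proof (intro sum_mono)
        fix k
        have "norm (\<phi> (row k)) \<le> \<epsilon> * (1/2) ^ Suc k * nrm L (row k)"
          using sup row by (intro B[rule_format, THEN conjunct2, rule_format]) (auto simp: supported_def row_def)
        also have "\<dots> \<le> \<epsilon> * (1/2) ^ Suc k * nrm L f" using row e by (intro mult_left_mono) auto
        finally show "norm (\<phi> (row k)) \<le> \<epsilon> * nrm L f * (1/2) ^ Suc k" by (simp add: mult_ac)
      qed
      also have "\<dots> = \<epsilon> * nrm L f * (\<Sum>k<n. (1/2) ^ Suc k)" by (simp only: sum_distrib_left)
      also have "\<dots> \<le> \<epsilon> * nrm L f * 1"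
      proof (intro mult_left_mono)
        have "(\<Sum>k<n. (1/2 :: real) ^ Suc k) = 1 - (1/2) ^ n" by (induction n) auto
        then show "(\<Sum>k<n. (1/2 :: real) ^ Suc k) \<le> 1" by simp
        show "0 \<le> \<epsilon> * nrm L f" using e nspace_nonneg[OF ns f] by simp
      qed
      finally show ?thesis using K(2)[OF tail, of n] by simp
    qed
    moreover have "(\<lambda>n. \<epsilon> * nrm L f + K * nrm L (tail n)) \<longlonglongrightarrow> \<epsilon> * nrm L f + K * 0"
    proof (intro tendsto_intros)
      have "nrm L (tail n) = lp_norm (ereal q) (\<lambda>i. if i < n then 0 else nrm M (f i))" for n
        by (simp add: lp_sum_simps tail_def 2 if_distrib nspace_nrm_zero[OF normed_space_M] cong: if_cong)
      then show "(\<lambda>n. nrm L (tail n)) \<longlonglongrightarrow> 0"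
        using lp_tail_tendsto[OF 2(2), of "\<lambda>i. nrm M (f i)"] f by (simp add: lp_sum_simps 2)
    qed
    ultimately show "norm (\<phi> f) \<le> \<epsilon> * nrm L f" by (intro LIMSEQ_le_const) auto
  qed
  then show ?thesis
    by (intro exI[of _ "\<lambda>k. B k k"] conjI allI ballI impI B[rule_format, THEN conjunct1, rule_format, THEN conjunct1]
      B[rule_format, THEN conjunct1, rule_format, THEN conjunct2])
qed

end

section \<open>Compressions close to diagonal operators\<close>

context marcinkiewicz_sum
begin

text \<open>One step of the inductive choice. \<open>F\<close> holds the places chosen earlier,
  \<open>A\<close> the coordinates still available. The order matters: first a set in row
  \<open>k0\<close> on which the images of the earlier unit vectors hardly oscillate, then
  \<open>n'\<close> in it, then a restriction making coordinate \<open>n'\<close> of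
  \<open>T\<close> small, and only then \<open>n\<close>.\<close>

lemma choose_coordinates:
  fixes T :: "(nat \<Rightarrow> nat \<Rightarrow> 'f::{real_normed_field, euclidean_space}) \<Rightarrow> nat \<Rightarrow> nat \<Rightarrow> 'f"
  assumes T: "bounded_operator L L T" and A: "\<And>k. infinite (A k)" and F: "finite F" and e: "0 < \<epsilon>"
  shows "\<exists>n n' B. n \<in> A k0 \<and> n' \<in> A k0 \<and> (\<forall>k. infinite (B k) \<and> B k \<subseteq> A k - {n, n'}) \<and>
    (\<forall>x\<in>F. norm (T (unit_at (fst x) (snd x)) k0 n - T (unit_at (fst x) (snd x)) k0 n') \<le> \<epsilon>) \<and>
    norm (T (unit_at k0 n) k0 n') \<le> \<epsilon> \<and>
    (\<forall>f\<in>car L. supported B f \<longrightarrow> norm (T f k0 n - T f k0 n') \<le> \<epsilon> * nrm L f)"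
proof -
  have ns: "normed_space (L :: ('f, _) nspace)" by (rule normed_space_L)
  have \<phi>: "bounded_operator L scalars (\<lambda>f. T f k0 n)" for n by (rule bop_compose[OF ns ns T bop_coordinate])
  define D where "D = nrm L (geometric :: nat \<Rightarrow> nat \<Rightarrow> 'f)"
  have D: "0 \<le> D" unfolding D_def by (rule nspace_nonneg[OF ns geometric_L])
  have unit: "unit_at k j \<in> car L" "nrm L (unit_at k j :: nat \<Rightarrow> nat \<Rightarrow> 'f) \<le> D" for k j
    using unit_at_L[of k j] by (auto simp: D_def)
  have bd: "bounded (range (\<lambda>n. T (unit_at (fst x) (snd x)) k0 n))" for x :: "nat \<times> nat"
    using L_component[OF bop_car[OF T unit(1)]] by (intro boundedI) blast
  have "\<exists>B. infinite B \<and> B \<subseteq> A k0 \<and> (\<forall>x\<in>F. \<forall>m\<in>B. \<forall>n\<in>B.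
      norm (T (unit_at (fst x) (snd x)) k0 m - T (unit_at (fst x) (snd x)) k0 n) \<le> \<epsilon>)"
    by (rule small_oscillation[OF F A bd e])
  then obtain A0 where A0: "infinite A0" "A0 \<subseteq> A k0" "\<forall>x\<in>F. \<forall>m\<in>A0. \<forall>n\<in>A0.
      norm (T (unit_at (fst x) (snd x)) k0 m - T (unit_at (fst x) (snd x)) k0 n) \<le> \<epsilon>" by blast
  define A1 where "A1 = A(k0 := A0)"
  have A1: "infinite (A1 k)" "A1 k \<subseteq> A k" for k using A A0 by (auto simp: A1_def)
  obtain n' where n': "n' \<in> A0" using A0(1) by (metis ex_in_conv finite.emptyI)
  \<comment> \<open>Chosen to give both \<open>\<delta> * D \<le> \<epsilon>\<close>, for the image
    of a unit vector, and \<open>\<delta> + \<delta> \<le> \<epsilon>\<close>, for the difference of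
    two functionals.\<close>
  define \<delta> where "\<delta> = \<epsilon> / (D + 2)"
  have \<delta>0: "0 < \<delta>" using e D by (simp add: \<delta>_def)
  have "\<delta> * (D + 2) = \<epsilon>" using D by (simp add: \<delta>_def)
  then have "\<delta> * D + (\<delta> + \<delta>) = \<epsilon>" by (simp add: algebra_simps)
  moreover have "0 \<le> \<delta> * D" using \<delta>0 D by simp
  ultimately have \<delta>: "0 < \<delta>" "\<delta> * D \<le> \<epsilon>" "\<delta> + \<delta> \<le> \<epsilon>" using \<delta>0 by linarith+
  have "\<exists>B. (\<forall>k. infinite (B k) \<and> B k \<subseteq> A1 k) \<and>
    (\<forall>f\<in>car L. supported B f \<longrightarrow> norm (T f k0 n') \<le> \<delta> * nrm L f)"
    by (rule functional_small[OF \<phi> _ \<delta>(1)]) (rule A1)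
  then obtain B1 where B1: "\<forall>k. infinite (B1 k) \<and> B1 k \<subseteq> A1 k"
    and small1: "\<forall>f\<in>car L. supported B1 f \<longrightarrow> norm (T f k0 n') \<le> \<delta> * nrm L f" by blast
  \<comment> \<open>Taking \<open>n\<close> where coordinate \<open>n'\<close> of \<open>T\<close>
    is already small controls the entry of \<open>T (unit_at k0 n)\<close> at
    \<open>n'\<close>.\<close>
  obtain n where n: "n \<in> B1 k0" using B1 by (metis ex_in_conv finite.emptyI)
  have "\<exists>B. (\<forall>k. infinite (B k) \<and> B k \<subseteq> B1 k - {n, n'}) \<and>
    (\<forall>f\<in>car L. supported B f \<longrightarrow> norm (T f k0 n) \<le> \<delta> * nrm L f)"
    by (rule functional_small[OF \<phi> _ \<delta>(1)]) (use B1 in simp)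
  then obtain B where B: "\<forall>k. infinite (B k) \<and> B k \<subseteq> B1 k - {n, n'}"
    and small: "\<forall>f\<in>car L. supported B f \<longrightarrow> norm (T f k0 n) \<le> \<delta> * nrm L f" by blast
  have n0: "n \<in> A0" using n B1 by (auto simp: A1_def dest!: spec[of _ k0])
  have "norm (T (unit_at k0 n) k0 n') \<le> \<delta> * nrm L (unit_at k0 n :: nat \<Rightarrow> nat \<Rightarrow> 'f)"
    using n by (intro small1[rule_format] unit(1)) (auto simp: supported_def unit_at_def)
  also have "\<dots> \<le> \<delta> * D" using unit(2) \<delta>(1) by (intro mult_left_mono) auto
  finally have u: "norm (T (unit_at k0 n) k0 n') \<le> \<epsilon>" using \<delta>(2) by linarith
  have "norm (T f k0 n - T f k0 n') \<le> \<epsilon> * nrm L f" if f: "f \<in> car L" and sup: "supported B f" for f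
  proof -
    have "supported B1 f" unfolding supported_def
    proof (intro allI impI)
      fix k j assume "j \<notin> B1 k"
      then have "j \<notin> B k" using B by blast
      then show "f k j = 0" using sup by (simp add: supported_def)
    qed
    then have "norm (T f k0 n) + norm (T f k0 n') \<le> \<delta> * nrm L f + \<delta> * nrm L f"
      using small small1 f sup by (intro add_mono) auto
    also have "\<dots> = (\<delta> + \<delta>) * nrm L f" by (simp add: distrib_right)
    also have "\<dots> \<le> \<epsilon> * nrm L f" using \<delta>(3) nspace_nonneg[OF ns f] by (rule mult_right_mono)
    finally show ?thesis using norm_triangle_ineq4[of "T f k0 n" "T f k0 n'"] by linarith
  qed
  moreover have "B k \<subseteq> A k - {n, n'}" for k using B B1 A1 by blast
  ultimately show ?thesis
    using n0 n' A0 B u by (intro exI[of _ n] exI[of _ n'] exI[of _ B]) blast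
qed

text \<open>The functionals \<open>T f k n - T f k n'\<close> are differences of two coordinates in the same row: the
  entries of \<open>T (unit_at \<dots>)\<close> in this row need not tend to 0, but they cluster.\<close>

definition separating ::
    "((nat \<Rightarrow> nat \<Rightarrow> 'f::{real_normed_field, euclidean_space}) \<Rightarrow> nat \<Rightarrow> nat \<Rightarrow> 'f) \<Rightarrow> (nat \<Rightarrow> nat) \<Rightarrow>
     (nat \<Rightarrow> real) \<Rightarrow> (nat \<Rightarrow> nat) \<Rightarrow> (nat \<Rightarrow> nat) \<Rightarrow> (nat \<Rightarrow> nat \<Rightarrow> nat set) \<Rightarrow> bool" where
  "separating T \<rho> \<epsilon> n n' B \<longleftrightarrow> inj n \<and> inj n' \<and> (\<forall>q r. r < q \<longrightarrow> n q \<in> B r (\<rho> q)) \<and>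
    (\<forall>q r. q < r \<longrightarrow>
      norm (T (unit_at (\<rho> q) (n q)) (\<rho> r) (n r) - T (unit_at (\<rho> q) (n q)) (\<rho> r) (n' r)) \<le> \<epsilon> r) \<and>
    (\<forall>r. norm (T (unit_at (\<rho> r) (n r)) (\<rho> r) (n' r)) \<le> \<epsilon> r) \<and>
    (\<forall>r. \<forall>f\<in>car L. supported (B r) f \<longrightarrow>
      norm (T f (\<rho> r) (n r) - T f (\<rho> r) (n' r)) \<le> \<epsilon> r * nrm L f)"

text \<open>Iterates \<open>choose_coordinates\<close>. Stage \<open>r\<close> must know all places
  chosen before, so the recursion is over the whole history; its value is the triple of remaining
  sets, \<open>n\<close> and \<open>n'\<close>.\<close>

lemma separating_exists:
  fixes T :: "(nat \<Rightarrow> nat \<Rightarrow> 'f::{real_normed_field, euclidean_space}) \<Rightarrow> nat \<Rightarrow> nat \<Rightarrow> 'f"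
  assumes T: "bounded_operator L L T" and e: "\<And>r. 0 < \<epsilon> r"
  shows "\<exists>n n' B. separating T \<rho> \<epsilon> n n' B"
proof -
  \<comment> \<open>The sets left over by stage \<open>r - 1\<close>; stage 0 starts with all
    coordinates in all rows.\<close>
  define prev :: "(nat \<Rightarrow> (nat \<Rightarrow> nat set) \<times> nat \<times> nat) \<Rightarrow> nat \<Rightarrow> nat \<Rightarrow> nat set"
    where "prev f r = (if r = 0 then \<lambda>_. UNIV else fst (f (r - 1)))" for f r
  define Q where "Q f r B n n' \<longleftrightarrow> n \<in> prev f r (\<rho> r) \<and> n' \<in> prev f r (\<rho> r) \<and>
      (\<forall>k. infinite (B k) \<and> B k \<subseteq> prev f r k - {n, n'}) \<and>
      (\<forall>y\<in>(\<lambda>q. (\<rho> q, fst (snd (f q)))) ` {..<r}.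
        norm (T (unit_at (fst y) (snd y)) (\<rho> r) n - T (unit_at (fst y) (snd y)) (\<rho> r) n') \<le> \<epsilon> r) \<and>
      norm (T (unit_at (\<rho> r) n) (\<rho> r) n') \<le> \<epsilon> r \<and>
      (\<forall>f\<in>car L. supported B f \<longrightarrow> norm (T f (\<rho> r) n - T f (\<rho> r) n') \<le> \<epsilon> r * nrm L f)"
    for f r B n n'
  define P where "P f r x \<longleftrightarrow> Q f r (fst x) (fst (snd x)) (snd (snd x))" for f r x
  \<comment> \<open>Dependent choice requires that \<open>P f r\<close> look at \<open>f\<close>
    only below \<open>r\<close>; this holds for \<open>prev\<close> and for the set of earlier
    places.\<close>
  have "\<exists>f. \<forall>r. P f r (f r)"
  proof (rule dependent_wf_choice[OF wf_less_than])
    fix f g :: "nat \<Rightarrow> (nat \<Rightarrow> nat set) \<times> nat \<times> nat" and r x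
    assume eq: "\<And>z. (z, r) \<in> less_than \<Longrightarrow> f z = g z"
    have "prev f r = prev g r" using eq[of "r - 1"] by (simp add: prev_def)
    moreover have "(\<lambda>q. (\<rho> q, fst (snd (f q)))) ` {..<r} = (\<lambda>q. (\<rho> q, fst (snd (g q)))) ` {..<r}"
      using eq by (intro image_cong) auto
    ultimately show "P f r x = P g r x" by (simp only: P_def Q_def)
  next
    fix r and f :: "nat \<Rightarrow> (nat \<Rightarrow> nat set) \<times> nat \<times> nat"
    assume IH: "\<And>q. (q, r) \<in> less_than \<Longrightarrow> P f q (f q)"
    have inf: "infinite (prev f r k)" for k
    proof (cases "r = 0")
      case False
      then have "P f (r - 1) (f (r - 1))" by (intro IH) simp
      then show ?thesis using False by (simp add: P_def Q_def prev_def)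
    qed (simp add: prev_def)
    have "\<exists>n n' B. Q f r B n n'"
      unfolding Q_def by (rule choose_coordinates[OF T inf _ e]) simp
    then obtain n n' B where "Q f r B n n'" by blast
    then show "\<exists>x. P f r x" by (intro exI[of _ "(B, n, n')"]) (simp add: P_def)
  qed
  then obtain f where f: "\<And>r. P f r (f r)" by blast
  define B where "B r = fst (f r)" for r
  define n where "n r = fst (snd (f r))" for r
  define n' where "n' r = snd (snd (f r))" for r
  have Qr: "Q f r (B r) (n r) (n' r)" for r using f[of r] by (simp add: P_def B_def n_def n'_def)
  have fr: "n r \<in> prev f r (\<rho> r)" "n' r \<in> prev f r (\<rho> r)"
      "B r k \<subseteq> prev f r k - {n r, n' r}"
      "norm (T (unit_at (\<rho> r) (n r)) (\<rho> r) (n' r)) \<le> \<epsilon> r"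
      "\<forall>h\<in>car L. supported (B r) h \<longrightarrow> norm (T h (\<rho> r) (n r) - T h (\<rho> r) (n' r)) \<le> \<epsilon> r * nrm L h" for r k
    using Qr[of r] unfolding Q_def by simp_all
  have lower: "norm (T (unit_at (\<rho> q) (n q)) (\<rho> r) (n r) - T (unit_at (\<rho> q) (n q)) (\<rho> r) (n' r)) \<le> \<epsilon> r"
    if "q < r" for q r
    using Qr[of r] that unfolding Q_def n_def by simp
  have dec: "prev f q k \<subseteq> B r k" if "r < q" for q r k
    using that
  proof (induction q)
    case (Suc q)
    have "prev f (Suc q) k = B q k" by (simp add: prev_def B_def)
    then show ?case using Suc fr(3)[of q k] by (cases "r = q") (auto simp: less_Suc_eq)
  qed simp
  have later: "n q \<in> B r (\<rho> q)" "n' q \<in> B r (\<rho> q)" if "r < q" for r q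
    using dec[OF that] fr(1,2) by blast+
  have not: "n r \<notin> B r k" "n' r \<notin> B r k" for r k using fr(3) by blast+
  \<comment> \<open>Each stage removes its two coordinates from every row, not just from its own, so
    later stages cannot meet them again.\<close>
  have "inj n" "inj n'"
    using later not by (auto intro!: linorder_injI; metis)+
  then have "separating T \<rho> \<epsilon> n n' B"
    unfolding separating_def by (intro conjI allI impI later(1) lower fr(4,5))
  then show ?thesis by blast
qed

text \<open>The operator \<open>G = C \<circ> R \<circ> T \<circ> S\<close>, with \<open>C\<close>
  dividing by the diagonal entries, differs from the identity by at most half, hence has a left
  inverse. The last clause, that \<open>S\<close> creates no new rows, is kept for the passage to
  \<open>m(s)\<close>.\<close>

lemma factor_of_large_diagonal:
  fixes T :: "(nat \<Rightarrow> nat \<Rightarrow> 'f::{real_normed_field, euclidean_space}) \<Rightarrow> nat \<Rightarrow> nat \<Rightarrow> 'f"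
  assumes T: "bounded_operator L L T" and diag: "\<And>k j. 1/2 \<le> norm (T (unit_at k j) k j)"
  shows "\<exists>S U. bounded_operator L L S \<and> bounded_operator L L U \<and> (\<forall>f\<in>car L. U (T (S f)) = f) \<and>
    (\<forall>f\<in>car L. \<forall>k. f k = 0 \<longrightarrow> S f k = 0)"
proof -
  have ns: "normed_space (L :: ('f, _) nspace)" by (rule normed_space_L)
  define D where "D = nrm L (geometric :: nat \<Rightarrow> nat \<Rightarrow> 'f)"
  have D: "0 \<le> D" unfolding D_def by (rule nspace_nonneg[OF ns geometric_L])
  \<comment> \<open>The error of \<open>G\<close> will have norm at most
    \<open>2 * \<eta> * D * nrm L f\<close>, where 2 bounds the inverse diagonal entries.\<close>
  define \<eta> where "\<eta> = 1 / (4 * (D + 1))"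
  have \<eta>: "0 < \<eta>" "2 * \<eta> * D \<le> 1/2" using D by (auto simp: \<eta>_def field_simps)
  define row where "row r = fst (prod_decode r)" for r
  define col where "col r = snd (prod_decode r)" for r
  \<comment> \<open>Stage \<open>r\<close> handles the place \<open>prod_decode r\<close>. Its error
    consists of \<open>r\<close> terms from earlier unit vectors and one from coordinate
    \<open>n'\<close>, each with a factor \<open>s 1\<close> bounding entries by the norm, and one
    term from the remainder: \<open>\<epsilon> r * (Suc r * s 1 + 1)\<close> in all.\<close>
  define \<epsilon> where "\<epsilon> r = \<eta> * ((1/2) ^ row r * (1/2) ^ col r) / (real (Suc r) * s 1 + 1)" for r
  have s1: "0 < s 1" by (rule s_pos) simp
  have dpos: "0 < real (Suc r) * s 1 + 1" for r using s1 by (intro add_nonneg_pos) auto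
  have e: "0 < \<epsilon> r" for r unfolding \<epsilon>_def using \<eta> dpos by (intro divide_pos_pos mult_pos_pos) auto
  have "\<exists>n n' B. separating T row \<epsilon> n n' B" by (rule separating_exists[OF T e])
  then obtain n where "\<exists>n' B. separating T row \<epsilon> n n' B" ..
  then obtain n' where "\<exists>B. separating T row \<epsilon> n n' B" ..
  then obtain B where "separating T row \<epsilon> n n' B" ..
  note nB = this[unfolded separating_def]
  note n = nB[THEN conjunct1] nB[THEN conjunct2, THEN conjunct1]
  note nB' = nB[THEN conjunct2, THEN conjunct2]
  note later = nB'[THEN conjunct1, rule_format]
    and lower = nB'[THEN conjunct2, THEN conjunct1, rule_format]
    and cross = nB'[THEN conjunct2, THEN conjunct2, THEN conjunct1, rule_format]
    and upper = nB'[THEN conjunct2, THEN conjunct2, THEN conjunct2, rule_format]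
  define \<tau> where "\<tau> k j = n (prod_encode (k, j))" for k j
  define \<tau>' where "\<tau>' k j = n' (prod_encode (k, j))" for k j
  have inj\<tau>: "inj (\<tau> k)" "inj (\<tau>' k)" for k
    by (rule injI, simp add: \<tau>_def \<tau>'_def inj_eq[OF n(1)] inj_eq[OF n(2)])+
  have \<tau>r: "\<tau> (row r) (col r) = n r" "\<tau>' (row r) (col r) = n' r" for r
    by (simp_all add: \<tau>_def \<tau>'_def row_def col_def)
  define S where "S = (spread id \<tau> :: (nat \<Rightarrow> nat \<Rightarrow> 'f) \<Rightarrow> _)"
  have S: "bounded_operator L L S" unfolding S_def by (rule bop_spread[OF inj_on_id inj\<tau>(1)])
  define R where "R f = (\<lambda>k j. f k (\<tau> k j)) - (\<lambda>k j. f k (\<tau>' k j))" for f :: "nat \<Rightarrow> nat \<Rightarrow> 'f"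
  have R: "bounded_operator L L R"
    unfolding R_def[abs_def]
    using bop_operator_diff[OF ns ns bop_restrict[OF inj_on_id inj\<tau>(1)] bop_restrict[OF inj_on_id inj\<tau>(2)]]
    by simp
  \<comment> \<open>The diagonal of \<open>T\<close> alone; what coordinate
    \<open>\<tau>' k j\<close> subtracts from it is counted as an error.\<close>
  define \<mu> where "\<mu> k j = T (unit_at k (\<tau> k j)) k (\<tau> k j)" for k j
  have \<mu>: "1/2 \<le> norm (\<mu> k j)" for k j unfolding \<mu>_def by (rule diag)
  have \<mu>0: "\<mu> k j \<noteq> 0" for k j using \<mu>[of k j] by auto
  have inv\<mu>: "norm (inverse (\<mu> k j)) \<le> 2" for k j
    using le_imp_inverse_le[OF \<mu>[of k j]] by (simp add: norm_inverse)
  define C where "C f = (\<lambda>k j. inverse (\<mu> k j) * f k j)" for f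
  have C: "bounded_operator L L C" unfolding C_def[abs_def] by (rule bop_multiplier[OF inv\<mu>])
  define G where "G f = C (R (T (S f)))" for f
  note RT = bop_compose[OF ns ns T R]
  have CRT: "bounded_operator L L (\<lambda>f. C (R (T f)))" by (rule bop_compose[OF ns ns RT C])
  have G: "bounded_operator L L G" unfolding G_def[abs_def] by (rule bop_compose[OF ns ns S CRT])
  have near: "nrm L (G f - f) \<le> 1/2 * nrm L f" if f: "f \<in> car L" for f
  proof -
    define g where "g = S f"
    have g: "g \<in> car L" "nrm L g \<le> nrm L f"
      unfolding g_def S_def using spread_L[where \<tau> = \<tau>, OF inj_on_id inj\<tau>(1) f] by blast+
    have gat: "g (row q) (n q) = f (row q) (col q)" for q
      unfolding g_def S_def using spread_at[where \<kappa> = id and \<tau> = \<tau>, OF inj_on_id inj\<tau>(1), of f "row q" "col q"] by (simp add: \<tau>r)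
    have g0: "g k m = 0" if "\<And>q. k = row q \<Longrightarrow> m \<noteq> n q" for k m
      unfolding g_def S_def
    proof (rule spread_eq_0[where \<kappa> = id and \<tau> = \<tau>, OF inj_on_id inj\<tau>(1)])
      fix k' j assume "k = id k'" "m = \<tau> k' j"
      then show "f k' j = 0" using that[of "prod_encode (k', j)"] by (simp add: \<tau>_def row_def)
    qed
    have bound: "norm (G f k j - f k j) \<le> 2 * \<eta> * nrm L f * norm (geometric k j :: 'f)" for k j
    proof -
      define r where "r = prod_encode (k, j)"
      have r: "row r = k" "col r = j" by (simp_all add: r_def row_def col_def)
      define \<phi> where "\<phi> h = T h k (n r) - T h k (n' r)" for h
      have \<phi>: "bounded_operator L scalars \<phi>"
        unfolding \<phi>_def[abs_def]
        by (intro bop_operator_diff ns normed_space_scalars bop_compose[OF ns ns T bop_coordinate])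
      define v where "v q = g (row q) (n q)" for q
      have v: "norm (v q) \<le> s 1 * nrm L f" for q
        using L_component[OF g(1), of "row q" "n q"] mult_left_mono[OF g(2), of "s 1"] s1 unfolding v_def by linarith
      define u where "u q = (unit_at (row q) (n q) :: nat \<Rightarrow> nat \<Rightarrow> 'f)" for q
      have u: "u q \<in> car L" for q using unit_at_L unfolding u_def by blast
      \<comment> \<open>The part of \<open>g\<close> at places chosen after stage \<open>r\<close>.
        These places lie in \<open>B r\<close>, so the smallness of the functional applies to it as
        a whole.\<close>
      define rest where "rest = (\<lambda>k m. if \<exists>q\<le>r. k = row q \<and> m = n q then 0 else g k m)"
      have rest: "rest \<in> car L \<and> nrm L rest \<le> nrm L g" by (rule L_solid[OF g(1)]) (simp add: rest_def)
      have sup: "supported (B r) rest"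
        unfolding supported_def
      proof (intro allI impI)
        fix k m assume m: "m \<notin> B r k"
        show "rest k m = 0"
        proof (rule ccontr)
          assume "rest k m \<noteq> 0"
          then have "g k m \<noteq> 0" "\<not> (\<exists>q\<le>r. k = row q \<and> m = n q)" by (auto simp: rest_def split: if_splits)
          then obtain q where "k = row q" "m = n q" "r < q" using g0 by (metis not_le)
          then show False using later m by blast
        qed
      qed
      \<comment> \<open>A finite sum plus a remainder: linearity suffices, and no convergence of an
        expansion in unit vectors is involved.\<close>
      have split: "g = (\<Sum>q\<le>r. scl L (v q) (u q)) + rest"
      proof (intro ext)
        fix k m
        have "(\<Sum>q\<le>r. scl L (v q) (u q)) k m = (\<Sum>q\<le>r. if k = row q \<and> m = n q then v q else 0)"
          by (simp add: sum_apply scl_L u_def unit_at_def if_distrib cong: if_cong)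
        also have "\<dots> = (if \<exists>q\<le>r. k = row q \<and> m = n q then g k m else 0)"
        proof (cases "\<exists>q\<le>r. k = row q \<and> m = n q")
          case True
          then obtain q0 where q0: "q0 \<le> r" "k = row q0" "m = n q0" by blast
          have "(\<Sum>q\<le>r. if k = row q \<and> m = n q then v q else 0) = (\<Sum>q\<le>r. if q = q0 then v q else 0)"
            using q0 injD[OF n(1)] by (intro sum.cong) auto
          then show ?thesis using True q0 by (simp add: v_def)
        next
          case False
          then show ?thesis by (auto intro!: sum.neutral)
        qed
        finally show "g k m = ((\<Sum>q\<le>r. scl L (v q) (u q)) + rest) k m"
          by (cases "\<exists>q\<le>r. k = row q \<and> m = n q")
            (simp_all only: plus_fun_apply rest_def if_True if_False add_0_right add_0_left simp_thms)
      qed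
      have vu: "scl L (v q) (u q) \<in> car L" for q by (rule nspace_scl[OF ns u])
      have "\<phi> g = (\<Sum>q\<le>r. v q * \<phi> (u q)) + \<phi> rest"
        by (subst split) (simp add: bop_add[OF \<phi> nspace_sum[OF ns vu] conjunct1[OF rest]]
          bop_sum[OF ns \<phi> vu] bop_scl[OF \<phi> u])
      also have "(\<Sum>q\<le>r. v q * \<phi> (u q)) = (\<Sum>q<r. v q * \<phi> (u q)) + v r * \<phi> (u r)"
        by (simp add: lessThan_Suc_atMost[symmetric])
      also have "\<phi> (u r) = \<mu> k j - T (u r) k (n' r)"
        by (simp add: \<phi>_def \<mu>_def u_def r \<tau>_def r_def[symmetric])
      finally have "\<phi> g - v r * \<mu> k j = (\<Sum>q<r. v q * \<phi> (u q)) + (\<phi> rest - v r * T (u r) k (n' r))"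
        by (simp add: algebra_simps)
      then have "norm (\<phi> g - v r * \<mu> k j) \<le> norm (\<Sum>q<r. v q * \<phi> (u q)) + norm (\<phi> rest - v r * T (u r) k (n' r))"
        by (simp only: norm_triangle_ineq)
      also have "\<dots> \<le> (\<Sum>q<r. norm (v q * \<phi> (u q))) + (norm (\<phi> rest) + norm (v r * T (u r) k (n' r)))"
        by (intro add_mono norm_sum norm_triangle_ineq4)
      also have "\<dots> \<le> (\<Sum>q<r. s 1 * nrm L f * \<epsilon> r) + (\<epsilon> r * nrm L f + s 1 * nrm L f * \<epsilon> r)"
      proof (intro add_mono sum_mono)
        fix q assume "q \<in> {..<r}"
        then have "norm (\<phi> (u q)) \<le> \<epsilon> r" using lower[of q r] by (simp add: \<phi>_def u_def r)
        then show "norm (v q * \<phi> (u q)) \<le> s 1 * nrm L f * \<epsilon> r"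
          unfolding norm_mult using v by (intro mult_mono') auto
      next
        have "norm (\<phi> rest) \<le> \<epsilon> r * nrm L rest" using upper[OF conjunct1[OF rest] sup] by (simp add: \<phi>_def r)
        also have "\<dots> \<le> \<epsilon> r * nrm L f" using rest g(2) e[of r] by (intro mult_left_mono) auto
        finally show "norm (\<phi> rest) \<le> \<epsilon> r * nrm L f" .
        have "norm (T (u r) k (n' r)) \<le> \<epsilon> r" using cross[of r] by (simp add: u_def r)
        then show "norm (v r * T (u r) k (n' r)) \<le> s 1 * nrm L f * \<epsilon> r"
          unfolding norm_mult using v by (intro mult_mono') auto
      qed
      also have "\<dots> = \<epsilon> r * (real (Suc r) * s 1 + 1) * nrm L f" by (simp add: algebra_simps)
      also have "\<epsilon> r * (real (Suc r) * s 1 + 1) = \<eta> * ((1/2) ^ k * (1/2) ^ j)"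
        using dpos[of r] by (simp add: \<epsilon>_def r)
      finally have est: "norm (\<phi> g - v r * \<mu> k j) \<le> \<eta> * ((1/2) ^ k * (1/2) ^ j) * nrm L f" .
      have "G f k j - f k j = inverse (\<mu> k j) * (\<phi> g - v r * \<mu> k j)"
        using \<mu>0[of k j] gat[of r]
        by (simp add: G_def C_def R_def g_def[symmetric] \<phi>_def \<tau>_def \<tau>'_def r_def[symmetric] v_def r field_simps)
      then have "norm (G f k j - f k j) = norm (inverse (\<mu> k j)) * norm (\<phi> g - v r * \<mu> k j)"
        by (simp only: norm_mult)
      also have "\<dots> \<le> 2 * (\<eta> * ((1/2) ^ k * (1/2) ^ j) * nrm L f)"
        using est inv\<mu> by (intro mult_mono) auto
      finally show ?thesis by (simp add: geometric_def norm_mult norm_power norm_divide mult_ac)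
    qed
    have nf: "0 \<le> nrm L f" by (rule nspace_nonneg[OF ns f])
    have c: "norm (of_real (2 * \<eta> * nrm L f) :: 'f) = 2 * \<eta> * nrm L f"
      unfolding norm_of_real using \<eta>(1) nf by simp
    \<comment> \<open>Solidity turns the entrywise bound into a norm bound.\<close>
    have "nrm L (G f - f) \<le> nrm L (scl L (of_real (2 * \<eta> * nrm L f)) (geometric :: nat \<Rightarrow> nat \<Rightarrow> 'f))"
      using bound by (intro conjunct2[OF L_solid] nspace_scl[OF ns geometric_L]) (simp only: scl_L norm_mult c fun_diff_def)
    also have "\<dots> = 2 * \<eta> * nrm L f * D" unfolding nspace_nscl[OF ns geometric_L] c D_def ..
    also have "\<dots> = 2 * \<eta> * D * nrm L f" by simp
    also have "\<dots> \<le> 1/2 * nrm L f" using \<eta>(2) nf by (rule mult_right_mono)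
    finally show ?thesis .
  qed
  obtain V where V: "bounded_operator L L V" "\<And>f. f \<in> car L \<Longrightarrow> V (G f) = f"
    using near_identity_left_inverse[OF banach_space_L G near] by blast
  have rows: "\<forall>f\<in>car L. \<forall>k. f k = 0 \<longrightarrow> S f k = 0"
    by (auto simp: S_def spread_def)
  have VG: "\<forall>f\<in>car L. V (C (R (T (S f)))) = f" using V(2) by (simp add: G_def)
  show ?thesis
  proof (rule exI[of _ S], rule exI[of _ "\<lambda>f. V (C (R f))"], intro conjI)
    show "bounded_operator L L (\<lambda>f. V (C (R f)))" by (rule bop_compose[OF ns ns bop_compose[OF ns ns R C] V(1)])
  qed (fact S VG rows)+
qed

text \<open>The pigeonhole principle twice: every row has infinitely many entries of one of the two
  kinds, and one kind prevails in infinitely many rows. Enumerating these rows and entries gives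
  \<open>\<kappa>\<close> and \<open>\<tau>\<close>.\<close>

lemma diagonal_dichotomy:
  fixes x :: "nat \<Rightarrow> nat \<Rightarrow> 'a::real_normed_field"
  shows "\<exists>(\<kappa> :: nat \<Rightarrow> nat) (\<tau> :: nat \<Rightarrow> nat \<Rightarrow> nat). inj \<kappa> \<and> (\<forall>k. inj (\<tau> k)) \<and>
    ((\<forall>k j. 1/2 \<le> norm (x (\<kappa> k) (\<tau> k j))) \<or> (\<forall>k j. 1/2 \<le> norm (1 - x (\<kappa> k) (\<tau> k j))))"
proof -
  have cols: "\<exists>(\<kappa> :: nat \<Rightarrow> nat) (\<tau> :: nat \<Rightarrow> nat \<Rightarrow> nat). inj \<kappa> \<and> (\<forall>k. inj (\<tau> k)) \<and> (\<forall>k j. \<tau> k j \<in> E (\<kappa> k))"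
    if inf: "infinite {k. infinite (E k)}" for E :: "nat \<Rightarrow> nat set"
  proof -
    define \<kappa> where "\<kappa> = enumerate {k. infinite (E k)}"
    have \<kappa>: "inj \<kappa>" unfolding \<kappa>_def by (rule strict_mono_imp_inj_on[OF strict_mono_enumerate[OF inf]])
    have inf': "infinite (E (\<kappa> k))" for k
      using enumerate_in_set[OF inf, of k] by (simp add: \<kappa>_def)
    have inj: "inj (enumerate (E (\<kappa> k)))" for k
      by (rule strict_mono_imp_inj_on[OF strict_mono_enumerate[OF inf']])
    show ?thesis
      by (rule exI[of _ \<kappa>], rule exI[of _ "\<lambda>k. enumerate (E (\<kappa> k))"])
        (simp add: \<kappa> inj enumerate_in_set[OF inf'])
  qed
  define E where "E k = {j. 1/2 \<le> norm (x k j)}" for k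
  define F where "F k = {j. 1/2 \<le> norm (1 - x k j)}" for k
  have EF: "E k \<union> F k = UNIV" for k
  proof -
    have "1/2 \<le> norm (x k j) \<or> 1/2 \<le> norm (1 - x k j)" for j
      using norm_triangle_ineq[of "x k j" "1 - x k j"] by auto
    then show ?thesis by (auto simp: E_def F_def)
  qed
  have "infinite (E k) \<or> infinite (F k)" for k
    using EF[of k] by (metis finite_UnI infinite_UNIV_nat)
  then have "{k. infinite (E k)} \<union> {k. infinite (F k)} = UNIV" by auto
  then consider "infinite {k. infinite (E k)}" | "infinite {k. infinite (F k)}"
    by (metis finite_UnI infinite_UNIV_nat)
  then show ?thesis
  proof cases
    case 1 then show ?thesis using cols[of E] unfolding E_def by (metis mem_Collect_eq)
  next
    case 2 then show ?thesis using cols[of F] unfolding F_def by (metis mem_Collect_eq)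
  qed
qed

text \<open>If \<open>T\<close> acts row by row, the last condition confines \<open>T \<circ> S\<close> on row 0 to the single row \<open>m\<close>, which turns
  the factorization on \<open>\<ell>\<^sub>p(m(s))\<close> into one on \<open>m(s)\<close>.\<close>

definition row_factorization ::
    "((nat \<Rightarrow> nat \<Rightarrow> 'f::{real_normed_field, euclidean_space}) \<Rightarrow> nat \<Rightarrow> nat \<Rightarrow> 'f) \<Rightarrow>
     ((nat \<Rightarrow> nat \<Rightarrow> 'f) \<Rightarrow> nat \<Rightarrow> nat \<Rightarrow> 'f) \<Rightarrow> ((nat \<Rightarrow> nat \<Rightarrow> 'f) \<Rightarrow> nat \<Rightarrow> nat \<Rightarrow> 'f) \<Rightarrow> nat \<Rightarrow> bool" where
  "row_factorization T S U m \<longleftrightarrow>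
     bounded_operator L L S \<and> bounded_operator L L U \<and> (\<forall>f\<in>car L. U (T (S f)) = f) \<and>
     (\<forall>f\<in>car L. (\<forall>k. k \<noteq> 0 \<longrightarrow> f k = 0) \<longrightarrow> (\<forall>k. k \<noteq> m \<longrightarrow> S f k = 0))"

definition row_factors :: "((nat \<Rightarrow> nat \<Rightarrow> 'f::{real_normed_field, euclidean_space}) \<Rightarrow> nat \<Rightarrow> nat \<Rightarrow> 'f) \<Rightarrow> bool" where
  "row_factors T \<longleftrightarrow> (\<exists>S U m. row_factorization T S U m)"

text \<open>Compressing \<open>T\<close> to the selected places yields an operator with large
  diagonal everywhere, as \<open>spread\<close> maps unit vectors to unit vectors.\<close>

lemma row_factors_of_large_entries:
  fixes T :: "(nat \<Rightarrow> nat \<Rightarrow> 'f::{real_normed_field, euclidean_space}) \<Rightarrow> nat \<Rightarrow> nat \<Rightarrow> 'f"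
    and \<kappa> :: "nat \<Rightarrow> nat" and \<tau> :: "nat \<Rightarrow> nat \<Rightarrow> nat"
  assumes T: "bounded_operator L L T" and inj: "inj \<kappa>" "\<And>k. inj (\<tau> k)"
    and large: "\<And>k j. 1/2 \<le> norm (T (unit_at (\<kappa> k) (\<tau> k j)) (\<kappa> k) (\<tau> k j))"
  shows "row_factors T"
proof -
  have ns: "normed_space (L :: ('f, _) nspace)" by (rule normed_space_L)
  define E where "E = (spread \<kappa> \<tau> :: (nat \<Rightarrow> nat \<Rightarrow> 'f) \<Rightarrow> _)"
  define R where "R f = (\<lambda>k j. f (\<kappa> k) (\<tau> k j))" for f :: "nat \<Rightarrow> nat \<Rightarrow> 'f"
  have E: "bounded_operator L L E" unfolding E_def by (rule bop_spread[OF inj])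
  have R: "bounded_operator L L R" unfolding R_def[abs_def] by (rule bop_restrict[OF inj])
  have RTE: "bounded_operator L L (\<lambda>f. R (T (E f)))"
    by (rule bop_compose[OF ns ns bop_compose[OF ns ns E T] R])
  have "1/2 \<le> norm (R (T (E (unit_at k j))) k j)" for k j
    unfolding R_def E_def spread_unit_at[OF inj] by (rule large)
  from factor_of_large_diagonal[OF RTE this]
  obtain S U where S: "bounded_operator L L S" and U: "bounded_operator L L U"
    and id: "\<forall>f\<in>car L. U (R (T (E (S f)))) = f" and rows: "\<forall>f\<in>car L. \<forall>k. f k = 0 \<longrightarrow> S f k = 0" by blast
  \<comment> \<open>The operator \<open>S\<close> keeps an element of row 0 in row 0, and
    \<open>E\<close> moves it to row \<open>\<kappa> 0\<close>, which is the row \<open>m\<close> of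
    the factorization.\<close>
  have rows_E: "E (S f) k = 0" if f: "f \<in> car L" and 0: "\<forall>k. k \<noteq> 0 \<longrightarrow> f k = 0" and k: "k \<noteq> \<kappa> 0" for f k
  proof
    fix m
    show "E (S f) k m = 0 m"
      unfolding E_def
    proof (subst spread_eq_0[OF inj])
      fix k' j assume "k = \<kappa> k'"
      then have "f k' = 0" using k 0 by (cases "k' = 0") auto
      then show "S f k' j = 0" using rows f by auto
    qed simp
  qed
  show ?thesis
    unfolding row_factors_def row_factorization_def
  proof (rule exI[of _ "\<lambda>f. E (S f)"], rule exI[of _ "\<lambda>f. U (R f)"], rule exI[of _ "\<kappa> 0"], intro conjI)
    show "bounded_operator L L (\<lambda>f. E (S f))" by (rule bop_compose[OF ns ns S E])
    show "bounded_operator L L (\<lambda>f. U (R f))" by (rule bop_compose[OF ns ns R U])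
    show "\<forall>f\<in>car L. (\<forall>k. k \<noteq> 0 \<longrightarrow> f k = 0) \<longrightarrow> (\<forall>k. k \<noteq> \<kappa> 0 \<longrightarrow> E (S f) k = 0)"
      using rows_E by blast
  qed (fact id)
qed

lemma row_factors_dichotomy:
  fixes T :: "(nat \<Rightarrow> nat \<Rightarrow> 'f::{real_normed_field, euclidean_space}) \<Rightarrow> nat \<Rightarrow> nat \<Rightarrow> 'f"
  assumes T: "bounded_operator L L T"
  shows "row_factors T \<or> row_factors (\<lambda>x. x - T x)"
proof -
  have ns: "normed_space (L :: ('f, _) nspace)" by (rule normed_space_L)
  obtain \<kappa> :: "nat \<Rightarrow> nat" and \<tau> :: "nat \<Rightarrow> nat \<Rightarrow> nat" where inj: "inj \<kappa>" "\<And>k. inj (\<tau> k)"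
    and d: "(\<forall>k j. 1/2 \<le> norm (T (unit_at (\<kappa> k) (\<tau> k j)) (\<kappa> k) (\<tau> k j))) \<or>
      (\<forall>k j. 1/2 \<le> norm (1 - T (unit_at (\<kappa> k) (\<tau> k j)) (\<kappa> k) (\<tau> k j)))"
    using diagonal_dichotomy[of "\<lambda>k j. T (unit_at k j) k j"] by blast
  from d show ?thesis
  proof
    assume "\<forall>k j. 1/2 \<le> norm (T (unit_at (\<kappa> k) (\<tau> k j)) (\<kappa> k) (\<tau> k j))"
    then have "row_factors T" by (intro row_factors_of_large_entries[where \<tau> = \<tau>, OF T inj]) simp
    then show ?thesis ..
  next
    assume "\<forall>k j. 1/2 \<le> norm (1 - T (unit_at (\<kappa> k) (\<tau> k j)) (\<kappa> k) (\<tau> k j))"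
    then have "1/2 \<le> norm ((unit_at (\<kappa> k) (\<tau> k j) - T (unit_at (\<kappa> k) (\<tau> k j))) (\<kappa> k) (\<tau> k j))" for k j
      by (simp add: unit_at_def)
    then have "row_factors (\<lambda>x. x - T x)"
      by (rule row_factors_of_large_entries[where \<tau> = \<tau>, OF bop_id_minus[OF ns ns T] inj])
    then show ?thesis ..
  qed
qed

section \<open>From row factorizations to the two spaces\<close>

lemma row_factors_imp_factors:
  assumes "row_factors T"
  shows "identity_factors_through L T"
proof -
  obtain S U m where "row_factorization T S U m" using assms unfolding row_factors_def by (elim exE)
  then have "bounded_operator L L S \<and> bounded_operator L L U \<and> (\<forall>f\<in>car L. U (T (S f)) = f)"
    by (simp add: row_factorization_def)
  then show ?thesis
    unfolding identity_factors_through_def by (rule exI[of _ S, OF exI[of _ U]])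
qed

text \<open>The maps are cut down to single rows: embed into row 0, apply \<open>S\<close>, read row
  \<open>m\<close>; then embed into row \<open>m\<close>, apply \<open>U\<close>, read row
  0.\<close>

lemma row_factors_imp_factors_M:
  fixes T :: "(nat \<Rightarrow> 'f::{real_normed_field, euclidean_space}) \<Rightarrow> nat \<Rightarrow> 'f"
  assumes T: "bounded_operator M M T" and rf: "row_factors (\<lambda>f k. T (f k))"
  shows "identity_factors_through M T"
proof -
  have nL: "normed_space (L :: ('f, _) nspace)" by (rule normed_space_L)
  have nM: "normed_space (M :: ('f, _) nspace)" by (rule normed_space_M)
  obtain S U m where SU: "row_factorization (\<lambda>f k. T (f k)) S U m" using rf unfolding row_factors_def by (elim exE)
  have S: "bounded_operator L L S" and U: "bounded_operator L L U"
    and id: "\<And>f. f \<in> car L \<Longrightarrow> U (\<lambda>k. T (S f k)) = f"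
    and rows: "\<And>f k. f \<in> car L \<Longrightarrow> \<forall>k. k \<noteq> 0 \<longrightarrow> f k = 0 \<Longrightarrow> k \<noteq> m \<Longrightarrow> S f k = 0"
    using SU by (simp_all add: row_factorization_def)
  define J where "J k x = (\<lambda>i. if i = k then x else 0)" for k :: nat and x :: "nat \<Rightarrow> 'f"
  have J: "bounded_operator M L (J k)" for k
  proof (rule bounded_operatorI[where K = 1])
    fix x :: "nat \<Rightarrow> 'f" assume x: "x \<in> car M"
    have "J k x \<in> car L \<and> nrm L (J k x) \<le> lp_norm p (\<lambda>i. if i = k then nrm M x else 0)"
      by (rule lp_sum_bounded_by[OF p nM])
        (use lp_single[OF p] x in \<open>auto simp: J_def nspace_zero[OF nM] nspace_nrm_zero[OF nM]\<close>)
    then show "J k x \<in> car L" "nrm L (J k x) \<le> 1 * nrm M x"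
      using lp_single[OF p, of k "nrm M x"] nspace_nonneg[OF nM x] by auto
  qed (auto simp: J_def fun_eq_iff scl_L marcinkiewicz_simps)
  have P: "bounded_operator L M (\<lambda>f :: nat \<Rightarrow> nat \<Rightarrow> 'f. f k)" for k
    by (rule bounded_operatorI[where K = 1])
      (auto simp: lp_sum_component[OF p nM] lp_sum_simps(2))
  have id_M: "U (J m (T (S (J 0 x) m))) 0 = x" if x: "x \<in> car M" for x
  proof -
    note Jx = bop_car[OF J x, of 0]
    \<comment> \<open>Outside row \<open>m\<close> the element \<open>S (J 0 x)\<close> vanishes and
      \<open>T 0 = 0\<close>, so nothing is lost by reading only row \<open>m\<close>.\<close>
    have "(\<lambda>k. T (S (J 0 x) k)) = J m (T (S (J 0 x) m))"
    proof
      fix k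
      show "T (S (J 0 x) k) = J m (T (S (J 0 x) m)) k"
        using rows[OF Jx, of k] bop_zero[OF nM T] by (cases "k = m") (auto simp: J_def)
    qed
    then have "U (J m (T (S (J 0 x) m))) = J 0 x" using id[OF Jx] by simp
    then show ?thesis by (simp add: J_def)
  qed
  have S_M: "bounded_operator M M (\<lambda>x. S (J 0 x) m)"
    by (rule bop_compose[OF nM nL J bop_compose[OF nL nL S P]])
  have U_M: "bounded_operator M M (\<lambda>x. U (J m x) 0)"
    by (rule bop_compose[OF nM nL J bop_compose[OF nL nL U P]])
  show ?thesis
    unfolding identity_factors_through_def
    by (rule exI[of _ "\<lambda>x. S (J 0 x) m"], rule exI[of _ "\<lambda>x. U (J m x) 0"]) (simp add: S_M U_M id_M)
qed

lemma factors_dichotomy_M: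
  fixes T :: "(nat \<Rightarrow> 'f::{real_normed_field, euclidean_space}) \<Rightarrow> nat \<Rightarrow> 'f"
  assumes T: "bounded_operator M M T"
  shows "identity_factors_through M T \<or> identity_factors_through M (\<lambda>x. x - T x)"
proof -
  have nM: "normed_space (M :: ('f, _) nspace)" by (rule normed_space_M)
  \<comment> \<open>Subtracting the row-by-row operator from the identity gives the row-by-row
    operator of \<open>Id - T\<close>, so both alternatives descend to \<open>M\<close>.\<close>
  have "(\<lambda>f :: nat \<Rightarrow> nat \<Rightarrow> 'f. f - (\<lambda>k. T (f k))) = (\<lambda>f k. f k - T (f k))" by (simp add: fun_eq_iff)
  then show ?thesis
    using row_factors_dichotomy[OF bop_lp_sum[OF p nM nM T]] row_factors_imp_factors_M[OF T]
      row_factors_imp_factors_M[OF bop_id_minus[OF nM nM T]] by auto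
qed

end

theorem corollary3p6:
  fixes p :: ereal and s w :: "nat \<Rightarrow> real"
    and M :: "('f::{real_normed_field, euclidean_space}, nat \<Rightarrow> 'f) nspace"
    and L :: "('f, nat \<Rightarrow> nat \<Rightarrow> 'f) nspace"
  defines "M \<equiv> marcinkiewicz s"
    and "L \<equiv> lp_sum p (marcinkiewicz s)"
  assumes p: "1 \<le> p"
    and s: "weight s" "mono_on {1..} s"
    and w: "discrete_derivative s w" "essentially_decreasing w"
    and inf_sup: "(INF n\<in>{1..}. SUP k\<in>{1..}. s k / s (k * n)) = 0"
  shows "(\<forall>T. bounded_operator M M T \<longrightarrow>
             identity_factors_through M T \<or> identity_factors_through M (\<lambda>x. x - T x))
       \<and> (\<forall>T. bounded_operator L L T \<longrightarrow>
             identity_factors_through L T \<or> identity_factors_through L (\<lambda>x. x - T x))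
       \<and> primary TYPE('v::ab_group_add) TYPE('w::ab_group_add) L"
proof -
  interpret marcinkiewicz_sum s w p
    using p s w inf_sup by unfold_locales
  have L: "identity_factors_through L T \<or> identity_factors_through L (\<lambda>x. x - T x)"
    if "bounded_operator L L T" for T
    using row_factors_dichotomy[of T] row_factors_imp_factors that unfolding L_def by blast
  then have "primary TYPE('v) TYPE('w) L"
    unfolding L_def by (rule primary_lp_sum[OF p banach_space_M])
  then show ?thesis using L factors_dichotomy_M unfolding M_def by blast
qed

end
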